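(* Let $t,u,v\in\mathrm{ACol}(C_n)$ and $w=tuv$, and let $w^0$ be the highest weight word of the connected component of $w$ in the crystal graph on $\mathrm{ACol}(C_n)^*$. Then $\mathrm{conf}(w)=\mathrm{conf}(w^0)$.
   Context: Setting: $C_n=\{1<\cdots<n<\overline n<\cdots<\overline1\}$ with its type $C$ crystal graph; Kashiwara operators act on $C_n^*$ by the tensor product rule. Columns, admissible columns, $\preceq$, tableau words, $Pl(C_n)$ and column insertion are the standard type $C$ notions (Lecouvey). $\mathrm{ACol}(C_n)$ is the set of admissible columns together with an extra symbol $\epsilon$; $p:\mathrm{ACol}(C_n)^*\to C_n^*$ sends $\epsilon$ to the empty word and each admissible column to itself. $\preceq$ is extended by $c\preceq\epsilon$ for all $c$ and $\epsilon\not\preceq c$ for $c\ne\epsilon$; $(c_1\leftarrow c_2)\in\mathrm{ACol}(C_n)^2$ is $d_1d_2$, $\epsilon d$, or $\epsilon\epsilon$ according as the tableau word of $p(c_1)p(c_2)$ is $d_1d_2$, one column $d$, or empty. $\mathbf{ACol}$ is the (convergent) 2-polygraph with generators $\mathrm{ACol}(C_n)$ and rules $c_1c_2\Rightarrow(c_1\leftarrow c_2)$ for $c_2\not\preceq c_1$. Crystal structure on $\mathrm{ACol}(C_n)^*$: $f_iw$ (resp. $e_iw$) is defined iff $f_ip(w)$ (resp. $e_ip(w)$) is defined, and then is obtained by replacing the column of $w$ containing the modified letter by the modified column; $w$ is of highest weight if no $e_i$ is defined on it. For a word $w$ of three letters of $\mathrm{ACol}(C_n)$, let $a(w)$ be the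 longest sequence of rewriting steps starting from $w$ that alternately rewrites the pair in positions $(1,2)$, then $(2,3)$, then $(1,2)$, etc., starting with positions $(1,2)$ (the leftmost reduction strategy), and $b(w)$ the analogous longest alternating sequence starting with positions $(2,3)$ (the rightmost reduction strategy). Both are finite and end at the normal form of $w$. The confluence pair is $\mathrm{conf}(w)=(|a(w)|,|b(w)|)$, the numbers of rewriting steps. *)

theory Defs
  imports Main
begin

text \<open>Letters of C_n are encoded as nonzero integers: the unbarred letter i is the
integer i, the barred letter bar i is the integer -i (1 <= i <= n).
The total order 1 < ... < n < bar n < ... < bar 1 is given by the key lkey.\<close>

definition is_letter :: "nat \<Rightarrow> int \<Rightarrow> bool" where
  "is_letter n x \<longleftrightarrow> x \<noteq> 0 \<and> \<bar>x\<bar> \<le> int n"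

definition lkey :: "nat \<Rightarrow> int \<Rightarrow> int" where
  "lkey n x = (if x > 0 then x else 2 * int n + 1 + x)"

definition lle :: "nat \<Rightarrow> int \<Rightarrow> int \<Rightarrow> bool" where
  "lle n x y \<longleftrightarrow> lkey n x \<le> lkey n y"

definition lless :: "nat \<Rightarrow> int \<Rightarrow> int \<Rightarrow> bool" where
  "lless n x y \<longleftrightarrow> lkey n x < lkey n y"

definition fl :: "nat \<Rightarrow> nat \<Rightarrow> int \<Rightarrow> int option" where
  "fl n i x =
    (if 1 \<le> i \<and> i < n then
       (if x = int i then Some (int i + 1) else if x = - (int i + 1) then Some (- int i) else None)
     else if i = n \<and> 1 \<le> n then (if x = int n then Some (- int n) else None)
     else None)"

definition el :: "nat \<Rightarrow> nat \<Rightarrow> int \<Rightarrow> int option" where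
  "el n i x =
    (if 1 \<le> i \<and> i < n then
       (if x = int i + 1 then Some (int i) else if x = - int i then Some (- (int i + 1)) else None)
     else if i = n \<and> 1 \<le> n then (if x = - int n then Some (int n) else None)
     else None)"

definition cnt :: "('a \<Rightarrow> bool) \<Rightarrow> 'a list \<Rightarrow> nat" where
  "cnt P xs = length (filter P xs)"

text \<open>Tensor product rule (Kashiwara's convention, as in Lecouvey): each letter on which
f_i is defined gives a +, each letter on which e_i is defined gives a -; the pairs (+,-)
(with + to the left) are cancelled recursively.  f_i acts on the leftmost uncancelled +,
e_i on the rightmost uncancelled -.  A + at position j is uncancelled iff in every
nonempty segment starting right after j there are at most as many - as +.\<close>

definition free_plus :: "nat \<Rightarrow> nat \<Rightarrow> int list \<Rightarrow> nat \<Rightarrow> bool" where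
  "free_plus n i w j \<longleftrightarrow> j < length w \<and> fl n i (w ! j) \<noteq> None \<and>
     (\<forall>m. cnt (\<lambda>x. el n i x \<noteq> None) (take m (drop (Suc j) w))
          \<le> cnt (\<lambda>x. fl n i x \<noteq> None) (take m (drop (Suc j) w)))"

definition free_minus :: "nat \<Rightarrow> nat \<Rightarrow> int list \<Rightarrow> nat \<Rightarrow> bool" where
  "free_minus n i w j \<longleftrightarrow> j < length w \<and> el n i (w ! j) \<noteq> None \<and>
     (\<forall>m. cnt (\<lambda>x. fl n i x \<noteq> None) (drop m (take j w))
          \<le> cnt (\<lambda>x. el n i x \<noteq> None) (drop m (take j w)))"

definition fw :: "nat \<Rightarrow> nat \<Rightarrow> int list \<Rightarrow> int list option" where
  "fw n i w =
    (if \<exists>j. free_plus n i w j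
     then (let j = (LEAST j. free_plus n i w j) in Some (w[j := the (fl n i (w ! j))]))
     else None)"

definition ew :: "nat \<Rightarrow> nat \<Rightarrow> int list \<Rightarrow> int list option" where
  "ew n i w =
    (if \<exists>j. free_minus n i w j
     then (let j = (GREATEST j. free_minus n i w j) in Some (w[j := the (el n i (w ! j))]))
     else None)"

definition is_column :: "nat \<Rightarrow> int list \<Rightarrow> bool" where
  "is_column n c \<longleftrightarrow> (\<forall>x\<in>set c. is_letter n x) \<and> sorted_wrt (lless n) c"

definition Ncount :: "nat \<Rightarrow> int list \<Rightarrow> int \<Rightarrow> int" where
  "Ncount n c z = int (cnt (\<lambda>x. lle n x z \<or> lle n (- z) x) c)"

definition admissible_column :: "nat \<Rightarrow> int list \<Rightarrow> bool" where
  "admissible_column n c \<longleftrightarrow> c \<noteq> [] \<and> is_column n c \<and>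
     (\<forall>z. 1 \<le> z \<and> z \<le> int n \<longrightarrow> Ncount n c z \<le> z)"

text \<open>Split form: I = {z1 > ... > zr} the unbarred z with z, bar z in C; t1 > ... > tr,
t_k the greatest letter with t_k < z_k, t_k < t_(k-1) and t_k, bar t_k not in C.\<close>
definition Ipairs :: "nat \<Rightarrow> int list \<Rightarrow> int set" where
  "Ipairs n c = {z. 1 \<le> z \<and> z \<le> int n \<and> z \<in> set c \<and> - z \<in> set c}"

fun tseq :: "int list \<Rightarrow> int \<Rightarrow> int list \<Rightarrow> int list" where
  "tseq c b [] = []"
| "tseq c b (z # zs) =
     (let t = Max {t. 1 \<le> t \<and> t < min z b \<and> t \<notin> set c \<and> - t \<notin> set c}
      in t # tseq c t zs)"

definition Izs :: "nat \<Rightarrow> int list \<Rightarrow> int list" where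
  "Izs n c = rev (sorted_list_of_set (Ipairs n c))"

definition lcol :: "nat \<Rightarrow> int list \<Rightarrow> int list" where
  "lcol n c = sort_key (lkey n)
     (filter (\<lambda>x. x \<notin> set (Izs n c)) c @ tseq c (int n + 1) (Izs n c))"

definition rcol :: "nat \<Rightarrow> int list \<Rightarrow> int list" where
  "rcol n c = sort_key (lkey n)
     (filter (\<lambda>x. - x \<notin> set (Izs n c)) c @ map uminus (tseq c (int n + 1) (Izs n c)))"

definition col_prec :: "nat \<Rightarrow> int list \<Rightarrow> int list \<Rightarrow> bool" where
  "col_prec n c d \<longleftrightarrow> length d \<le> length c \<and>
     (\<forall>k < length d. lle n (rcol n c ! k) (lcol n d ! k))"

section \<open>The plactic monoid Pl(C_n) (Lecouvey's presentation)\<close>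

inductive plac_rel :: "nat \<Rightarrow> int list \<Rightarrow> int list \<Rightarrow> bool" for n where
  R1a: "\<lbrakk>is_letter n x; is_letter n y; is_letter n z; lle n x y; lless n y z; z \<noteq> - x\<rbrakk>
        \<Longrightarrow> plac_rel n [y, z, x] [y, x, z]"
| R1b: "\<lbrakk>is_letter n x; is_letter n y; is_letter n z; lless n x y; lle n y z; z \<noteq> - x\<rbrakk>
        \<Longrightarrow> plac_rel n [x, z, y] [z, x, y]"
| R2a: "\<lbrakk>1 < x; x \<le> int n; is_letter n y; lle n x y; lle n y (- x)\<rbrakk>
        \<Longrightarrow> plac_rel n [y, - (x - 1), x - 1] [y, x, - x]"
| R2b: "\<lbrakk>1 < x; x \<le> int n; is_letter n y; lle n x y; lle n y (- x)\<rbrakk>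
        \<Longrightarrow> plac_rel n [x, - x, y] [- (x - 1), x - 1, y]"
| R3: "\<lbrakk>is_column n w; \<not> admissible_column n w;
        \<forall>a b c. w = a @ b @ c \<and> b \<noteq> [] \<and> length b < length w \<longrightarrow> admissible_column n b;
        z = (LEAST z. 1 \<le> z \<and> z \<le> int n \<and> z \<in> set w \<and> - z \<in> set w \<and> Ncount n w z > z)\<rbrakk>
        \<Longrightarrow> plac_rel n w (filter (\<lambda>x. x \<noteq> z \<and> x \<noteq> - z) w)"

definition plactic :: "nat \<Rightarrow> int list \<Rightarrow> int list \<Rightarrow> bool" where
  "plactic n = equivclp (\<lambda>a b. \<exists>u v l r. a = u @ l @ v \<and> b = u @ r @ v \<and> plac_rel n l r)"

text \<open>Tableau words: readings d1 d2 ... dk (columns of the tableau read from right to left)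
of symplectic tableaux, i.e. admissible columns with d_(j+1) \<preceq> d_j.\<close>
definition is_tableau :: "nat \<Rightarrow> int list list \<Rightarrow> bool" where
  "is_tableau n ds \<longleftrightarrow> (\<forall>d\<in>set ds. admissible_column n d) \<and>
     (\<forall>k. Suc k < length ds \<longrightarrow> col_prec n (ds ! Suc k) (ds ! k))"

definition tableau_of :: "nat \<Rightarrow> int list \<Rightarrow> int list list" where
  "tableau_of n w = (THE ds. is_tableau n ds \<and> plactic n (concat ds) w)"

section \<open>ACol(C_n): admissible columns plus \<epsilon> (encoded as None)\<close>

definition acol :: "nat \<Rightarrow> int list option \<Rightarrow> bool" where
  "acol n a \<longleftrightarrow> (case a of None \<Rightarrow> True | Some c \<Rightarrow> admissible_column n c)"

definition pA :: "int list option \<Rightarrow> int list" where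
  "pA a = (case a of None \<Rightarrow> [] | Some c \<Rightarrow> c)"

definition pw :: "int list option list \<Rightarrow> int list" where
  "pw ws = concat (map pA ws)"

definition acol_prec :: "nat \<Rightarrow> int list option \<Rightarrow> int list option \<Rightarrow> bool" where
  "acol_prec n a b =
     (case b of None \<Rightarrow> True
      | Some d \<Rightarrow> (case a of None \<Rightarrow> False | Some c \<Rightarrow> col_prec n c d))"

definition acol_ins :: "nat \<Rightarrow> int list option \<Rightarrow> int list option
                        \<Rightarrow> int list option \<times> int list option" where
  "acol_ins n a b =
     (case tableau_of n (pA a @ pA b) of
        [d1, d2] \<Rightarrow> (Some d1, Some d2)
      | [d] \<Rightarrow> (None, Some d)
      | _ \<Rightarrow> (None, None))"

definition reducible_at :: "nat \<Rightarrow> int list option list \<Rightarrow> nat \<Rightarrow> bool" where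
  "reducible_at n w j \<longleftrightarrow> Suc j < length w \<and> \<not> acol_prec n (w ! Suc j) (w ! j)"

definition rewrite_at :: "nat \<Rightarrow> int list option list \<Rightarrow> nat \<Rightarrow> int list option list" where
  "rewrite_at n w j =
     (let r = acol_ins n (w ! j) (w ! Suc j) in w[j := fst r, Suc j := snd r])"

definition lstep :: "nat \<Rightarrow> int list option list \<Rightarrow> int list option list option" where
  "lstep n w = (if \<exists>j. reducible_at n w j
                then Some (rewrite_at n w (LEAST j. reducible_at n w j)) else None)"

definition rstep :: "nat \<Rightarrow> int list option list \<Rightarrow> int list option list option" where
  "rstep n w = (if \<exists>j. reducible_at n w j
                then Some (rewrite_at n w (GREATEST j. reducible_at n w j)) else None)"

inductive strat_len :: "('a \<Rightarrow> 'a option) \<Rightarrow> 'a \<Rightarrow> nat \<Rightarrow> bool" for s where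
  stop: "s w = None \<Longrightarrow> strat_len s w 0"
| step: "\<lbrakk>s w = Some w'; strat_len s w' k\<rbrakk> \<Longrightarrow> strat_len s w (Suc k)"

definition conf :: "nat \<Rightarrow> int list option list \<Rightarrow> nat \<times> nat" where
  "conf n w = ((THE k. strat_len (lstep n) w k), (THE k. strat_len (rstep n) w k))"

fun resplit :: "int list option list \<Rightarrow> int list \<Rightarrow> int list option list" where
  "resplit [] w = []"
| "resplit (None # cs) w = None # resplit cs w"
| "resplit (Some c # cs) w = Some (take (length c) w) # resplit cs (drop (length c) w)"

definition fA :: "nat \<Rightarrow> nat \<Rightarrow> int list option list \<Rightarrow> int list option list option" where
  "fA n i ws = map_option (resplit ws) (fw n i (pw ws))"

definition eA :: "nat \<Rightarrow> nat \<Rightarrow> int list option list \<Rightarrow> int list option list option" where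
  "eA n i ws = map_option (resplit ws) (ew n i (pw ws))"

definition crystal_edge :: "nat \<Rightarrow> int list option list \<Rightarrow> int list option list \<Rightarrow> bool" where
  "crystal_edge n a b \<longleftrightarrow> (\<exists>i. 1 \<le> i \<and> i \<le> n \<and> fA n i a = Some b)"

definition same_component :: "nat \<Rightarrow> int list option list \<Rightarrow> int list option list \<Rightarrow> bool" where
  "same_component n = (\<lambda>a b. crystal_edge n a b \<or> crystal_edge n b a)\<^sup>*\<^sup>*"

definition highest_weight :: "nat \<Rightarrow> int list option list \<Rightarrow> bool" where
  "highest_weight n w \<longleftrightarrow> (\<forall>i. 1 \<le> i \<and> i \<le> n \<longrightarrow> eA n i w = None)"

end

theory Submission
  imports Defs
begin

text \<open>Every lowering operator commutes with every rewriting step, so along an edge of the crystal graph the two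
  words are rewritten at the same positions, forever or until both are irreducible; hence the confluence pair is
  constant on components. For reducibility, the comparison of split columns is turned into inequalities between
  numbers of letters, which the tensor product rule preserves. For the rewriting step itself, plactic relations are
  carried to plactic relations, and raising operators reduce the existence and uniqueness of the tableau to highest
  weight words: such a word is plactic equivalent to a product of columns 1 2 \<dots> a, these columns commute with
  each other, and the weight determines them. The weight at 1 also bounds the number of columns of the tableau of
  two columns by two.\<close>

section \<open>Signatures and the tensor product rule\<close>

text \<open>Two obstacles shape the argument. \<open>tableau_of\<close> is a description operator,
  so nothing can be said about how insertion moves along a crystal edge before existence and
  uniqueness of the tableau are known. And \<open>acol_ins\<close> sends every tableau outside its
  first two patterns to two copies of epsilon: a tableau with three columns would silently lose its
  letters, hence the bound on the number of columns. R3 and \<open>col_prec\<close> are both defined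
  by greedy choices (a least z, successive maxima t_k) that can jump when a single letter changes.
  Each is therefore replaced by inequalities between counting functions in which no choice occurs:
  \<open>contractible\<close> for R3, \<open>fits\<close> for the order. Transport through a context
  rests on one fact throughout: by the tensor product rule, a factor of a word influences where an
  operator acts only through its \<open>eps\<close> and \<open>phi\<close>. Plactic equivalence
  preserves both, so the operator hits corresponding factors before and after a relation or a
  rewriting step is applied.\<close>

text \<open>Read from right to left, eps and phi count the signs - and + that remain after cancellation.\<close>
fun eps :: "nat \<Rightarrow> nat \<Rightarrow> int list \<Rightarrow> nat" where
  "eps n i [] = 0"
| "eps n i (x # xs) =
    (if el n i x \<noteq> None then Suc (eps n i xs)
     else if fl n i x \<noteq> None then eps n i xs - 1 else eps n i xs)"

fun phi :: "nat \<Rightarrow> nat \<Rightarrow> int list \<Rightarrow> nat" where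
  "phi n i [] = 0"
| "phi n i (x # xs) =
    (if fl n i x \<noteq> None \<and> eps n i xs = 0 then Suc (phi n i xs) else phi n i xs)"

lemma fl_el_exclusive: "fl n i x = None \<or> el n i x = None"
  by (auto simp: fl_def el_def)

lemma fl_None_if_el: "el n i x = Some y \<Longrightarrow> fl n i x = None"
  using fl_el_exclusive[of n i x] by auto

lemma eps_append: "eps n i (u @ v) = eps n i u + (eps n i v - phi n i u)"
  by (induction u) (auto simp: fl_None_if_el)

lemma phi_append: "phi n i (u @ v) = phi n i v + (phi n i u - eps n i v)"
  by (induction u) (auto simp: eps_append fl_None_if_el)

lemma cnt_Cons: "cnt P (x # xs) = (if P x then Suc (cnt P xs) else cnt P xs)"
  by (simp add: cnt_def)

lemma eps_le_iff:
  "(\<forall>m. cnt (\<lambda>x. el n i x \<noteq> None) (take m xs) \<le> cnt (\<lambda>x. fl n i x \<noteq> None) (take m xs) + k)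
   \<longleftrightarrow> eps n i xs \<le> k"
proof (induction xs arbitrary: k)
  case Nil
  then show ?case by (simp add: cnt_def)
next
  case (Cons x xs)
  let ?E = "\<lambda>x. el n i x \<noteq> None" and ?F = "\<lambda>x. fl n i x \<noteq> None"
  have split: "(\<forall>m. Q m) \<longleftrightarrow> Q 0 \<and> (\<forall>m. Q (Suc m))" for Q :: "nat \<Rightarrow> bool"
    by (metis not0_implies_Suc)
  have c0: "cnt P [] = 0" for P :: "int \<Rightarrow> bool" by (simp add: cnt_def)
  consider (e) "?E x" "\<not> ?F x" | (f) "\<not> ?E x" "?F x" | (n) "\<not> ?E x" "\<not> ?F x"
    using fl_el_exclusive[of n i x] by metis
  then show ?case
  proof cases
    case e
    show ?thesis
    proof (cases k)
      case 0
      have "\<not> (\<forall>m. cnt ?E (take m (x # xs)) \<le> cnt ?F (take m (x # xs)) + 0)"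
        using e by (auto simp: cnt_def intro!: exI[of _ 1])
      then show ?thesis using e 0 by simp
    next
      case (Suc k')
      then show ?thesis using e Cons.IH[of k'] by (subst split) (simp add: cnt_Cons c0)
    qed
  next
    case f
    then show ?thesis using Cons.IH[of "Suc k"] by (subst split) (auto simp add: cnt_Cons c0)
  next
    case n
    then show ?thesis using Cons.IH[of k] by (subst split) (simp add: cnt_Cons c0)
  qed
qed

lemma free_plus_0: "free_plus n i (x # xs) 0 \<longleftrightarrow> fl n i x \<noteq> None \<and> eps n i xs = 0"
  using eps_le_iff[of n i xs 0] by (simp add: free_plus_def)

lemma free_plus_Suc: "free_plus n i (x # xs) (Suc j) \<longleftrightarrow> free_plus n i xs j"
  by (simp add: free_plus_def)

lemma fw_Nil: "fw n i [] = None"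
  by (simp add: fw_def free_plus_def)

text \<open>Position 0, if free, is the least free position; otherwise the free positions are those
  of the tail, shifted by one. This recursion takes the place of LEAST from here on.\<close>

lemma fw_Cons:
  "fw n i (x # xs) =
    (if fl n i x \<noteq> None \<and> eps n i xs = 0 then Some (the (fl n i x) # xs)
     else map_option ((#) x) (fw n i xs))"
proof (cases "free_plus n i (x # xs) 0")
  case True
  then have "(LEAST j. free_plus n i (x # xs) j) = 0" by (simp add: Least_eq_0)
  then show ?thesis using True by (auto simp: fw_def free_plus_0 Let_def intro: exI[of _ 0])
next
  case False
  have ex: "(\<exists>j. free_plus n i (x # xs) j) \<longleftrightarrow> (\<exists>j. free_plus n i xs j)"
    using False free_plus_Suc by (metis not0_implies_Suc)
  show ?thesis
  proof (cases "\<exists>j. free_plus n i xs j")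
    case True
    then have "(LEAST j. free_plus n i (x # xs) j) = Suc (LEAST j. free_plus n i xs j)"
      using Least_Suc[of "free_plus n i (x # xs)"] False ex by (auto simp: free_plus_Suc)
    then show ?thesis using True False ex by (auto simp: fw_def free_plus_0 Let_def)
  next
    case no: False
    then show ?thesis using False ex by (auto simp: fw_def free_plus_0)
  qed
qed

lemma fw_None_iff: "fw n i w = None \<longleftrightarrow> phi n i w = 0"
  by (induction w) (auto simp: fw_Nil fw_Cons)

text \<open>This is the tensor product rule: the surplus - of v cancel + of u, so a + of u survives
  exactly when \<open>phi\<close> of u exceeds \<open>eps\<close> of v, and it then stands to the
  left of every surviving + of v.\<close>

lemma fw_append:
  "fw n i (u @ v) =
    (if phi n i u > eps n i v then map_option (\<lambda>u'. u' @ v) (fw n i u)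
     else map_option (\<lambda>v'. u @ v') (fw n i v))"
proof (induction u)
  case Nil
  then show ?case by (cases "fw n i v") auto
next
  case (Cons x u)
  show ?case
    by (cases "fw n i u"; cases "fw n i v") (auto simp: fw_Cons eps_append Cons.IH)
qed

text \<open>The two vanishing conditions locate the modified letter from both sides: no + survives
  in a and no - survives in b. They are the same for the old and the new letter, so they also locate
  the place where the step is undone; \<open>fw_dual\<close> rests on this.\<close>

lemma fw_SomeD:
  assumes "fw n i w = Some w'"
  shows "\<exists>a x y b. w = a @ x # b \<and> w' = a @ y # b \<and> fl n i x = Some y
           \<and> phi n i a = 0 \<and> eps n i b = 0"
  using assms
proof (induction w arbitrary: w')
  case Nil
  then show ?case by (simp add: fw_Nil)
next
  case (Cons z w)
  show ?case
  proof (cases "fl n i z \<noteq> None \<and> eps n i w = 0")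
    case True
    then show ?thesis using Cons.prems
      by (intro exI[of _ "[]"] exI[of _ z] exI[of _ "the (fl n i z)"] exI[of _ w]) (auto simp: fw_Cons)
  next
    case False
    then obtain w1 where w1: "fw n i w = Some w1" "w' = z # w1"
      using Cons.prems by (auto simp: fw_Cons)
    obtain a x y b where ab: "w = a @ x # b" "w1 = a @ y # b" "fl n i x = Some y"
      "phi n i a = 0" "eps n i b = 0"
      using Cons.IH[OF w1(1)] by blast
    have "el n i x = None" using ab(3) fl_el_exclusive[of n i x] by auto
    then have "eps n i w = eps n i a" using ab by (simp add: eps_append)
    then have "phi n i (z # a) = 0" using False ab by auto
    then show ?thesis using ab w1
      by (intro exI[of _ "z # a"] exI[of _ x] exI[of _ y] exI[of _ b]) auto
  qed
qed

lemma fw_splitI: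
  assumes "fl n i x = Some y" "phi n i a = 0" "eps n i b = 0"
  shows "fw n i (a @ x # b) = Some (a @ y # b)"
  using assms by (simp add: fw_append fw_Cons)

text \<open>Reversing a word and barring its letters exchanges the two kinds of crystal operators; all statements
  about raising operators are derived from those about lowering operators in this way.\<close>
definition dual :: "int list \<Rightarrow> int list" where
  "dual w = rev (map uminus w)"

lemma dual_append: "dual (u @ v) = dual v @ dual u"
  by (simp add: dual_def)

lemma dual_Cons: "dual (x # v) = dual v @ [- x]"
  by (simp add: dual_def)

lemma dual_dual [simp]: "dual (dual w) = w"
  by (simp add: dual_def rev_map o_def)

lemma dual_Nil [simp]: "dual [] = []"
  by (simp add: dual_def)

lemma length_dual [simp]: "length (dual w) = length w"
  by (simp add: dual_def)

lemma set_dual: "set (dual w) = uminus ` set w"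
  by (simp add: dual_def)

lemma el_uminus: "el n i (- x) = map_option uminus (fl n i x)"
  by (auto simp: el_def fl_def)

lemma fl_uminus: "fl n i (- x) = map_option uminus (el n i x)"
  by (auto simp: el_def fl_def)

lemma el_eq_Some_iff: "el n i y = Some x \<longleftrightarrow> fl n i x = Some y"
  by (auto simp: el_def fl_def split: if_splits)

lemma eps_dual: "eps n i (dual w) = phi n i w"
  and phi_dual: "phi n i (dual w) = eps n i w"
proof (induction w)
  case (Cons x w)
  {
    case 1
    show ?case using Cons fl_el_exclusive[of n i x]
      by (auto simp: dual_Cons eps_append phi_append el_uminus fl_uminus)
  next
    case 2
    show ?case using Cons fl_el_exclusive[of n i x]
      by (auto simp: dual_Cons eps_append phi_append el_uminus fl_uminus)
  }
qed simp_all

lemma fw_dual: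
  assumes "fw n i w = Some w'"
  shows "fw n i (dual w') = Some (dual w)"
proof -
  obtain a x y b where ab: "w = a @ x # b" "w' = a @ y # b" "fl n i x = Some y"
      "phi n i a = 0" "eps n i b = 0"
    using fw_SomeD[OF assms] by blast
  have "fl n i (- y) = Some (- x)"
    using ab(3) by (simp add: fl_uminus el_eq_Some_iff[symmetric])
  then show ?thesis
    using fw_splitI[of n i "- y" "- x" "dual b" "dual a"] ab
    by (simp add: dual_append dual_Cons eps_dual phi_dual)
qed

lemma eps_pos_ex:
  assumes "eps n i w > 0"
  obtains v where "fw n i v = Some w"
proof -
  have "fw n i (dual w) \<noteq> None" using assms by (simp add: fw_None_iff phi_dual)
  then obtain v where "fw n i (dual w) = Some v" by blast
  then show thesis using fw_dual[of n i "dual w" v] that by simp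
qed

lemma fw_length: "fw n i w = Some w' \<Longrightarrow> length w' = length w"
  using fw_SomeD by fastforce

lemma fw_append_Some:
  assumes "fw n i (u @ v) = Some (u' @ v')" "length u = length u'"
  shows "fw n i u = Some u' \<and> v' = v \<and> eps n i v < phi n i u
       \<or> u' = u \<and> fw n i v = Some v' \<and> phi n i u \<le> eps n i v"
proof (cases "eps n i v < phi n i u")
  case True
  then obtain u'' where "fw n i u = Some u''" "u'' @ v = u' @ v'"
    using assms by (auto simp: fw_append)
  then show ?thesis using assms(2) fw_length[of n i u u''] True by auto
next
  case False
  then show ?thesis using assms by (auto simp: fw_append)
qed

section \<open>Induction along the crystal\<close>

definition height :: "nat \<Rightarrow> int list \<Rightarrow> nat" where
  "height n w = sum_list (map (\<lambda>x. nat (lkey n x)) w)"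

lemma fl_lkey: "fl n i x = Some y \<Longrightarrow> lkey n y = lkey n x + 1 \<and> lkey n x \<ge> 0"
  by (auto simp: fl_def lkey_def split: if_splits)

lemma fw_height: "fw n i w = Some w' \<Longrightarrow> height n w' = Suc (height n w)"
  by (drule fw_SomeD) (auto simp: height_def dest!: fl_lkey)

text \<open>Lowering raises the sum of the keys by exactly one, so passing to preimages under
  lowering operators terminates. Words without a preimage are those of highest weight; for them the
  induction hypothesis is void and a direct argument is required.\<close>

lemma crystal_induct:
  assumes "\<And>w. (\<And>i v. fw n i v = Some w \<Longrightarrow> P v) \<Longrightarrow> P w"
  shows "P w"
proof (induction "height n w" arbitrary: w rule: less_induct)
  case less
  show ?case using assms[of w] less fw_height by (metis lessI)
qed

section \<open>Columns\<close>

text \<open>\<open>U\<close> counts the unbarred letters 1, ..., k of a column and \<open>V\<close>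
  the barred letters bar k, ..., bar 1, so that \<open>U c k + V c k\<close> is the number N(k) of
  the admissibility condition.\<close>

definition U :: "int list \<Rightarrow> int \<Rightarrow> int" where
  "U c k = int (card {x \<in> set c. 0 < x \<and> x \<le> k})"

definition V :: "int list \<Rightarrow> int \<Rightarrow> int" where
  "V c k = int (card {x \<in> set c. - k \<le> x \<and> x < 0})"

lemma U_0 [simp]: "U c 0 = 0"
proof -
  have "{x \<in> set c. 0 < x \<and> x \<le> 0} = {}" by auto
  then show ?thesis unfolding U_def by simp
qed

lemma V_0 [simp]: "V c 0 = 0"
proof -
  have "{x \<in> set c. - 0 \<le> x \<and> x < 0} = {}" by auto
  then show ?thesis unfolding V_def by simp
qed

lemma U_step:
  assumes "1 \<le> k"
  shows "U c k = U c (k - 1) + of_bool (k \<in> set c)"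
proof -
  have "{x \<in> set c. 0 < x \<and> x \<le> k}
      = {x \<in> set c. 0 < x \<and> x \<le> k - 1} \<union> (if k \<in> set c then {k} else {})"
    using assms by (auto simp: order_less_le)
  then show ?thesis by (auto simp: U_def)
qed

lemma V_step:
  assumes "1 \<le> k"
  shows "V c k = V c (k - 1) + of_bool (- k \<in> set c)"
proof -
  have "{x \<in> set c. - k \<le> x \<and> x < 0}
      = {x \<in> set c. - (k - 1) \<le> x \<and> x < 0} \<union> (if - k \<in> set c then {- k} else {})"
  proof -
    have "x = - k \<or> - (k - 1) \<le> x" if "- k \<le> x" for x using that by auto
    then show ?thesis using assms by auto
  qed
  then show ?thesis by (auto simp: V_def)
qed

lemma U_nonneg [simp]: "0 \<le> U c k" and V_nonneg [simp]: "0 \<le> V c k"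
  by (simp_all add: U_def V_def)

lemma uminus_image_iff: "x \<in> uminus ` A \<longleftrightarrow> - x \<in> A" for x :: int
  by (metis (no_types) add.inverse_inverse image_iff)

lemma U_dual: "U (dual c) k = V c k"
proof -
  have "{x \<in> set (dual c). 0 < x \<and> x \<le> k} = uminus ` {x \<in> set c. - k \<le> x \<and> x < 0}"
    by (rule set_eqI) (simp add: set_dual uminus_image_iff, linarith)
  then show ?thesis by (simp add: U_def V_def card_image)
qed

lemma V_dual: "V (dual c) k = U c k"
  using U_dual[of "dual c" k] by simp

lemma lkey_inj: "is_letter n x \<Longrightarrow> is_letter n y \<Longrightarrow> lkey n x = lkey n y \<Longrightarrow> x = y"
  by (auto simp: is_letter_def lkey_def split: if_splits)

lemma is_column_sorted: "is_column n c \<Longrightarrow> sorted_wrt (<) (map (lkey n) c)"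
  by (simp add: is_column_def sorted_wrt_map lless_def[abs_def])

lemma is_column_distinct: "is_column n c \<Longrightarrow> distinct c"
  using is_column_sorted[of n c] distinct_map[of "lkey n" c] strict_sorted_iff by blast

lemma is_column_eqI:
  assumes "is_column n c" "is_column n d" "set c = set d"
  shows "c = d"
proof -
  have "map (lkey n) c = map (lkey n) d"
    using assms is_column_sorted[of n c] is_column_sorted[of n d]
    by (metis list.set_map strict_sorted_equal)
  moreover have "inj_on (lkey n) (set c \<union> set d)"
    using assms by (auto simp: inj_on_def is_column_def intro: lkey_inj)
  ultimately show ?thesis by (simp add: inj_on_map_eq_map)
qed

lemma is_column_filter: "is_column n c \<Longrightarrow> is_column n (filter P c)"
  by (auto simp: is_column_def sorted_wrt_filter)

lemma is_column_append:
  "is_column n (a @ b) \<longleftrightarrow> is_column n a \<and> is_column n b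
     \<and> (\<forall>x\<in>set a. \<forall>y\<in>set b. lless n x y)"
  by (auto simp: is_column_def sorted_wrt_append)

lemma is_column_Cons:
  "is_column n (x # b) \<longleftrightarrow> is_letter n x \<and> is_column n b \<and> (\<forall>y\<in>set b. lless n x y)"
  by (auto simp: is_column_def)

lemma is_column_Nil [simp]: "is_column n []"
  by (simp add: is_column_def)

lemma lkey_uminus: "is_letter n x \<Longrightarrow> lkey n (- x) = 2 * int n + 1 - lkey n x"
  by (auto simp: is_letter_def lkey_def)

lemma is_column_letter: "is_column n c \<Longrightarrow> x \<in> set c \<Longrightarrow> is_letter n x"
  by (simp add: is_column_def)

lemma is_column_dual: "is_column n c \<Longrightarrow> is_column n (dual c)"
proof (induction c)
  case (Cons x c)
  have "lless n (- y) (- x)" if "y \<in> set c" for y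
    using Cons.prems that is_column_letter[of n c y]
    by (auto simp: is_column_Cons lless_def lkey_uminus)
  then show ?case using Cons
    by (auto simp: dual_Cons is_column_append is_column_Cons set_dual is_letter_def)
qed simp

lemma Ncount_UV:
  assumes "is_column n c" "1 \<le> z" "z \<le> int n"
  shows "Ncount n c z = U c z + V c z"
proof -
  have d: "distinct c" using assms is_column_distinct by blast
  have l: "is_letter n x" if "x \<in> set c" for x using assms that by (auto simp: is_column_def)
  have "{x \<in> set c. lle n x z \<or> lle n (- z) x}
     = {x \<in> set c. 0 < x \<and> x \<le> z} \<union> {x \<in> set c. - z \<le> x \<and> x < 0}"
  proof (rule set_eqI)
    fix x
    show "x \<in> {x \<in> set c. lle n x z \<or> lle n (- z) x} \<longleftrightarrow>
      x \<in> {x \<in> set c. 0 < x \<and> x \<le> z} \<union> {x \<in> set c. - z \<le> x \<and> x < 0}"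
    proof (cases "x \<in> set c")
      case True
      then show ?thesis using l[OF True] assms
        by (cases "x > 0") (auto simp: lle_def lkey_def is_letter_def)
    qed simp
  qed
  moreover have "cnt P c = card {x \<in> set c. P x}" for P
    using d by (simp add: cnt_def distinct_length_filter Int_def conj_commute)
  ultimately have "Ncount n c z = int (card ({x \<in> set c. 0 < x \<and> x \<le> z} \<union> {x \<in> set c. - z \<le> x \<and> x < 0}))"
    by (simp add: Ncount_def)
  also have "\<dots> = U c z + V c z"
    unfolding U_def V_def by (subst card_Un_disjoint) auto
  finally show ?thesis .
qed

lemma length_column:
  assumes "is_column n c"
  shows "int (length c) = U c (int n) + V c (int n)"
proof -
  let ?A = "{x \<in> set c. 0 < x \<and> x \<le> int n}" and ?B = "{x \<in> set c. - int n \<le> x \<and> x < 0}"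
  have l: "x \<noteq> 0 \<and> - int n \<le> x \<and> x \<le> int n" if "x \<in> set c" for x
    using is_column_letter[OF assms that] by (auto simp: is_letter_def)
  have "x \<in> set c \<longleftrightarrow> x \<in> ?A \<union> ?B" for x
    using l[of x] by (cases "x > 0") auto
  then have e: "set c = ?A \<union> ?B" by blast
  have "card (?A \<union> ?B) = card ?A + card ?B"
    by (intro card_Un_disjoint) auto
  then have "card (set c) = card ?A + card ?B" using e by argo
  then show ?thesis
    using distinct_card[OF is_column_distinct[OF assms]] by (simp add: U_def V_def)
qed

definition bounded_counts :: "nat \<Rightarrow> int list \<Rightarrow> bool" where
  "bounded_counts n c \<longleftrightarrow> (\<forall>z. 1 \<le> z \<and> z \<le> int n \<longrightarrow> U c z + V c z \<le> z)"

lemma admissible_iff: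
  "admissible_column n c \<longleftrightarrow> c \<noteq> [] \<and> is_column n c \<and> bounded_counts n c"
  by (auto simp: admissible_column_def bounded_counts_def Ncount_UV)

lemma admissible_dual: "admissible_column n c \<Longrightarrow> admissible_column n (dual c)"
  using length_dual[of c]
  by (auto simp: admissible_iff is_column_dual bounded_counts_def U_dual V_dual add.commute
      simp del: length_dual)

section \<open>Signatures of columns\<close>

definition active :: "nat \<Rightarrow> nat \<Rightarrow> int \<Rightarrow> bool" where
  "active n i x \<longleftrightarrow> el n i x \<noteq> None \<or> fl n i x \<noteq> None"

lemma eps_filter: "eps n i (filter (active n i) w) = eps n i w"
  by (induction w) (auto simp: active_def)

lemma phi_filter: "phi n i (filter (active n i) w) = phi n i w"
  by (induction w) (auto simp: active_def[symmetric] eps_filter, auto simp: active_def)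

definition opt :: "bool \<Rightarrow> int \<Rightarrow> int list" where
  "opt b x = (if b then [x] else [])"

text \<open>A column is strictly increasing, so the letters visible to an index i < n form a subword
  of i, i+1, bar(i+1), bar i, whose signs are + - + -. Four membership facts thus determine its
  signature.\<close>

lemma filter_active_column:
  assumes "is_column n c" "1 \<le> i" "i < n"
  shows "filter (active n i) c =
     opt (int i \<in> set c) (int i) @ opt (int i + 1 \<in> set c) (int i + 1)
     @ opt (- int i - 1 \<in> set c) (- int i - 1) @ opt (- int i \<in> set c) (- int i)"
proof (rule is_column_eqI[of n])
  show "is_column n (filter (active n i) c)" using assms is_column_filter by blast
  show "is_column n (opt (int i \<in> set c) (int i) @ opt (int i + 1 \<in> set c) (int i + 1)
     @ opt (- int i - 1 \<in> set c) (- int i - 1) @ opt (- int i \<in> set c) (- int i))"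
    using assms by (auto simp: opt_def is_column_append is_column_Cons is_letter_def lless_def lkey_def)
  show "set (filter (active n i) c) = set (opt (int i \<in> set c) (int i) @ opt (int i + 1 \<in> set c) (int i + 1)
     @ opt (- int i - 1 \<in> set c) (- int i - 1) @ opt (- int i \<in> set c) (- int i))"
    using assms by (auto simp: opt_def active_def el_def fl_def split: if_splits)
qed

lemma filter_active_column_n:
  assumes "is_column n c" "1 \<le> n"
  shows "filter (active n n) c = opt (int n \<in> set c) (int n) @ opt (- int n \<in> set c) (- int n)"
proof (rule is_column_eqI[of n])
  show "is_column n (filter (active n n) c)" using assms is_column_filter by blast
  show "is_column n (opt (int n \<in> set c) (int n) @ opt (- int n \<in> set c) (- int n))"
    using assms by (auto simp: opt_def is_column_append is_column_Cons is_letter_def lless_def lkey_def)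
  show "set (filter (active n n) c) = set (opt (int n \<in> set c) (int n) @ opt (- int n \<in> set c) (- int n))"
    using assms by (auto simp: opt_def active_def el_def fl_def split: if_splits)
qed

text \<open>Truncated subtraction carries out the cancellation, read from the right: bar i is a -, a
  + at bar(i+1) cancels it if it is there, i+1 adds a -, and i cancels one - if any is left.\<close>

lemma eps_column:
  assumes "is_column n c" "1 \<le> i" "i < n"
  shows "eps n i c = (of_bool (- int i \<in> set c) - of_bool (- int i - 1 \<in> set c))
            + of_bool (int i + 1 \<in> set c) - of_bool (int i \<in> set c)"
  unfolding eps_filter[of n i c, symmetric] filter_active_column[OF assms]
  using assms(2,3)
  by (cases "int i \<in> set c"; cases "int i + 1 \<in> set c"; cases "- int i - 1 \<in> set c";
      cases "- int i \<in> set c") (simp_all add: opt_def el_def fl_def)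

lemma phi_column:
  assumes "is_column n c" "1 \<le> i" "i < n"
  shows "phi n i c = (of_bool (int i \<in> set c) - of_bool (int i + 1 \<in> set c))
            + of_bool (- int i - 1 \<in> set c) - of_bool (- int i \<in> set c)"
  unfolding phi_filter[of n i c, symmetric] filter_active_column[OF assms]
  using assms(2,3)
  by (cases "int i \<in> set c"; cases "int i + 1 \<in> set c"; cases "- int i - 1 \<in> set c";
      cases "- int i \<in> set c") (simp_all add: opt_def el_def fl_def)

lemma eps_column_n:
  assumes "is_column n c" "1 \<le> n"
  shows "eps n n c = of_bool (- int n \<in> set c) - of_bool (int n \<in> set c)"
  unfolding eps_filter[of n n c, symmetric] filter_active_column_n[OF assms]
  using assms(2)
  by (cases "int n \<in> set c"; cases "- int n \<in> set c") (simp_all add: opt_def el_def fl_def)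

lemma phi_column_n:
  assumes "is_column n c" "1 \<le> n"
  shows "phi n n c = of_bool (int n \<in> set c) - of_bool (- int n \<in> set c)"
  unfolding phi_filter[of n n c, symmetric] filter_active_column_n[OF assms]
  using assms(2)
  by (cases "int n \<in> set c"; cases "- int n \<in> set c") (simp_all add: opt_def el_def fl_def)

text \<open>The key grows by exactly one, so the only letter on the right that could fail to stay
  larger is a second copy of y.\<close>

lemma column_replace:
  assumes "is_column n (a @ x # b)" "fl n i x = Some y" "y \<notin> set b"
  shows "is_column n (a @ y # b)"
proof -
  have y: "is_letter n y" "lkey n y = lkey n x + 1"
    using assms fl_lkey[OF assms(2)] by (auto simp: fl_def is_letter_def split: if_splits)
  have "lless n y z" if "z \<in> set b" for z
  proof -
    have "lless n x z" "is_letter n z" "z \<noteq> y"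
      using that assms by (auto simp: is_column_append is_column_Cons) (auto simp: is_column_def)
    then show ?thesis using y lkey_inj[of n z y] by (force simp: lless_def)
  qed
  then show ?thesis
    using assms(1) y by (force simp: is_column_append is_column_Cons lless_def)
qed

lemma set_replace:
  assumes "is_column n (a @ x # b)"
  shows "set (a @ y # b) = insert y (set (a @ x # b) - {x})"
  using is_column_distinct[OF assms] by auto

lemma fw_column:
  assumes "is_column n c" "1 \<le> i" "i < n" "fw n i c = Some c'"
  shows "is_column n c' \<and>
    (int i \<in> set c \<and> int i + 1 \<notin> set c \<and> (- int i \<in> set c \<longrightarrow> - int i - 1 \<in> set c)
       \<and> set c' = insert (int i + 1) (set c - {int i})
     \<or> - int i - 1 \<in> set c \<and> - int i \<notin> set c \<and> (int i \<in> set c \<longrightarrow> int i + 1 \<in> set c)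
       \<and> set c' = insert (- int i) (set c - {- int i - 1}))"
proof -
  obtain a x y b where ab: "c = a @ x # b" "c' = a @ y # b" "fl n i x = Some y"
      "phi n i a = 0" "eps n i b = 0"
    using fw_SomeD[OF assms(4)] by blast
  have cols: "is_column n a" "is_column n b" "\<forall>z\<in>set a. lless n z x" "\<forall>z\<in>set b. lless n x z"
    using assms(1) ab(1) by (auto simp: is_column_append is_column_Cons)
  have sr: "set c' = insert y (set c - {x})" using ab set_replace assms(1) by blast
  have eb: "(of_bool (- int i \<in> set b) - of_bool (- int i - 1 \<in> set b))
            + of_bool (int i + 1 \<in> set b) - of_bool (int i \<in> set b) = (0::nat)"
    using eps_column[OF cols(2) assms(2,3)] ab(5) by simp
  have pa: "(of_bool (int i \<in> set a) - of_bool (int i + 1 \<in> set a))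
            + of_bool (- int i - 1 \<in> set a) - of_bool (- int i \<in> set a) = (0::nat)"
    using phi_column[OF cols(1) assms(2,3)] ab(4) by simp
  consider "x = int i" "y = int i + 1" | "x = - int i - 1" "y = - int i"
    using ab(3) assms(2,3) by (auto simp: fl_def split: if_splits)
  then show ?thesis
  proof cases
    case 1
    have a: "int i + 1 \<notin> set a" "- int i \<notin> set a" "- int i - 1 \<notin> set a" "int i \<notin> set b"
      using cols(3,4) 1 assms by (auto simp: lless_def lkey_def)
    \<comment> \<open>A copy of i+1 in b would leave an uncancelled - there, since i does not occur
      in b, against \<open>eps\<close> of b being 0.\<close>
    have "y \<notin> set b" using eb a 1 by auto
    then have "is_column n c'" "y \<notin> set c" using column_replace[of n a x b i y] assms(1) ab 1 a by auto
    moreover have "x \<in> set c" "- int i \<in> set c \<longrightarrow> - int i - 1 \<in> set c"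
      using ab(1) a eb 1 assms(2) by (auto split: if_splits)
    ultimately show ?thesis using sr 1 by blast
  next
    case 2
    have a: "int i + 1 \<notin> set b" "- int i \<notin> set a" "- int i - 1 \<notin> set a" "int i \<notin> set b"
       "- int i - 1 \<notin> set b"
      using cols(3,4) 2 assms by (auto simp: lless_def lkey_def)
    have "y \<notin> set b" using eb a 2 by auto
    then have "is_column n c'" "y \<notin> set c" using column_replace[of n a x b i y] assms(1) ab 2 a by auto
    moreover have "x \<in> set c" "int i \<in> set c \<longrightarrow> int i + 1 \<in> set c"
      using ab(1) a pa 2 assms(2) by (auto split: if_splits)
    ultimately show ?thesis using sr 2 by blast
  qed
qed

lemma fw_column_n:
  assumes "is_column n c" "1 \<le> n" "fw n n c = Some c'"
  shows "is_column n c' \<and> int n \<in> set c \<and> - int n \<notin> set c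
       \<and> set c' = insert (- int n) (set c - {int n})"
proof -
  obtain a x y b where ab: "c = a @ x # b" "c' = a @ y # b" "fl n n x = Some y"
      "phi n n a = 0" "eps n n b = 0"
    using fw_SomeD[OF assms(3)] by blast
  have cols: "is_column n a" "is_column n b" "\<forall>z\<in>set a. lless n z x" "\<forall>z\<in>set b. lless n x z"
    using assms(1) ab(1) by (auto simp: is_column_append is_column_Cons)
  have sr: "set c' = insert y (set c - {x})" using ab set_replace assms(1) by blast
  have eb: "of_bool (- int n \<in> set b) - of_bool (int n \<in> set b) = (0::nat)"
    using eps_column_n[OF cols(2) assms(2)] ab(5) by simp
  have x: "x = int n" "y = - int n"
    using ab(3) assms by (auto simp: fl_def split: if_splits)
  have a: "- int n \<notin> set a" "int n \<notin> set b"
    using cols(3,4) x assms by (auto simp: lless_def lkey_def)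
  have "y \<notin> set b" using eb a x by auto
  then have "is_column n c'" "y \<notin> set c" using column_replace[of n a x b n y] assms(1,2) ab x a by auto
  moreover have "x \<in> set c" using ab(1) by simp
  ultimately show ?thesis using sr x by blast
qed

lemma fw_index: "fw n i w = Some w' \<Longrightarrow> 1 \<le> i \<and> i \<le> n"
  by (drule fw_SomeD) (auto simp: fl_def split: if_splits)

lemma card_swap:
  assumes "finite A" "y \<notin> A"
  shows "int (card ((A - {x}) \<union> (if P then {y} else {}))) + of_bool (x \<in> A)
    = int (card A) + of_bool P"
proof (cases "x \<in> A")
  case True
  then have "card A = Suc (card (A - {x}))" using assms(1) by (rule card.remove[rotated])
  then show ?thesis using assms True by (cases P) simp_all
next
  case False
  then have "A - {x} = A" by blast
  then show ?thesis using assms False by (cases P) simp_all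
qed

lemma U_swap:
  assumes "set c' = insert y (set c - {x})" "0 < x" "x \<in> set c" "y \<notin> set c" "y = x + 1 \<or> y < 0"
  shows "U c' k = U c k - of_bool (x \<le> k \<and> (y \<le> k \<longrightarrow> y < 0))"
proof -
  let ?A = "{z \<in> set c. 0 < z \<and> z \<le> k}"
  have "{z \<in> set c'. 0 < z \<and> z \<le> k} = (?A - {x}) \<union> (if 0 < y \<and> y \<le> k then {y} else {})"
    using assms(1) by auto
  then have "U c' k = int (card ((?A - {x}) \<union> (if 0 < y \<and> y \<le> k then {y} else {})))"
    by (simp only: U_def)
  moreover have "int (card ((?A - {x}) \<union> (if 0 < y \<and> y \<le> k then {y} else {}))) + of_bool (x \<in> ?A)
      = int (card ?A) + of_bool (0 < y \<and> y \<le> k)"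
    by (rule card_swap) (use assms(4) in auto)
  ultimately have "U c' k + of_bool (x \<in> ?A) = U c k + of_bool (0 < y \<and> y \<le> k)"
    by (simp only: U_def)
  moreover have "x \<in> ?A \<longleftrightarrow> x \<le> k" using assms(2,3) by simp
  ultimately show ?thesis using assms(2,5)
    by (cases "x \<le> k"; cases "y \<le> k"; cases "y < 0") simp_all
qed

lemma V_swap:
  assumes "set c' = insert y (set c - {x})" "y < 0" "x \<in> set c" "y \<notin> set c" "y = x + 1 \<or> x > 0"
  shows "V c' k = V c k + of_bool (- k \<le> y \<and> (- k \<le> x \<longrightarrow> x > 0))"
proof -
  let ?A = "{z \<in> set c. - k \<le> z \<and> z < 0}"
  have "{z \<in> set c'. - k \<le> z \<and> z < 0} = (?A - {x}) \<union> (if - k \<le> y then {y} else {})"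
    using assms(1,2) by auto
  then have "V c' k = int (card ((?A - {x}) \<union> (if - k \<le> y then {y} else {})))"
    by (simp only: V_def)
  moreover have "int (card ((?A - {x}) \<union> (if - k \<le> y then {y} else {}))) + of_bool (x \<in> ?A)
      = int (card ?A) + of_bool (- k \<le> y)"
    by (rule card_swap) (use assms(4) in auto)
  ultimately have "V c' k + of_bool (x \<in> ?A) = V c k + of_bool (- k \<le> y)"
    by (simp only: V_def)
  moreover have "x \<in> ?A \<longleftrightarrow> - k \<le> x \<and> \<not> x > 0" using assms(2,3,5) by auto
  ultimately show ?thesis using assms(5)
    by (cases "- k \<le> x"; cases "- k \<le> y"; cases "x > 0") (simp_all only: of_bool_def, auto)
qed

lemma U_same:
  assumes "set c' = insert y (set c - {x})" "x < 0" "y < 0"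
  shows "U c' k = U c k"
proof -
  have "{z \<in> set c'. 0 < z \<and> z \<le> k} = {z \<in> set c. 0 < z \<and> z \<le> k}"
    unfolding assms(1) using assms(2,3) by auto
  then show ?thesis by (simp add: U_def)
qed

lemma V_same:
  assumes "set c' = insert y (set c - {x})" "x > 0" "y > 0"
  shows "V c' k = V c k"
proof -
  have "{z \<in> set c'. - k \<le> z \<and> z < 0} = {z \<in> set c. - k \<le> z \<and> z < 0}"
    unfolding assms(1) using assms(2,3) by auto
  then show ?thesis by (simp add: V_def)
qed

text \<open>Turning i into i+1 takes a letter out of just one of the segments 1, ..., k, namely that
  with k = i; turning bar(i+1) into bar i brings a letter into just one of the segments bar k, ...,
  bar 1. One value of one counting function changes, which keeps later verifications within i-1, i,
  i+1.\<close>

lemma fw_column_counts: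
  assumes "is_column n c" "1 \<le> i" "i < n" "fw n i c = Some c'"
  shows "(int i \<in> set c \<and> int i + 1 \<notin> set c \<and> (- int i \<in> set c \<longrightarrow> - int i - 1 \<in> set c)
       \<and> (\<forall>k. U c' k = U c k - of_bool (k = int i)) \<and> (\<forall>k. V c' k = V c k))
     \<or> (- int i - 1 \<in> set c \<and> - int i \<notin> set c \<and> (int i \<in> set c \<longrightarrow> int i + 1 \<in> set c)
       \<and> (\<forall>k. U c' k = U c k) \<and> (\<forall>k. V c' k = V c k + of_bool (k = int i)))"
proof -
  consider (1) "int i \<in> set c \<and> int i + 1 \<notin> set c \<and> (- int i \<in> set c \<longrightarrow> - int i - 1 \<in> set c)
       \<and> set c' = insert (int i + 1) (set c - {int i})"
    | (2) "- int i - 1 \<in> set c \<and> - int i \<notin> set c \<and> (int i \<in> set c \<longrightarrow> int i + 1 \<in> set c)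
       \<and> set c' = insert (- int i) (set c - {- int i - 1})"
    using fw_column[OF assms] by blast
  then show ?thesis
  proof cases
    case 1
    have "U c' k = U c k - of_bool (k = int i)" "V c' k = V c k" for k
      using U_swap[of c' "int i + 1" c "int i" k] V_same[of c' "int i + 1" c "int i" k] 1 assms(2)
      by (simp_all del: insert_iff)
    then show ?thesis using 1 by blast
  next
    case 2
    have "V c' k = V c k + of_bool (k = int i)" "U c' k = U c k" for k
      using V_swap[of c' "- int i" c "- int i - 1" k] U_same[of c' "- int i" c "- int i - 1" k] 2 assms(2)
      by (simp_all del: insert_iff)
    then show ?thesis using 2 by blast
  qed
qed

lemma fw_column_n_counts:
  assumes "is_column n c" "1 \<le> n" "fw n n c = Some c'"
  shows "int n \<in> set c \<and> - int n \<notin> set c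
       \<and> (\<forall>k. U c' k = U c k - of_bool (k \<ge> int n)) \<and> (\<forall>k. V c' k = V c k + of_bool (k \<ge> int n))"
proof -
  have c: "int n \<in> set c" "- int n \<notin> set c" "set c' = insert (- int n) (set c - {int n})"
    using fw_column_n[OF assms] by blast+
  have "U c' k = U c k - of_bool (k \<ge> int n)" "V c' k = V c k + of_bool (k \<ge> int n)" for k
    using U_swap[OF c(3) _ c(1,2), of k] V_swap[OF c(3) _ c(1,2), of k] assms(2) by simp_all
  then show ?thesis using c by blast
qed

section \<open>Plactic relations and crystal operators\<close>

text \<open>In terms of keys, index i acts by a shift of 1 at the keys i, i+1, 2n-i, 2n+1-i,
  uniformly for i < n and i = n (where the four keys collapse to two). Compatibility with the
  plactic relations on three letters then becomes linear integer arithmetic.\<close>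

lemma letter_status:
  assumes "is_letter n x" "1 \<le> i" "i \<le> n"
  obtains
    (minus) w where "el n i x = Some w" "fl n i x = None" "is_letter n w" "lkey n w = lkey n x - 1"
      "lkey n x = int i + 1 \<or> lkey n x = 2 * int n + 1 - int i"
  | (plus) w where "el n i x = None" "fl n i x = Some w" "is_letter n w" "lkey n w = lkey n x + 1"
      "lkey n x = int i \<or> lkey n x = 2 * int n - int i"
  | (neutral) "el n i x = None" "fl n i x = None" "lkey n x \<noteq> int i" "lkey n x \<noteq> int i + 1"
      "lkey n x \<noteq> 2 * int n - int i" "lkey n x \<noteq> 2 * int n + 1 - int i"
proof (cases "fl n i x")
  case (Some w)
  then show ?thesis using assms plus[of w]
    by (auto simp: fl_def el_def lkey_def is_letter_def split: if_splits)
next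
  case f: None
  show ?thesis
  proof (cases "el n i x")
    case None
    have "lkey n x \<noteq> int i \<and> lkey n x \<noteq> int i + 1
      \<and> lkey n x \<noteq> 2 * int n - int i \<and> lkey n x \<noteq> 2 * int n + 1 - int i"
      using None f assms by (auto simp: fl_def el_def lkey_def is_letter_def split: if_splits)
    then show ?thesis using f None neutral by blast
  next
    case (Some w)
    then show ?thesis using f assms minus[of w]
      by (auto simp: fl_def el_def lkey_def is_letter_def split: if_splits)
  qed
qed

text \<open>The disjuncts are R1a, R1b, R2a, R2b, in this order, written for the keys of the six
  letters of the two words; the keys of x and bar x add up to 2N+1.\<close>

definition key_rel :: "int \<Rightarrow> int \<Rightarrow> int \<Rightarrow> int \<Rightarrow> int \<Rightarrow> int \<Rightarrow> int \<Rightarrow> bool" where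
  "key_rel N a b c d e f \<longleftrightarrow>
     (a = d \<and> b = f \<and> c = e \<and> c \<le> a \<and> a < b \<and> b + c \<noteq> 2 * N + 1)
   \<or> (a = e \<and> b = d \<and> c = f \<and> a < c \<and> c \<le> b \<and> a + b \<noteq> 2 * N + 1)
   \<or> (a = d \<and> c < N \<and> b + c = 2 * N + 1 \<and> e = c + 1 \<and> e + f = 2 * N + 1 \<and> e \<le> a \<and> a \<le> f)
   \<or> (c = f \<and> e < N \<and> d + e = 2 * N + 1 \<and> a = e + 1 \<and> a + b = 2 * N + 1 \<and> a \<le> c \<and> c \<le> b)"

lemma is_letter_uminus [simp]: "is_letter n (- x) = is_letter n x"
  by (simp add: is_letter_def)

lemma lkey_bounds: "is_letter n x \<Longrightarrow> 1 \<le> lkey n x \<and> lkey n x \<le> 2 * int n"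
  by (auto simp: lkey_def is_letter_def)

lemma lkey_sum_iff:
  "is_letter n x \<Longrightarrow> is_letter n y \<Longrightarrow> lkey n x + lkey n y = 2 * int n + 1 \<longleftrightarrow> y = - x"
  by (auto simp: lkey_def is_letter_def)

lemma lkey_unbarred: "is_letter n x \<Longrightarrow> lkey n x \<le> int n \<Longrightarrow> lkey n x = x \<and> x \<ge> 1"
  by (auto simp: lkey_def is_letter_def split: if_splits)


lemma R1a_key:
  assumes "is_letter n x" "is_letter n y" "is_letter n z"
    "lkey n x \<le> lkey n y" "lkey n y < lkey n z" "lkey n x + lkey n z \<noteq> 2 * int n + 1"
  shows "plac_rel n [y, z, x] [y, x, z]"
  using assms lkey_sum_iff[of n x z] by (intro plac_rel.R1a) (auto simp: lle_def lless_def)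

lemma R1b_key:
  assumes "is_letter n x" "is_letter n y" "is_letter n z"
    "lkey n x < lkey n y" "lkey n y \<le> lkey n z" "lkey n x + lkey n z \<noteq> 2 * int n + 1"
  shows "plac_rel n [x, z, y] [z, x, y]"
  using assms lkey_sum_iff[of n x z] by (intro plac_rel.R1b) (auto simp: lle_def lless_def)

lemma R2a_key:
  assumes "is_letter n y" "is_letter n a" "is_letter n a'" "is_letter n x" "is_letter n x'"
    "lkey n a < int n" "lkey n a + lkey n a' = 2 * int n + 1" "lkey n x = lkey n a + 1"
    "lkey n x + lkey n x' = 2 * int n + 1" "lkey n x \<le> lkey n y" "lkey n y \<le> lkey n x'"
  shows "plac_rel n [y, a', a] [y, x, x']"
proof -
  have "a \<ge> 1" "lkey n a = a" "x \<ge> 1" "lkey n x = x"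
    using lkey_unbarred[of n a] lkey_unbarred[of n x] assms by auto
  moreover have "a' = - a" "x' = - x" using assms lkey_sum_iff[of n a a'] lkey_sum_iff[of n x x'] by auto
  ultimately show ?thesis using plac_rel.R2a[of x n y] assms by (auto simp: lle_def)
qed

lemma R2b_key:
  assumes "is_letter n y" "is_letter n a" "is_letter n a'" "is_letter n x" "is_letter n x'"
    "lkey n a < int n" "lkey n a + lkey n a' = 2 * int n + 1" "lkey n x = lkey n a + 1"
    "lkey n x + lkey n x' = 2 * int n + 1" "lkey n x \<le> lkey n y" "lkey n y \<le> lkey n x'"
  shows "plac_rel n [x, x', y] [a', a, y]"
proof -
  have "a \<ge> 1" "lkey n a = a" "x \<ge> 1" "lkey n x = x"
    using lkey_unbarred[of n a] lkey_unbarred[of n x] assms by auto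
  moreover have "a' = - a" "x' = - x" using assms lkey_sum_iff[of n a a'] lkey_sum_iff[of n x x'] by auto
  ultimately show ?thesis using plac_rel.R2b[of x n y] assms by (auto simp: lle_def)
qed

lemma key_relI:
  assumes L: "is_letter n a" "is_letter n b" "is_letter n c" "is_letter n d" "is_letter n e" "is_letter n f"
  assumes "key_rel (int n) (lkey n a) (lkey n b) (lkey n c) (lkey n d) (lkey n e) (lkey n f)"
  shows "plac_rel n [a, b, c] [d, e, f]"
  using assms(7) unfolding key_rel_def
proof (elim disjE conjE)
  assume k: "lkey n a = lkey n d" "lkey n b = lkey n f" "lkey n c = lkey n e"
    "lkey n c \<le> lkey n a" "lkey n a < lkey n b" "lkey n b + lkey n c \<noteq> 2 * int n + 1"
  have "a = d" "b = f" "c = e" using lkey_inj L k by blast+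
  then show ?thesis using R1a_key[of n c a b] L k by simp
next
  assume k: "lkey n a = lkey n e" "lkey n b = lkey n d" "lkey n c = lkey n f"
    "lkey n a < lkey n c" "lkey n c \<le> lkey n b" "lkey n a + lkey n b \<noteq> 2 * int n + 1"
  have "a = e" "b = d" "c = f" using lkey_inj L k by blast+
  then show ?thesis using R1b_key[of n a c b] L k by simp
next
  assume k: "lkey n a = lkey n d" "lkey n c < int n" "lkey n b + lkey n c = 2 * int n + 1"
    "lkey n e = lkey n c + 1" "lkey n e + lkey n f = 2 * int n + 1" "lkey n e \<le> lkey n a" "lkey n a \<le> lkey n f"
  have "a = d" using lkey_inj L k by blast
  then show ?thesis using R2a_key[of n a c b e f] L k by simp
next
  assume k: "lkey n c = lkey n f" "lkey n e < int n" "lkey n d + lkey n e = 2 * int n + 1"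
    "lkey n a = lkey n e + 1" "lkey n a + lkey n b = 2 * int n + 1" "lkey n a \<le> lkey n c" "lkey n c \<le> lkey n b"
  have "c = f" using lkey_inj L k by blast
  then show ?thesis using R2b_key[of n c e d a b] L k by simp
qed

text \<open>The two images may be related by a different relation than the original words. For y
  inactive, f_i sends the instance [y, bar(i+1), i], [y, i, bar(i+1)] of R1a to [y, bar i, i],
  [y, i+1, bar(i+1)], which is an instance of R2a. This is why \<open>key_rel\<close> treats all
  four relations at once.\<close>

definition compat :: "nat \<Rightarrow> nat \<Rightarrow> int list \<Rightarrow> int list \<Rightarrow> bool" where
  "compat n i l r \<longleftrightarrow> eps n i l = eps n i r \<and> phi n i l = phi n i r \<and>
    (\<forall>l' r'. fw n i l = Some l' \<longrightarrow> fw n i r = Some r' \<longrightarrow> plac_rel n l' r')"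

lemma R1a_compat:
  assumes "is_letter n x" "is_letter n y" "is_letter n z"
    "lkey n x \<le> lkey n y" "lkey n y < lkey n z" "lkey n x + lkey n z \<noteq> 2 * int n + 1"
    "1 \<le> i" "i \<le> n"
  shows "compat n i [y, z, x] [y, x, z]"
  apply (rule letter_status[OF assms(1) assms(7,8)]; rule letter_status[OF assms(3) assms(7,8)]; rule letter_status[OF assms(2) assms(7,8)])
  apply (simp_all add: fw_Cons fw_Nil compat_def)
  by (insert assms) ((rule key_relI, assumption+, unfold key_rel_def)?, smt (z3))+

lemma R1b_compat:
  assumes "is_letter n x" "is_letter n y" "is_letter n z"
    "lkey n x < lkey n y" "lkey n y \<le> lkey n z" "lkey n x + lkey n z \<noteq> 2 * int n + 1"
    "1 \<le> i" "i \<le> n"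
  shows "compat n i [x, z, y] [z, x, y]"
  apply (rule letter_status[OF assms(1) assms(7,8)]; rule letter_status[OF assms(3) assms(7,8)]; rule letter_status[OF assms(2) assms(7,8)])
  apply (simp_all add: fw_Cons fw_Nil compat_def)
  by (insert assms) ((rule key_relI, assumption+, unfold key_rel_def)?, smt (z3))+

lemma R2a_compat:
  assumes L: "is_letter n y" "is_letter n a" "is_letter n x"
    and i: "1 \<le> i" "i \<le> n"
    and k: "lkey n a < int n" "lkey n x = lkey n a + 1" "lkey n x \<le> lkey n y" "lkey n y \<le> lkey n (- x)"
  shows "compat n i [y, - a, a] [y, x, - x]"
  apply (rule letter_status[OF L(2) i]; rule letter_status[OF L(3) i]; rule letter_status[OF L(1) i])
                      apply (insert L i k lkey_uminus[OF L(2)] lkey_uminus[OF L(3)])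
                      apply (simp_all add: compat_def fw_Cons fw_Nil el_uminus fl_uminus)
  by ((elim disjE; simp; fail)
     | (rule key_relI; ((simp; fail) | (unfold key_rel_def, smt (z3) lkey_uminus) | (unfold key_rel_def; (elim disjE)?; (rule disjI2, rule disjI2, ((rule disjI1; intro conjI; linarith; fail) | (rule disjI2; intro conjI; linarith; fail)))))))+

lemma R2b_compat:
  assumes L: "is_letter n y" "is_letter n a" "is_letter n x"
    and i: "1 \<le> i" "i \<le> n"
    and k: "lkey n a < int n" "lkey n x = lkey n a + 1" "lkey n x \<le> lkey n y" "lkey n y \<le> lkey n (- x)"
  shows "compat n i [x, - x, y] [- a, a, y]"
  apply (rule letter_status[OF L(2) i]; rule letter_status[OF L(3) i]; rule letter_status[OF L(1) i])
                      apply (insert L i k lkey_uminus[OF L(2)] lkey_uminus[OF L(3)])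
                      apply (simp_all add: compat_def fw_Cons fw_Nil el_uminus fl_uminus)
  by ((elim disjE; simp; fail)
     | (rule key_relI; ((simp; fail) | (unfold key_rel_def, smt (z3) lkey_uminus) | (unfold key_rel_def; (elim disjE)?; (rule disjI2, rule disjI2, ((rule disjI1; intro conjI; linarith; fail) | (rule disjI2; intro conjI; linarith; fail)))))))+


lemma compat_triples:
  assumes "is_letter n x" "is_letter n y" "is_letter n z" "1 \<le> i" "i \<le> n"
  shows "lle n x y \<Longrightarrow> lless n y z \<Longrightarrow> z \<noteq> - x \<Longrightarrow> compat n i [y, z, x] [y, x, z]"
    and "lless n x y \<Longrightarrow> lle n y z \<Longrightarrow> z \<noteq> - x \<Longrightarrow> compat n i [x, z, y] [z, x, y]"
  using R1a_compat[OF assms(1,2,3) _ _ _ assms(4,5)] R1b_compat[OF assms(1,2,3) _ _ _ assms(4,5)]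
    lkey_sum_iff[OF assms(1,3)] by (auto simp: lle_def lless_def)

text \<open>The columns contracted by relation R3: if all proper factors are admissible then N(y) exceeds y by at
  most 1, and the least z with N(z) > z automatically occurs together with its barred partner.\<close>
definition contractible :: "nat \<Rightarrow> int list \<Rightarrow> int \<Rightarrow> bool" where
  "contractible n w z \<longleftrightarrow> is_column n w \<and> 1 \<le> z \<and> z \<le> int n \<and> U w z + V w z = z + 1
     \<and> (\<forall>y. 1 \<le> y \<and> y < z \<longrightarrow> U w y + V w y \<le> y)
     \<and> (\<forall>y. 1 \<le> y \<and> y \<le> int n \<longrightarrow> U w y + V w y \<le> y + 1)"

abbreviation remove_pair :: "int \<Rightarrow> int list \<Rightarrow> int list" where
  "remove_pair z w \<equiv> filter (\<lambda>x. x \<noteq> z \<and> x \<noteq> - z) w"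

text \<open>From z-1 to z the count N grows from at most z-1 to z+1, and each of z, bar z
  contributes at most one.\<close>

lemma contractible_mem:
  assumes "contractible n w z"
  shows "z \<in> set w" "- z \<in> set w"
proof -
  have "U w (z - 1) + V w (z - 1) \<le> z - 1"
    using assms spec[of "\<lambda>y. 1 \<le> y \<and> y < z \<longrightarrow> U w y + V w y \<le> y" "z - 1"]
    by (cases "z = 1") (auto simp: contractible_def)
  then show "z \<in> set w" "- z \<in> set w"
    using assms U_step[of z w] V_step[of z w] by (auto simp: contractible_def of_bool_def split: if_splits)
qed

lemma U_mono_set: "set b \<subseteq> set w \<Longrightarrow> U b k \<le> U w k"
  and V_mono_set: "set b \<subseteq> set w \<Longrightarrow> V b k \<le> V w k"
  by (auto simp: U_def V_def intro!: card_mono)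

lemma U_eq_mem:
  assumes "set b \<subseteq> set w" "U b k = U w k" "x \<in> set w" "0 < x" "x \<le> k"
  shows "x \<in> set b"
proof -
  have "{x \<in> set b. 0 < x \<and> x \<le> k} = {x \<in> set w. 0 < x \<and> x \<le> k}"
    using assms(1,2) by (intro card_subset_eq) (auto simp: U_def)
  then show ?thesis using assms(3-5) by blast
qed

lemma V_eq_mem:
  assumes "set b \<subseteq> set w" "V b k = V w k" "x \<in> set w" "- k \<le> x" "x < 0"
  shows "x \<in> set b"
proof -
  have "{x \<in> set b. - k \<le> x \<and> x < 0} = {x \<in> set w. - k \<le> x \<and> x < 0}"
    using assms(1,2) by (intro card_subset_eq) (auto simp: V_def)
  then show ?thesis using assms(3-5) by blast
qed

lemma U_Cons: "distinct (x # w) \<Longrightarrow> U (x # w) k = U w k + of_bool (0 < x \<and> x \<le> k)"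
proof -
  assume d: "distinct (x # w)"
  have "{y \<in> set (x # w). 0 < y \<and> y \<le> k}
      = (if 0 < x \<and> x \<le> k then insert x {y \<in> set w. 0 < y \<and> y \<le> k} else {y \<in> set w. 0 < y \<and> y \<le> k})"
    by auto
  then show ?thesis using d by (simp add: U_def)
qed

lemma V_Cons: "distinct (x # w) \<Longrightarrow> V (x # w) k = V w k + of_bool (- k \<le> x \<and> x < 0)"
proof -
  assume d: "distinct (x # w)"
  have "{y \<in> set (x # w). - k \<le> y \<and> y < 0}
      = (if - k \<le> x \<and> x < 0 then insert x {y \<in> set w. - k \<le> y \<and> y < 0} else {y \<in> set w. - k \<le> y \<and> y < 0})"
    by auto
  then show ?thesis using d by (simp add: V_def)
qed

lemma contractibleI:
  assumes col: "is_column n w" and ne: "w \<noteq> []" and na: "\<not> admissible_column n w"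
    and fac: "\<forall>a b c. w = a @ b @ c \<and> b \<noteq> [] \<and> length b < length w \<longrightarrow> admissible_column n b"
  shows "contractible n w (LEAST z. 1 \<le> z \<and> z \<le> int n \<and> z \<in> set w \<and> - z \<in> set w \<and> Ncount n w z > z)"
proof -
  \<comment> \<open>Dropping the first letter leaves a proper factor, which is empty or admissible,
    and the dropped letter adds at most one to N(y).\<close>
  have all: "U w y + V w y \<le> y + 1" if "1 \<le> y" "y \<le> int n" for y
  proof -
    obtain x w' where w: "w = x # w'" using ne by (cases w) auto
    have d: "distinct (x # w')" using col w is_column_distinct by blast
    have "U w' y + V w' y \<le> y"
    proof (cases "w' = []")
      case True
      then show ?thesis using that by (simp add: U_def V_def)
    next
      case False
      then have "admissible_column n w'" using fac[rule_format, of "[x]" w' "[]"] w by simp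
      then show ?thesis using that by (auto simp: admissible_iff bounded_counts_def)
    qed
    then show ?thesis using U_Cons[OF d, of y] V_Cons[OF d, of y] w that by auto
  qed
  obtain y where y: "1 \<le> y" "y \<le> int n" "U w y + V w y > y"
    using na col ne by (auto simp: admissible_iff bounded_counts_def not_le)
  \<comment> \<open>The minimum is taken over naturals, where well-foundedness provides it, and is
    afterwards identified with the integer LEAST of R3.\<close>
  define k where "k = (LEAST k. 1 \<le> int k \<and> int k \<le> int n \<and> U w (int k) + V w (int k) > int k)"
  have k: "1 \<le> int k \<and> int k \<le> int n \<and> U w (int k) + V w (int k) > int k"
    unfolding k_def by (rule LeastI[of _ "nat y"]) (use y in auto)
  have kl: "U w j + V w j \<le> j" if "1 \<le> j" "j < int k" for j
    using not_less_Least[of "nat j" "\<lambda>k. 1 \<le> int k \<and> int k \<le> int n \<and> U w (int k) + V w (int k) > int k"]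
      that k unfolding k_def[symmetric] by (auto simp: nat_less_iff)
  have "U w (int k) + V w (int k) = int k + 1" using all[of "int k"] k by linarith
  then have c: "contractible n w (int k)"
    using k kl all col by (auto simp: contractible_def)
  have "(LEAST z. 1 \<le> z \<and> z \<le> int n \<and> z \<in> set w \<and> - z \<in> set w \<and> Ncount n w z > z) = int k"
  proof (rule Least_equality)
    show "1 \<le> int k \<and> int k \<le> int n \<and> int k \<in> set w \<and> - int k \<in> set w \<and> Ncount n w (int k) > int k"
      using k contractible_mem[OF c] Ncount_UV[OF col] by auto
  next
    fix z assume "1 \<le> z \<and> z \<le> int n \<and> z \<in> set w \<and> - z \<in> set w \<and> Ncount n w z > z"
    then show "int k \<le> z" using kl[of z] Ncount_UV[OF col, of z] by force
  qed
  then show ?thesis using c by simp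
qed

text \<open>A factor b with N(y) > y must have y \<ge> z and, since N(y) \<le> y+1 for w, the same
  N(y) as w. So b contains every letter of w up to z and from bar z on. A letter before b would be
  smaller than z, a letter after b greater than bar z; both would occur twice in w. Hence b is all
  of w.\<close>

lemma contractible_plac_rel:
  assumes c: "contractible n w z"
  shows "plac_rel n w (remove_pair z w)"
proof (rule plac_rel.R3)
  have col: "is_column n w" and d: "distinct w"
    using c is_column_distinct by (auto simp: contractible_def)
  show "is_column n w" by fact
  show "\<not> admissible_column n w"
    using c by (auto simp: contractible_def admissible_iff bounded_counts_def intro!: exI[of _ z])
  show "\<forall>a b d. w = a @ b @ d \<and> b \<noteq> [] \<and> length b < length w \<longrightarrow> admissible_column n b"
  proof (intro allI impI)
    fix a b e assume h: "w = a @ b @ e \<and> b \<noteq> [] \<and> length b < length w"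
    have cb: "is_column n b" using col h by (auto simp: is_column_append)
    have sub: "set b \<subseteq> set w" using h by auto
    show "admissible_column n b"
    proof (rule ccontr)
      assume "\<not> admissible_column n b"
      then obtain y where y: "1 \<le> y" "y \<le> int n" "U b y + V b y > y"
        using h cb by (auto simp: admissible_iff bounded_counts_def not_le)
      have yz: "z \<le> y" using c y U_mono_set[OF sub, of y] V_mono_set[OF sub, of y]
        by (force simp: contractible_def)
      have "U w y + V w y \<le> y + 1" using c y by (auto simp: contractible_def)
      then have eq: "U b y = U w y" "V b y = V w y"
        using y(3) U_mono_set[OF sub, of y] V_mono_set[OF sub, of y] by linarith+
      have zz: "lkey n z = z" "lkey n (- z) = 2 * int n + 1 - z" "is_letter n z"
        using c by (auto simp: contractible_def lkey_def is_letter_def)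
      have key_le: "x \<in> set b" if "x \<in> set w" "lkey n x \<le> z \<or> 2 * int n + 1 - z \<le> lkey n x" for x
      proof -
        have "is_letter n x" using col that(1) is_column_letter by blast
        then have "0 < x \<and> x \<le> y \<or> - y \<le> x \<and> x < 0"
          using that(2) yz y by (auto simp: lkey_def is_letter_def split: if_splits)
        then show ?thesis using U_eq_mem[OF sub eq(1) that(1)] V_eq_mem[OF sub eq(2) that(1)] by blast
      qed
      have zb: "z \<in> set b" "- z \<in> set b" using contractible_mem[OF c] key_le zz by auto
      have "a = []"
      proof (cases a)
        case (Cons f a')
        then have "lless n f z" using col h zb by (auto simp: is_column_append is_column_Cons)
        then have "f \<in> set b" using key_le[of f] h Cons zz by (auto simp: lless_def)
        then show ?thesis using d h Cons by auto
      qed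
      moreover have "e = []"
      proof (cases e)
        case (Cons f e')
        then have "lless n (- z) f" using col h zb by (auto simp: is_column_append is_column_Cons)
        then have "f \<in> set b" using key_le[of f] h Cons zz by (auto simp: lless_def)
        then show ?thesis using d h Cons by auto
      qed
      ultimately show False using h by (metis append_Nil append_Nil2 less_irrefl)
    qed
  qed
  show "z = (LEAST z. 1 \<le> z \<and> z \<le> int n \<and> z \<in> set w \<and> - z \<in> set w \<and> Ncount n w z > z)"
  proof (rule Least_equality[symmetric])
    show "1 \<le> z \<and> z \<le> int n \<and> z \<in> set w \<and> - z \<in> set w \<and> Ncount n w z > z"
      using c contractible_mem[OF c] Ncount_UV[OF col] by (auto simp: contractible_def)
  next
    fix y assume "1 \<le> y \<and> y \<le> int n \<and> y \<in> set w \<and> - y \<in> set w \<and> Ncount n w y > y"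
    then show "z \<le> y" using c Ncount_UV[OF col, of y] by (force simp: contractible_def)
  qed
qed

lemma is_column_remove_pair: "is_column n w \<Longrightarrow> is_column n (remove_pair z w)"
  by (rule is_column_filter)

lemma N_step: "1 \<le> k \<Longrightarrow> U c k + V c k = U c (k - 1) + V c (k - 1) + of_bool (k \<in> set c) + of_bool (- k \<in> set c)"
  using U_step[of k c] V_step[of k c] by simp

text \<open>All clauses compare N at i-1, i, i+1 with the value z+1 at z and the bounds elsewhere.
  The last one says that N(i) still has room for one more letter, as required when bar(i+1) becomes
  bar i.\<close>

lemma contractible_local:
  assumes c: "contractible n w z" and i: "1 \<le> i" "i < n"
  shows "z = int i + 1 \<Longrightarrow> int i \<in> set w \<or> - int i \<in> set w"
    "z = int i + 1 \<Longrightarrow> U w (int i) + V w (int i) = int i"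
    "z = int i \<Longrightarrow> \<not> (int i + 1 \<in> set w \<and> - int i - 1 \<in> set w)"
    "z \<noteq> int i \<Longrightarrow> z \<noteq> int i + 1 \<Longrightarrow> - int i - 1 \<in> set w \<Longrightarrow> - int i \<notin> set w \<Longrightarrow>
       (int i \<in> set w \<longrightarrow> int i + 1 \<in> set w) \<Longrightarrow>
       U w (int i) + V w (int i) + 1 \<le> (if int i < z then int i else int i + 1)"
proof -
  let ?N = "\<lambda>k. U w k + V w k"
  have le: "?N y \<le> y" if "0 \<le> y" "y < z" for y
    using c that by (cases "y = 0") (auto simp: contractible_def)
  have le1: "?N y \<le> y + 1" if "0 \<le> y" "y \<le> int n" for y
    using c that by (cases "y = 0") (auto simp: contractible_def)
  have z: "?N z = z + 1" using c by (simp add: contractible_def)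
  have s1: "?N (int i + 1) = ?N (int i) + of_bool (int i + 1 \<in> set w) + of_bool (- int i - 1 \<in> set w)"
    using N_step[of "int i + 1" w] by simp
  have s0: "?N (int i) = ?N (int i - 1) + of_bool (int i \<in> set w) + of_bool (- int i \<in> set w)"
    using N_step[of "int i" w] i by simp
  note m = contractible_mem[OF c]
  show 2: "U w (int i) + V w (int i) = int i" if "z = int i + 1"
    using s1 m that z by simp
  show "int i \<in> set w \<or> - int i \<in> set w" if "z = int i + 1"
    using 2[OF that] s0 le[of "int i - 1"] that i by (auto simp: of_bool_def split: if_splits)
  show "\<not> (int i + 1 \<in> set w \<and> - int i - 1 \<in> set w)" if "z = int i"
    using s1 z that le1[of "int i + 1"] i by auto
  show "U w (int i) + V w (int i) + 1 \<le> (if int i < z then int i else int i + 1)"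
    if h: "z \<noteq> int i" "z \<noteq> int i + 1" "- int i - 1 \<in> set w" "- int i \<notin> set w"
       "int i \<in> set w \<longrightarrow> int i + 1 \<in> set w"
  proof (cases "int i < z")
    case True
    then show ?thesis using h s0 s1 le[of "int i - 1"] le[of "int i + 1"] i
      by (auto simp: of_bool_def split: if_splits)
  next
    case False
    then show ?thesis using h s0 s1 le1[of "int i - 1"] le1[of "int i + 1"] i
      by (auto simp: of_bool_def split: if_splits)
  qed
qed

lemma mem_remove_pair: "x \<in> set (remove_pair z w) \<longleftrightarrow> x \<in> set w \<and> x \<noteq> z \<and> x \<noteq> - z"
  by simp

text \<open>Removing the pair alters the signature for i < n in two configurations only: z = i with
  both i+1 and bar(i+1) present, and z = i+1 with neither i nor bar i present. These are exactly the
  ones excluded by \<open>contractible_local\<close>. For index n and z = n the removed signs + -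
  cancel each other.\<close>

lemma contract_eps_phi:
  assumes c: "contractible n w z" and i: "1 \<le> i" "i \<le> n"
  shows "eps n i (remove_pair z w) = eps n i w" "phi n i (remove_pair z w) = phi n i w"
proof -
  have col: "is_column n w" using c by (simp add: contractible_def)
  note colr = is_column_remove_pair[OF col, of z]
  note m = contractible_mem[OF c]
  have z: "1 \<le> z" using c by (simp add: contractible_def)
  have "eps n i (remove_pair z w) = eps n i w \<and> phi n i (remove_pair z w) = phi n i w"
  proof (cases "i < n")
    case True
    consider "z = int i" | "z = int i + 1" | "z \<noteq> int i" "z \<noteq> int i + 1" by blast
    then show ?thesis
    proof cases
      case 1
      then show ?thesis
        using contractible_local(3)[OF c i(1) True] m i(1)
        unfolding eps_column[OF col i(1) True] eps_column[OF colr i(1) True]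
          phi_column[OF col i(1) True] phi_column[OF colr i(1) True] mem_remove_pair
        by (cases "int i + 1 \<in> set w"; cases "- int i - 1 \<in> set w") simp_all
    next
      case 2
      then show ?thesis
        using contractible_local(1)[OF c i(1) True] m i(1)
        unfolding eps_column[OF col i(1) True] eps_column[OF colr i(1) True]
          phi_column[OF col i(1) True] phi_column[OF colr i(1) True] mem_remove_pair
        by (cases "int i \<in> set w"; cases "- int i \<in> set w") simp_all
    next
      case 3
      have "- int i \<noteq> - z \<and> - int i - 1 \<noteq> - z \<and> - int i \<noteq> z \<and> - int i - 1 \<noteq> z
          \<and> int i \<noteq> - z \<and> int i + 1 \<noteq> - z"
        using 3 z by auto
      then show ?thesis
        unfolding eps_column[OF col i(1) True] eps_column[OF colr i(1) True]
          phi_column[OF col i(1) True] phi_column[OF colr i(1) True] mem_remove_pair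
        using 3 by simp
    qed
  next
    case False
    then have [simp]: "i = n" using i by simp
    have n: "1 \<le> n" using i by simp
    have "int n \<in> set (remove_pair z w) \<longleftrightarrow> int n \<in> set w \<and> z \<noteq> int n"
      "- int n \<in> set (remove_pair z w) \<longleftrightarrow> - int n \<in> set w \<and> z \<noteq> int n"
      using z n by auto
    then show ?thesis
      unfolding \<open>i = n\<close> eps_column_n[OF col n] eps_column_n[OF colr n]
          phi_column_n[OF col n] phi_column_n[OF colr n]
      using m by (cases "z = int n") simp_all
  qed
  then show "eps n i (remove_pair z w) = eps n i w" "phi n i (remove_pair z w) = phi n i w" by auto
qed

lemma contractible_mono:
  assumes c: "contractible n w z" and "is_column n w'" "U w' z + V w' z = z + 1"
    and le: "\<And>y. U w' y + V w' y \<le> U w y + V w y"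
  shows "contractible n w' z"
proof -
  have "U w' y + V w' y \<le> y" if "1 \<le> y" "y < z" for y
    using c le[of y] that by (force simp: contractible_def)
  moreover have "U w' y + V w' y \<le> y + 1" if "1 \<le> y" "y \<le> int n" for y
    using c le[of y] that by (force simp: contractible_def)
  ultimately show ?thesis using assms by (simp add: contractible_def)
qed

text \<open>Usually z persists. If z = i and i becomes i+1, then bar(i+1) is present as well and the
  pair to contract becomes that of i+1, while on the contracted word the operator turns bar(i+1)
  into bar i. If z = i+1 and bar(i+1) becomes bar i, the pair changes to that of i, and on the
  contracted word i becomes i+1. Both routes lead to the same set of letters, hence to the same
  column.\<close>

lemma contract_fw:
  assumes c: "contractible n w z" and w': "fw n i w = Some w'" and v: "fw n i (remove_pair z w) = Some v"
  shows "\<exists>z'. contractible n w' z' \<and> v = remove_pair z' w'"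
proof -
  define r where "r = remove_pair z w"
  have sr: "set r = {x \<in> set w. x \<noteq> z \<and> x \<noteq> - z}" by (simp add: r_def)
  have i: "1 \<le> i" "i \<le> n" using fw_index[OF w'] by auto
  have col: "is_column n w" and z: "1 \<le> z" "z \<le> int n" using c by (simp_all add: contractible_def)
  note colr = is_column_remove_pair[OF col, of z, folded r_def]
  note m = contractible_mem[OF c]
  have cd: "U w z + V w z = z + 1" "\<And>y. 1 \<le> y \<Longrightarrow> y < z \<Longrightarrow> U w y + V w y \<le> y"
     "\<And>y. 1 \<le> y \<Longrightarrow> y \<le> int n \<Longrightarrow> U w y + V w y \<le> y + 1"
    using c by (auto simp: contractible_def)
  show ?thesis
  proof (cases "i < n")
    case True
    note loc = contractible_local[OF c i(1) True]
    note fc = fw_column[OF col i(1) True w'] and fr = fw_column[OF colr i(1) True v[folded r_def]]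
      and cnt = fw_column_counts[OF col i(1) True w']
    have col': "is_column n w'" and colv: "is_column n v" using fc fr by blast+
    have eqI: "v = remove_pair z' w'" if "set v = set (remove_pair z' w')" for z'
      using is_column_eqI[OF colv is_column_remove_pair[OF col'] that] .
    from fc consider
      (A) "int i \<in> set w" "int i + 1 \<notin> set w" "- int i \<in> set w \<longrightarrow> - int i - 1 \<in> set w"
         "set w' = insert (int i + 1) (set w - {int i})"
    | (B) "- int i - 1 \<in> set w" "- int i \<notin> set w" "int i \<in> set w \<longrightarrow> int i + 1 \<in> set w"
         "set w' = insert (- int i) (set w - {- int i - 1})"
      by blast
    then show ?thesis
    proof cases
      case A
      have cn: "U w' k = U w k - of_bool (k = int i)" "V w' k = V w k" for k
        using cnt A by blast+
      show ?thesis
      proof (cases "z = int i")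
        case zi: True
        have "- int i - 1 \<in> set w" using m A zi by simp
        have "U w (int i + 1) + V w (int i + 1) = int i + 2"
          using N_step[of "int i + 1" w] A cd(1) zi \<open>- int i - 1 \<in> set w\<close> by simp
        then have "contractible n w' (int i + 1)"
          using col' i True cd zi unfolding contractible_def cn by force
        moreover have "set v = set (remove_pair (int i + 1) w')"
        proof -
          have "int i \<notin> set r" using sr zi by simp
          then have "set v = insert (- int i) (set r - {- int i - 1})" using fr by blast
          then show ?thesis using m A(2) zi i(1) unfolding set_filter A(4) sr by auto
        qed
        ultimately show ?thesis using eqI by blast
      next
        case zi: False
        have zi1: "z \<noteq> int i + 1" using A m by auto
        have "contractible n w' z"
          by (rule contractible_mono[OF c col']) (simp_all add: cn cd(1) zi)
        moreover have "set v = set (remove_pair z w')"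
        proof -
          have ne: "int i + 1 \<noteq> - z" "- int i \<noteq> - z" "- int i - 1 \<noteq> z" using zi i(1) z by auto
          have "int i \<in> set r" "- int i \<in> set r \<longrightarrow> - int i - 1 \<in> set r"
            using sr zi zi1 i(1) z A by auto
          then have "set v = insert (int i + 1) (set r - {int i})" using fr sr A(2) by blast
          then show ?thesis using zi1 ne(1) unfolding set_filter A(4) sr by auto
        qed
        ultimately show ?thesis using eqI by blast
      qed
    next
      case B
      have cn: "V w' k = V w k + of_bool (k = int i)" "U w' k = U w k" for k
        using cnt B by blast+
      have zi: "z \<noteq> int i" using B m by auto
      show ?thesis
      proof (cases "z = int i + 1")
        case zi1: True
        have "int i \<in> set w" using loc(1) zi1 B by simp
        have "U w y + V w y \<le> y + (if y = int i then 0 else 1)" if "1 \<le> y" "y \<le> int n" for y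
          using cd(3)[OF that] loc(2)[OF zi1] by simp
        then have "contractible n w' (int i)"
          unfolding contractible_def cn using col' i cd(2) zi1 loc(2)[OF zi1] by force
        moreover have "set v = set (remove_pair (int i) w')"
        proof -
          have "- int i - 1 \<notin> set r" using sr zi1 by simp
          then have "set v = insert (int i + 1) (set r - {int i})" using fr by blast
          then show ?thesis using m B(2) zi1 i(1) unfolding set_filter B(4) sr by auto
        qed
        ultimately show ?thesis using eqI by blast
      next
        case zi1: False
        have "contractible n w' z"
        proof -
          have "U w y + V w y + of_bool (y = int i) \<le> y" if "1 \<le> y" "y < z" for y
            using cd(2)[OF that] loc(4)[OF zi zi1 B(1,2,3)] that by (cases "y = int i") simp_all
          moreover have "U w y + V w y + of_bool (y = int i) \<le> y + 1" if "1 \<le> y" "y \<le> int n" for y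
            using cd(3)[OF that] loc(4)[OF zi zi1 B(1,2,3)] by (cases "y = int i") (simp_all split: if_splits)
          ultimately show ?thesis
            unfolding contractible_def cn using col' z cd(1) zi by (simp add: add.assoc)
        qed
        moreover have "set v = set (remove_pair z w')"
        proof -
          have ne: "- int i \<noteq> z" "- int i \<noteq> - z" "- int i - 1 \<noteq> z" using zi i(1) z by auto
          have "- int i - 1 \<in> set r" "int i \<in> set r \<longrightarrow> int i + 1 \<in> set r"
            using sr zi zi1 i(1) z B by auto
          then have "set v = insert (- int i) (set r - {- int i - 1})" using fr sr B(2) by blast
          then show ?thesis using ne unfolding set_filter B(4) sr by auto
        qed
        ultimately show ?thesis using eqI by blast
      qed
    qed
  next
    case False
    then have [simp]: "i = n" using i by simp
    have n: "1 \<le> n" using i by simp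
    note fc = fw_column_n[OF col n w'[simplified]] and fr = fw_column_n[OF colr n v[folded r_def, simplified]]
      and cnt = fw_column_n_counts[OF col n w'[simplified]]
    have col': "is_column n w'" and colv: "is_column n v" using fc fr by blast+
    have zi: "z \<noteq> int n" using fc m by auto
    have "contractible n w' z"
      by (rule contractible_mono[OF c col']) (use cnt cd(1) zi z in simp_all)
    moreover have "set v = set (remove_pair z w')"
    proof -
      have ne: "- int n \<noteq> z" "- int n \<noteq> - z" using zi n z by auto
      have "set v = insert (- int n) (set r - {int n})" "set w' = insert (- int n) (set w - {int n})"
        using fr fc by blast+
      then show ?thesis using ne unfolding set_filter sr by auto
    qed
    then have "v = remove_pair z w'"
      using is_column_eqI[OF colv is_column_remove_pair[OF col']] by blast
    ultimately show ?thesis by blast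
  qed
qed

lemma fl_el_outside: "\<not> (1 \<le> i \<and> i \<le> n) \<Longrightarrow> fl n i x = None \<and> el n i x = None"
  by (auto simp: fl_def el_def)

lemma eps_outside: "\<not> (1 \<le> i \<and> i \<le> n) \<Longrightarrow> eps n i w = 0"
  using fl_el_outside[of i n] by (induction w) auto

lemma phi_outside: "\<not> (1 \<le> i \<and> i \<le> n) \<Longrightarrow> phi n i w = 0"
  using fl_el_outside[of i n] by (induction w) auto

text \<open>The case \<open>empty\<close> arises because the empty column is not admissible, so R3
  has the degenerate instance relating [] to [].\<close>

lemma plac_rel_contract_cases:
  assumes "plac_rel n l r"
  obtains (triple) x y z where "is_letter n x" "is_letter n y" "is_letter n z"
      "lle n x y" "lless n y z" "z \<noteq> - x" "l = [y, z, x]" "r = [y, x, z]"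
    | (triple') x y z where "is_letter n x" "is_letter n y" "is_letter n z"
      "lless n x y" "lle n y z" "z \<noteq> - x" "l = [x, z, y]" "r = [z, x, y]"
    | (pair) x y where "1 < x" "x \<le> int n" "is_letter n y" "lle n x y" "lle n y (- x)"
       "l = [y, - (x - 1), x - 1]" "r = [y, x, - x]"
    | (pair') x y where "1 < x" "x \<le> int n" "is_letter n y" "lle n x y" "lle n y (- x)"
       "l = [x, - x, y]" "r = [- (x - 1), x - 1, y]"
    | (empty) "l = []" "r = []"
    | (contract) z where "contractible n l z" "r = remove_pair z l"
  using assms
proof cases
  case (R1a x y z)
  then show thesis using triple[of x y z] by simp
next
  case (R1b x y z)
  then show thesis using triple'[of x y z] by simp
next
  case (R2a x y)
  then show thesis using pair[of x y] by simp
next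
  case (R2b x y)
  then show thesis using pair'[of x y] by simp
next
  case (R3 z)
  show thesis
  proof (cases "l = []")
    case True
    then show thesis using R3(1) empty by simp
  next
    case False
    then show thesis using contractibleI[OF R3(2) False R3(3,4)] R3(1,5) contract[of z] by simp
  qed
qed

lemma plac_rel_compat:
  assumes "plac_rel n l r" "1 \<le> i" "i \<le> n"
  shows "compat n i l r"
  using assms(1)
proof (cases rule: plac_rel_contract_cases)
  case (triple x y z)
  then show ?thesis using compat_triples(1)[OF triple(1-3) assms(2,3)] by simp
next
  case (triple' x y z)
  then show ?thesis using compat_triples(2)[OF triple'(1-3) assms(2,3)] by simp
next
  case (pair x y)
  have "is_letter n (x - 1)" "is_letter n x" using pair by (auto simp: is_letter_def)
  moreover have "lkey n (x - 1) < int n" "lkey n x = lkey n (x - 1) + 1" using pair by (auto simp: lkey_def)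
  ultimately show ?thesis using R2a_compat[OF pair(3), of "x - 1" x i] pair assms(2,3) by (simp add: lle_def)
next
  case (pair' x y)
  have "is_letter n (x - 1)" "is_letter n x" using pair' by (auto simp: is_letter_def)
  moreover have "lkey n (x - 1) < int n" "lkey n x = lkey n (x - 1) + 1" using pair' by (auto simp: lkey_def)
  ultimately show ?thesis using R2b_compat[OF pair'(3), of "x - 1" x i] pair' assms(2,3) by (simp add: lle_def)
next
  case empty
  then show ?thesis by (simp add: compat_def fw_Nil)
next
  case (contract z)
  then show ?thesis using contract_eps_phi[OF contract(1) assms(2,3)]
    by (auto simp: compat_def dest!: contract_fw[OF contract(1)] contractible_plac_rel)
qed

section \<open>Lowering operators on plactic classes\<close>

definition plac_step :: "nat \<Rightarrow> int list \<Rightarrow> int list \<Rightarrow> bool" where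
  "plac_step n a b \<longleftrightarrow> (\<exists>u v l r. a = u @ l @ v \<and> b = u @ r @ v \<and> plac_rel n l r)"

lemma plactic_plac_step: "plactic n = equivclp (plac_step n)"
  by (simp add: plactic_def plac_step_def[abs_def])

lemma plac_rel_fw:
  assumes "plac_rel n l r"
  shows "eps n i l = eps n i r" "phi n i l = phi n i r" "rel_option (plac_rel n) (fw n i l) (fw n i r)"
proof -
  have "eps n i l = eps n i r \<and> phi n i l = phi n i r \<and> rel_option (plac_rel n) (fw n i l) (fw n i r)"
  proof (cases "1 \<le> i \<and> i \<le> n")
    case True
    then have c: "compat n i l r" using plac_rel_compat assms by blast
    then show ?thesis using fw_None_iff[of n i l] fw_None_iff[of n i r]
      by (cases "fw n i l"; cases "fw n i r") (auto simp: compat_def)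
  next
    case False
    then show ?thesis using eps_outside phi_outside by (simp add: fw_None_iff[THEN iffD2])
  qed
  then show "eps n i l = eps n i r" "phi n i l = phi n i r" "rel_option (plac_rel n) (fw n i l) (fw n i r)"
    by auto
qed

text \<open>Where the operator acts in \<open>u @ l @ v\<close> depends on l only through
  \<open>eps\<close> and \<open>phi\<close>. These agree for l and r, so the same one of the three
  factors is changed on both sides.\<close>

lemma plac_step_fw:
  assumes "plac_step n a b"
  shows "eps n i a = eps n i b \<and> phi n i a = phi n i b \<and> rel_option (plac_step n) (fw n i a) (fw n i b)"
proof -
  obtain u v l r where ab: "a = u @ l @ v" "b = u @ r @ v" and lr: "plac_rel n l r"
    using assms by (auto simp: plac_step_def)
  note e = plac_rel_fw[OF lr, of i]
  have st: "plac_step n (u' @ l @ v') (u' @ r @ v')" for u' v'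
    using lr plac_step_def by blast
  have st': "plac_step n (u @ l' @ v) (u @ r' @ v)" if "plac_rel n l' r'" for l' r'
    using that plac_step_def by blast
  have "rel_option (plac_step n) (fw n i a) (fw n i b)"
    using e(3) unfolding ab fw_append eps_append e(1,2)
    by (cases "fw n i u"; cases "fw n i v"; cases "fw n i l"; cases "fw n i r") (auto simp: st st')
  then show ?thesis unfolding ab eps_append phi_append e(1,2) by simp
qed

lemma plactic_refl [simp]: "plactic n a a"
  by (simp add: plactic_plac_step)

lemma plactic_sym: "plactic n a b \<Longrightarrow> plactic n b a"
  unfolding plactic_plac_step by (rule equivclp_sym)

lemma plactic_trans [trans]: "plactic n a b \<Longrightarrow> plactic n b c \<Longrightarrow> plactic n a c"
  unfolding plactic_plac_step by (rule equivclp_trans)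

lemma plac_step_plactic: "plac_step n a b \<Longrightarrow> plactic n a b"
  unfolding plactic_plac_step by (rule r_into_equivclp)

lemma plactic_fw:
  assumes "plactic n a b"
  shows "eps n i a = eps n i b" "phi n i a = phi n i b" "rel_option (plactic n) (fw n i a) (fw n i b)"
proof -
  have "eps n i a = eps n i b \<and> phi n i a = phi n i b \<and> rel_option (plactic n) (fw n i a) (fw n i b)"
    using assms unfolding plactic_plac_step
  proof (induction rule: equivclp_induct)
    case base
    show ?case by (simp add: option.rel_refl)
  next
    case (step y z)
    have "eps n i y = eps n i z \<and> phi n i y = phi n i z \<and> rel_option (plactic n) (fw n i y) (fw n i z)"
      using step(2)
    proof
      assume "plac_step n y z"
      then show ?thesis using plac_step_fw[of n y z i]
        by (auto simp: rel_option_iff split: option.splits dest!: plac_step_plactic)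
    next
      assume "plac_step n z y"
      then show ?thesis using plac_step_fw[of n z y i]
        by (auto simp: rel_option_iff split: option.splits dest!: plac_step_plactic intro: plactic_sym)
    qed
    then show ?case using step(3)
      by (auto simp: rel_option_iff plactic_plac_step split: option.splits intro: equivclp_trans)
  qed
  then show "eps n i a = eps n i b" "phi n i a = phi n i b" "rel_option (plactic n) (fw n i a) (fw n i b)"
    by auto
qed

lemma plactic_fw_Some:
  assumes "plactic n a b" "fw n i a = Some a'"
  obtains b' where "fw n i b = Some b'" "plactic n a' b'"
  using plactic_fw(3)[OF assms(1), of i] assms(2) by (auto simp: option_rel_Some1)

section \<open>Duality of the plactic relations\<close>

lemma contractible_dual: "contractible n w z \<Longrightarrow> contractible n (dual w) z"
  by (auto simp: contractible_def U_dual V_dual is_column_dual add.commute)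

lemma remove_pair_dual: "dual (remove_pair z w) = remove_pair z (dual w)"
  by (induction w) (auto simp: dual_append dual_Cons)

lemma lle_dual: "is_letter n x \<Longrightarrow> is_letter n y \<Longrightarrow> lle n (- x) (- y) = lle n y x"
  and lless_dual: "is_letter n x \<Longrightarrow> is_letter n y \<Longrightarrow> lless n (- x) (- y) = lless n y x"
  by (auto simp: lle_def lless_def lkey_uminus)

text \<open>Duality exchanges R1a with R1b and R2a with R2b, in each case reversing the direction of
  the relation, and maps R3 to itself in the same direction; hence the disjunction.\<close>

lemma plac_rel_dual:
  assumes "plac_rel n l r"
  shows "plac_rel n (dual l) (dual r) \<or> plac_rel n (dual r) (dual l)"
  using assms
proof (cases rule: plac_rel_contract_cases)
  case (triple x y z)
  then show ?thesis using plac_rel.R1b[of n "- z" "- y" "- x"]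
    by (simp add: dual_def lle_dual lless_dual equation_minus_iff)
next
  case (triple' x y z)
  then show ?thesis using plac_rel.R1a[of n "- z" "- y" "- x"]
    by (simp add: dual_def lle_dual lless_dual equation_minus_iff)
next
  case (pair x y)
  have "is_letter n x" using pair by (auto simp: is_letter_def)
  then show ?thesis using plac_rel.R2b[of x n "- y"] pair lle_dual[of n y x] lle_dual[of n "- x" y]
    by (simp add: dual_def)
next
  case (pair' x y)
  have "is_letter n x" using pair' by (auto simp: is_letter_def)
  then show ?thesis using plac_rel.R2a[of x n "- y"] pair' lle_dual[of n y x] lle_dual[of n "- x" y]
    by (simp add: dual_def)
next
  case empty
  then show ?thesis using assms by simp
next
  case (contract z)
  then show ?thesis using contractible_plac_rel[OF contractible_dual] remove_pair_dual by metis
qed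

lemma plactic_dual:
  assumes "plactic n a b"
  shows "plactic n (dual a) (dual b)"
  using assms unfolding plactic_plac_step
proof (induction rule: equivclp_induct)
  case (step y z)
  have *: "plactic n (dual y) (dual z)" if "plac_step n y z" for y z
  proof -
    obtain u v l r where yz: "y = u @ l @ v" "z = u @ r @ v" and lr: "plac_rel n l r"
      using \<open>plac_step n y z\<close> by (auto simp: plac_step_def)
    have "plac_step n (dual y) (dual z) \<or> plac_step n (dual z) (dual y)"
      using plac_rel_dual[OF lr] unfolding yz dual_append plac_step_def append_assoc by blast
    then show ?thesis using plac_step_plactic plactic_sym by blast
  qed
  then show ?case using step plactic_trans plactic_sym unfolding plactic_plac_step by blast
qed simp

lemma plactic_fw_back:
  assumes "plactic n a b" "fw n i a' = Some a"
  obtains b' where "fw n i b' = Some b" "plactic n a' b'"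
proof -
  obtain c where "fw n i (dual b) = Some c" "plactic n (dual a') c"
    using plactic_fw_Some[OF plactic_dual[OF assms(1)] fw_dual[OF assms(2)]] .
  then show thesis using that[of "dual c"] fw_dual[of n i "dual b" c] plactic_dual[of n "dual a'" c] by simp
qed

lemma plactic_append:
  assumes "plactic n a b"
  shows "plactic n (u @ a @ v) (u @ b @ v)"
  using assms unfolding plactic_plac_step
proof (induction rule: equivclp_induct)
  case (step y z)
  have *: "plac_step n (u @ y @ v) (u @ z @ v)" if h: "plac_step n y z" for y z
  proof -
    obtain u' v' l r where yz: "y = u' @ l @ v'" "z = u' @ r @ v'" and lr: "plac_rel n l r"
      using h by (auto simp: plac_step_def)
    have "u @ y @ v = (u @ u') @ l @ (v' @ v)" "u @ z @ v = (u @ u') @ r @ (v' @ v)" by (simp_all add: yz)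
    then show ?thesis using lr unfolding plac_step_def by blast
  qed
  then have "equivclp (plac_step n) (u @ y @ v) (u @ z @ v)" using step(2)
    by (blast intro: equivclp_sym r_into_equivclp)
  then show ?case using step(3) equivclp_trans[of "plac_step n"] by metis
qed simp

lemma plactic_append1: "plactic n a b \<Longrightarrow> plactic n (u @ a) (u @ b)"
  using plactic_append[of n a b u "[]"] by simp

lemma plactic_append2: "plactic n a b \<Longrightarrow> plactic n (a @ v) (b @ v)"
  using plactic_append[of n a b "[]" v] by simp

text \<open>Barred letters count negatively, so a pair of opposite letters is invisible: R2 may
  replace it and R3 may delete it.\<close>

definition weight :: "int list \<Rightarrow> int \<Rightarrow> int" where
  "weight w k = int (count_list w k) - int (count_list w (- k))"

lemma weight_append: "weight (u @ v) k = weight u k + weight v k"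
  by (simp add: weight_def)

lemma count_list_distinct: "distinct xs \<Longrightarrow> count_list xs x = of_bool (x \<in> set xs)"
  by (induction xs) auto

lemma weight_remove_pair: "is_column n w \<Longrightarrow> z \<in> set w \<Longrightarrow> - z \<in> set w \<Longrightarrow> z \<noteq> 0 \<Longrightarrow>
    weight (remove_pair z w) k = weight w k"
proof -
  assume h: "is_column n w" "z \<in> set w" "- z \<in> set w" "z \<noteq> 0"
  show ?thesis
    using h is_column_distinct[OF h(1)] by (auto simp: weight_def count_list_distinct)
qed

lemma plac_rel_weight:
  assumes "plac_rel n l r" "k \<noteq> 0"
  shows "weight l k = weight r k"
  using assms(1)
proof (cases rule: plac_rel_contract_cases)
  case (contract z)
  then show ?thesis using weight_remove_pair contractible_mem[OF contract(1)]
    by (auto simp: contractible_def)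
qed (use assms(2) in \<open>auto simp: weight_def\<close>)

lemma plactic_weight:
  assumes "plactic n a b" "k \<noteq> 0"
  shows "weight a k = weight b k"
  using assms(1) unfolding plactic_plac_step
  by (induction rule: equivclp_induct)
    (auto simp: plac_step_def weight_append plac_rel_weight[OF _ assms(2)])

section \<open>The order on admissible columns\<close>

text \<open>With N(y) = U d y + V d y, the left split column of d has x - V d x + max (N(y) - y) letters up to x, the
  maximum being over x \<le> y \<le> n, and dually for the right split column of c. Comparing these counts at
  every letter gives the inequalities below, in which a crystal operator only changes values at its index.\<close>
definition fits_at :: "int list \<Rightarrow> int list \<Rightarrow> int \<Rightarrow> int \<Rightarrow> bool" where
  "fits_at c d x y \<longleftrightarrow>
     U d y + V d y - y \<le> U c x + V d x - x
   \<and> U c y + V c y - y \<le> int (length c) - int (length d) + U c x + V d x - x"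

definition fits :: "nat \<Rightarrow> int list \<Rightarrow> int list \<Rightarrow> bool" where
  "fits n c d \<longleftrightarrow> (\<forall>x y. 0 \<le> x \<and> x \<le> y \<and> y \<le> int n \<longrightarrow> fits_at c d x y)"

lemma fits_transfer:
  assumes "fits n c d"
    and len: "length c' = length c" "length d' = length d"
    and off: "\<And>k. k \<noteq> i \<Longrightarrow> k \<le> int n \<Longrightarrow> U c' k = U c k \<and> V c' k = V c k \<and> U d' k = U d k \<and> V d' k = V d k"
    and row: "\<And>y. i < y \<Longrightarrow> y \<le> int n \<Longrightarrow> fits_at c' d' i y"
    and col: "\<And>x. 0 \<le> x \<Longrightarrow> x < i \<Longrightarrow> fits_at c' d' x i"
    and diag: "fits_at c' d' i i"
  shows "fits n c' d'"
  unfolding fits_def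
proof (intro allI impI)
  fix x y assume xy: "0 \<le> x \<and> x \<le> y \<and> y \<le> int n"
  show "fits_at c' d' x y"
  proof (cases "x = i \<or> y = i")
    case True
    then show ?thesis using row[of y] col[of x] diag xy by force
  next
    case False
    then have "fits_at c' d' x y = fits_at c d x y"
      using off[of x] off[of y] xy len by (simp add: fits_at_def)
    then show ?thesis using assms(1) xy by (simp add: fits_def)
  qed
qed

lemma UV_around:
  assumes "1 \<le> i"
  shows "U c (int i) = U c (int i - 1) + of_bool (int i \<in> set c)"
    "V c (int i) = V c (int i - 1) + of_bool (- int i \<in> set c)"
    "U c (int i + 1) = U c (int i) + of_bool (int i + 1 \<in> set c)"
    "V c (int i + 1) = V c (int i) + of_bool (- int i - 1 \<in> set c)"
  using U_step[of "int i" c] V_step[of "int i" c] U_step[of "int i + 1" c] V_step[of "int i + 1" c] assms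
  by auto

text \<open>The row of i is controlled by the rows of i-1, i and i+1. For fixed y, put S = N(y) - y
  + i, up to the difference of lengths: the three rows say that S is at most U + V + 1 at i-1, at
  most U + V at i, and at most U + V - 1 at i+1. The hypothesis \<open>loc\<close> for arbitrary S
  thus serves all y > i at once; \<open>locd\<close> and \<open>locc\<close> do the same for the
  columns of the array, and \<open>diag\<close> covers the entry (i, i).\<close>

lemma fits_step:
  assumes i: "1 \<le> i" "i < n" and F: "fits n c d"
    and len: "length c' = length c" "length d' = length d"
    and off: "\<And>k. k \<noteq> int i \<Longrightarrow> U c' k = U c k \<and> V c' k = V c k \<and> U d' k = U d k \<and> V d' k = V d k"
    and loc: "\<And>S. \<lbrakk>S \<le> U c (int i - 1) + V d (int i - 1) + 1; S \<le> U c (int i) + V d (int i);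
               S \<le> U c (int i + 1) + V d (int i + 1) - 1\<rbrakk> \<Longrightarrow> S \<le> U c' (int i) + V d' (int i)"
    and locd: "\<And>S. \<lbrakk>U d (int i - 1) + V d (int i - 1) + 1 \<le> S; U d (int i) + V d (int i) \<le> S;
               U d (int i + 1) + V d (int i + 1) - 1 \<le> S\<rbrakk> \<Longrightarrow> U d' (int i) + V d' (int i) \<le> S"
    and locc: "\<And>S. \<lbrakk>U c (int i - 1) + V c (int i - 1) + 1 \<le> S; U c (int i) + V c (int i) \<le> S;
               U c (int i + 1) + V c (int i + 1) - 1 \<le> S\<rbrakk> \<Longrightarrow> U c' (int i) + V c' (int i) \<le> S"
    and diag: "\<lbrakk>fits_at c d (int i - 1) (int i - 1); fits_at c d (int i) (int i);
        fits_at c d (int i + 1) (int i + 1); fits_at c d (int i - 1) (int i);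
        fits_at c d (int i) (int i + 1)\<rbrakk> \<Longrightarrow> fits_at c' d' (int i) (int i)"
  shows "fits n c' d'"
proof (rule fits_transfer[OF F len off])
  have F': "fits_at c d x y" if "0 \<le> x" "x \<le> y" "y \<le> int n" for x y
    using F that by (auto simp: fits_def)
  fix y assume y: "int i < y" "y \<le> int n"
  have "fits_at c d (int i - 1) y" "fits_at c d (int i) y" "fits_at c d (int i + 1) y"
    using F' y i by auto
  then show "fits_at c' d' (int i) y"
    using loc[of "U d y + V d y - y + int i"] off[of y] y len
      loc[of "U c y + V c y - y + int i - int (length c) + int (length d)"]
    by (simp add: fits_at_def)
next
  have F': "fits_at c d x y" if "0 \<le> x" "x \<le> y" "y \<le> int n" for x y
    using F that by (auto simp: fits_def)
  fix x assume x: "0 \<le> x" "x < int i"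
  have "fits_at c d x (int i - 1)" "fits_at c d x (int i)" "fits_at c d x (int i + 1)"
    using F' x i by auto
  then show "fits_at c' d' x (int i)"
    using locd[of "U c x + V d x - x + int i"] off[of x] x len
      locc[of "int (length c) - int (length d) + U c x + V d x - x + int i"]
    by (simp add: fits_at_def)
next
  show "fits_at c' d' (int i) (int i)"
    by (rule diag) (use F i in \<open>auto simp: fits_def\<close>)
qed auto

text \<open>The reading is \<open>d @ c\<close> because a tableau word lists columns from right to
  left. The cases are which column changes and whether its unbarred or its barred part does;
  comparing \<open>eps\<close> of c with \<open>phi\<close> of d then restricts the letters of the
  other column near i. \<open>fits_step\<close> is used twice, the second time with old and new
  columns exchanged.\<close>

lemma fits_fw_lt:
  assumes col: "is_column n c" "is_column n d" and i: "1 \<le> i" "i < n"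
    and f: "fw n i (d @ c) = Some (d' @ c')" "length d = length d'"
  shows "fits n c d \<longleftrightarrow> fits n c' d'"
proof -
  note e = eps_column[OF col(1) i] phi_column[OF col(2) i]
  note s = UV_around[OF i(1), of c] UV_around[OF i(1), of d]
  have len: "length c' = length c" "length d' = length d"
    using fw_length[OF f(1)] f(2) by auto
  have len': "length c = length c'" "length d = length d'" using len by simp_all
  from fw_append_Some[OF f] consider
    (D) "fw n i d = Some d'" "c' = c" "eps n i c < phi n i d"
  | (C) "d' = d" "fw n i c = Some c'" "phi n i d \<le> eps n i c"
    by blast
  then show ?thesis
  proof cases
    case C
    note q = C(3)[unfolded e]
    from fw_column_counts[OF col(1) i C(2)]
    show ?thesis
    proof (elim disjE conjE)
      assume A: "int i \<in> set c" "int i + 1 \<notin> set c" "- int i \<in> set c \<longrightarrow> - int i - 1 \<in> set c"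
        "\<forall>k. U c' k = U c k - of_bool (k = int i)" "\<forall>k. V c' k = V c k"
      note B = A(4,5)
      \<comment> \<open>This is what the tensor product rule says about the unchanged column: the +
        of d must not outnumber the - available in c.\<close>
      have r: "- int i - 1 \<in> set d \<longrightarrow> - int i \<in> set d"
        "int i \<in> set d \<longrightarrow> int i + 1 \<notin> set d \<longrightarrow> - int i \<in> set d \<and> - int i - 1 \<notin> set d"
        using q A(1-3) by (auto simp: of_bool_def split: if_splits)
      show ?thesis
      proof
        assume "fits n c d"
        then show "fits n c' d'"
          by (rule fits_step[OF i _ len]; simp_all add: fits_at_def B s len C(1) A(1,2);
            use A(3) r in \<open>auto simp: of_bool_def split: if_splits\<close>)
      next
        assume "fits n c' d'"
        then show "fits n c d"
          by (rule fits_step[OF i _ len']; simp_all add: fits_at_def B s len C(1) A(1,2);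
            use A(3) r in \<open>auto simp: of_bool_def split: if_splits\<close>)
      qed
    next
      assume A: "- int i - 1 \<in> set c" "- int i \<notin> set c" "int i \<in> set c \<longrightarrow> int i + 1 \<in> set c"
        "\<forall>k. U c' k = U c k" "\<forall>k. V c' k = V c k + of_bool (k = int i)"
      note B = A(4,5)
      have r: "phi n i d \<le> of_bool (int i + 1 \<in> set c) - of_bool (int i \<in> set c)"
        using q A(1-3) e(2) by simp
      note r = r[unfolded e(2)]
      show ?thesis
      proof
        assume "fits n c d"
        then show "fits n c' d'"
          by (rule fits_step[OF i _ len]; simp_all add: fits_at_def B s len C(1) A(1,2);
            use A(3) r in \<open>auto simp: of_bool_def split: if_splits\<close>)
      next
        assume "fits n c' d'"
        then show "fits n c d"
          by (rule fits_step[OF i _ len']; simp_all add: fits_at_def B s len C(1) A(1,2);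
            use A(3) r in \<open>auto simp: of_bool_def split: if_splits\<close>)
      qed
    qed
  next
    case D
    note q = D(3)[unfolded e]
    from fw_column_counts[OF col(2) i D(1)]
    show ?thesis
    proof (elim disjE conjE)
      assume A: "int i \<in> set d" "int i + 1 \<notin> set d" "- int i \<in> set d \<longrightarrow> - int i - 1 \<in> set d"
        "\<forall>k. U d' k = U d k - of_bool (k = int i)" "\<forall>k. V d' k = V d k"
      note B = A(4,5)
      have r: "eps n i c < 1 + of_bool (- int i - 1 \<in> set d) - of_bool (- int i \<in> set d)"
        using q A(1-3) e(1) by simp
      note r = r[unfolded e(1)]
      show ?thesis
      proof
        assume "fits n c d"
        then show "fits n c' d'"
          by (rule fits_step[OF i _ len]; simp_all add: fits_at_def B s len D(2) A(1,2);
            use A(3) r in \<open>auto simp: of_bool_def split: if_splits\<close>)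
      next
        assume "fits n c' d'"
        then show "fits n c d"
          by (rule fits_step[OF i _ len']; simp_all add: fits_at_def B s len D(2) A(1,2);
            use A(3) r in \<open>auto simp: of_bool_def split: if_splits\<close>)
      qed
    next
      assume A: "- int i - 1 \<in> set d" "- int i \<notin> set d" "int i \<in> set d \<longrightarrow> int i + 1 \<in> set d"
        "\<forall>k. U d' k = U d k" "\<forall>k. V d' k = V d k + of_bool (k = int i)"
      note B = A(4,5)
      have r: "int i + 1 \<in> set c \<longrightarrow> int i \<in> set c"
        "- int i \<in> set c \<longrightarrow> - int i - 1 \<notin> set c \<longrightarrow> int i \<in> set c \<and> int i + 1 \<notin> set c"
        using q A(1-3) by (auto simp: of_bool_def split: if_splits)
      show ?thesis
      proof
        assume "fits n c d"
        then show "fits n c' d'"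
          by (rule fits_step[OF i _ len]; simp_all add: fits_at_def B s len D(2) A(1,2);
            use A(3) r in \<open>auto simp: of_bool_def split: if_splits\<close>)
      next
        assume "fits n c' d'"
        then show "fits n c d"
          by (rule fits_step[OF i _ len']; simp_all add: fits_at_def B s len D(2) A(1,2);
            use A(3) r in \<open>auto simp: of_bool_def split: if_splits\<close>)
      qed
    qed
  qed
qed

text \<open>Index n replaces n by bar n, so at n the count U falls, V rises and their sum N(n) is
  unchanged. Among pairs x \<le> y \<le> n only the inequalities at (n, n) are affected; there
  \<open>length_column\<close> expresses N(n) by the length.\<close>

lemma fits_fw_n:
  assumes col: "is_column n c" "is_column n d" and i: "1 \<le> n"
    and f: "fw n n (d @ c) = Some (d' @ c')" "length d = length d'"
  shows "fits n c d \<longleftrightarrow> fits n c' d'"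
proof -
  note e = eps_column_n[OF col(1) i] phi_column_n[OF col(2) i]
  note s = UV_around(1,2)[OF i, of c] UV_around(1,2)[OF i, of d]
  have len: "length c' = length c" "length d' = length d"
    using fw_length[OF f(1)] f(2) by auto
  note L = length_column[OF col(1)] length_column[OF col(2)]
  have step: "fits n c2 d2"
    if F: "fits n c1 d1" and len: "length c2 = length c1" "length d2 = length d1"
      and off: "\<And>k. k \<noteq> int n \<Longrightarrow> k \<le> int n \<Longrightarrow> U c2 k = U c1 k \<and> V c2 k = V c1 k \<and> U d2 k = U d1 k \<and> V d2 k = V d1 k"
      and N: "U c2 (int n) + V c2 (int n) = U c1 (int n) + V c1 (int n)"
         "U d2 (int n) + V d2 (int n) = U d1 (int n) + V d1 (int n)"
      and diag: "fits_at c1 d1 (int n - 1) (int n - 1) \<Longrightarrow> fits_at c1 d1 (int n) (int n) \<Longrightarrow>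
         fits_at c1 d1 (int n - 1) (int n) \<Longrightarrow> fits_at c2 d2 (int n) (int n)" for c1 d1 c2 d2
  proof (rule fits_transfer[OF F len off])
    fix x assume x: "0 \<le> x" "x < int n"
    have "fits_at c1 d1 x (int n)" using F x by (auto simp: fits_def)
    then show "fits_at c2 d2 x (int n)" using off[of x] x N len by (simp add: fits_at_def)
  next
    show "fits_at c2 d2 (int n) (int n)" by (rule diag) (use F i in \<open>auto simp: fits_def\<close>)
  qed auto
  have len': "length c = length c'" "length d = length d'" using len by simp_all
  from fw_append_Some[OF f] consider
    (D) "fw n n d = Some d'" "c' = c" "eps n n c < phi n n d"
  | (C) "d' = d" "fw n n c = Some c'" "phi n n d \<le> eps n n c"
    by blast
  then show ?thesis
  proof cases
    case C
    note q = C(3)[unfolded e]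
    have A: "int n \<in> set c" "- int n \<notin> set c"
       "\<forall>k. U c' k = U c k - of_bool (k \<ge> int n)" "\<forall>k. V c' k = V c k + of_bool (k \<ge> int n)"
      using fw_column_n_counts[OF col(1) i C(2)] by blast+
    note B = A(3,4)
    have r: "int n \<in> set d \<longrightarrow> - int n \<in> set d"
      using q A(1,2) by (auto simp: of_bool_def split: if_splits)
    show ?thesis
    proof
      assume "fits n c d"
      then show "fits n c' d'"
        by (rule step[OF _ len]; simp_all add: fits_at_def B L len C(1);
            use A(1,2) s r in \<open>auto simp: of_bool_def split: if_splits\<close>)
    next
      assume "fits n c' d'"
      then show "fits n c d"
        by (rule step[OF _ len']; simp_all add: fits_at_def B L len C(1);
            use A(1,2) s r in \<open>auto simp: of_bool_def split: if_splits\<close>)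
    qed
  next
    case D
    note q = D(3)[unfolded e]
    have A: "int n \<in> set d" "- int n \<notin> set d"
       "\<forall>k. U d' k = U d k - of_bool (k \<ge> int n)" "\<forall>k. V d' k = V d k + of_bool (k \<ge> int n)"
      using fw_column_n_counts[OF col(2) i D(1)] by blast+
    note B = A(3,4)
    have r: "- int n \<in> set c \<longrightarrow> int n \<in> set c"
      using q A(1,2) by (auto simp: of_bool_def split: if_splits)
    show ?thesis
    proof
      assume "fits n c d"
      then show "fits n c' d'"
        by (rule step[OF _ len]; simp_all add: fits_at_def B L len D(2);
            use A(1,2) s r in \<open>auto simp: of_bool_def split: if_splits\<close>)
    next
      assume "fits n c' d'"
      then show "fits n c d"
        by (rule step[OF _ len']; simp_all add: fits_at_def B L len D(2);
            use A(1,2) s r in \<open>auto simp: of_bool_def split: if_splits\<close>)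
    qed
  qed
qed

lemma fits_fw:
  assumes "is_column n c" "is_column n d" "fw n i (d @ c) = Some (d' @ c')" "length d = length d'"
  shows "fits n c d \<longleftrightarrow> fits n c' d'"
  using fw_index[OF assms(3)] fits_fw_lt[OF assms(1,2) _ _ assms(3,4)] fits_fw_n[OF assms(1,2)] assms(3,4)
  by (cases "i < n") auto

lemma fw_is_column:
  assumes "is_column n c" "fw n i c = Some c'"
  shows "is_column n c'"
  using fw_index[OF assms(2)] fw_column[OF assms(1) _ _ assms(2)] fw_column_n[OF assms(1)] assms(2)
  by (cases "i < n") auto

lemma fw_bounded_counts:
  assumes col: "is_column n c" and b: "bounded_counts n c" and f: "fw n i c = Some c'"
  shows "bounded_counts n c'"
  unfolding bounded_counts_def
proof (intro allI impI)
  fix z assume z: "1 \<le> z \<and> z \<le> int n"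
  have i: "1 \<le> i" "i \<le> n" using fw_index[OF f] by auto
  have le: "U c y + V c y \<le> y" if "0 \<le> y" "y \<le> int n" for y
    using b that by (cases "y = 0") (auto simp: bounded_counts_def)
  show "U c' z + V c' z \<le> z"
  proof (cases "i < n")
    case True
    note s = UV_around[OF i(1), of c]
    from fw_column_counts[OF col i(1) True f] show ?thesis
    proof (elim disjE conjE)
      assume "\<forall>k. U c' k = U c k - of_bool (k = int i)" "\<forall>k. V c' k = V c k"
      then show ?thesis using le[of z] z by (auto simp: of_bool_def)
    next
      assume "- int i - 1 \<in> set c" "- int i \<notin> set c" "int i \<in> set c \<longrightarrow> int i + 1 \<in> set c"
        "\<forall>k. U c' k = U c k" "\<forall>k. V c' k = V c k + of_bool (k = int i)"
      \<comment> \<open>At z = i there are two cases. If i occurs, so do i+1 and bar(i+1), and N(i)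
        + 2 = N(i+1) \<le> i+1. If i does not occur, neither i nor bar i does, and N(i) = N(i-1)
        \<le> i-1. Either way N(i) + 1 \<le> i.\<close>
      then show ?thesis using le[of z] le[of "int i + 1"] le[of "int i - 1"] z s i True
        by (cases "z = int i"; cases "int i \<in> set c"; simp)
    qed
  next
    case False
    then have "i = n" using i by simp
    then show ?thesis using fw_column_n_counts[OF col _ f[unfolded \<open>i = n\<close>]] i le[of z] z by simp
  qed
qed

text \<open>The converse direction is the forward one for the dual words, on which the same operator
  leads from the dual of c' to the dual of c.\<close>

lemma fw_admissible:
  assumes "fw n i c = Some c'"
  shows "admissible_column n c \<longleftrightarrow> admissible_column n c'"
proof
  assume "admissible_column n c"
  then show "admissible_column n c'"
    using fw_is_column[OF _ assms] fw_bounded_counts[OF _ _ assms] fw_length[OF assms]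
    by (auto simp: admissible_iff)
next
  assume "admissible_column n c'"
  then have "admissible_column n (dual c')" by (rule admissible_dual)
  then have "admissible_column n (dual c)"
    using fw_is_column[OF _ fw_dual[OF assms]] fw_bounded_counts[OF _ _ fw_dual[OF assms]]
      fw_length[OF fw_dual[OF assms]]
    by (auto simp: admissible_iff simp flip: length_greater_0_conv)
  then show "admissible_column n c" using admissible_dual[of n "dual c"] by simp
qed

section \<open>The greedy choice of t_1 > ... > t_r in split columns\<close>

definition cz :: "int list \<Rightarrow> int \<Rightarrow> int \<Rightarrow> int" where
  "cz zs x y = int (length (filter (\<lambda>z. x < z \<and> z \<le> y) zs))"

definition cf :: "int list \<Rightarrow> int \<Rightarrow> int \<Rightarrow> int \<Rightarrow> int" where
  "cf c b x y = int (card {f. x < f \<and> f \<le> y \<and> f < b \<and> f \<notin> set c \<and> - f \<notin> set c})"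

text \<open>When the lists are paired with t_k < z_k, this is the number of pairs straddling x, that
  is with t_k \<le> x < z_k.\<close>

definition gain :: "int list \<Rightarrow> int list \<Rightarrow> int \<Rightarrow> int" where
  "gain ts zs x = int (length (filter (\<lambda>t. t \<le> x) ts)) - int (length (filter (\<lambda>z. z \<le> x) zs))"

lemma cz_Cons: "cz (z # zs) x y = of_bool (x < z \<and> z \<le> y) + cz zs x y"
  by (simp add: cz_def)

lemma gain_Cons: "gain (t # ts) (z # zs) x = of_bool (t \<le> x) - of_bool (z \<le> x) + gain ts zs x"
  by (simp add: gain_def)

lemma cz_nonneg: "0 \<le> cz zs x y" and cf_nonneg: "0 \<le> cf c b x y"
  by (simp_all add: cz_def cf_def)

lemma cz_empty [simp]: "cz zs x x = 0"
  by (auto simp: cz_def filter_empty_conv)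

lemma cz_mono: "y \<le> y' \<Longrightarrow> cz zs x y \<le> cz zs x y'"
  by (induction zs) (auto simp: cz_Cons, auto simp: cz_def)

lemma cz_Nil [simp]: "cz [] x y = 0"
  by (simp add: cz_def)

lemma cz_le_all: "\<forall>w\<in>set zs. w < z \<Longrightarrow> cz zs x y \<le> cz zs x z"
  by (induction zs) (auto simp: cz_Cons of_bool_def)

lemma cf_finite: "finite {f :: int. x < f \<and> f \<le> y \<and> f < b \<and> P f}"
  by (rule finite_subset[of _ "{x<..y}"]) auto

lemma cf_mono: "b' \<le> b \<Longrightarrow> y' \<le> y \<Longrightarrow> cf c b' x y' \<le> cf c b x y"
  unfolding cf_def of_nat_le_iff by (rule card_mono[OF cf_finite]) auto

lemma cf_eq_0: "(\<And>f. x < f \<Longrightarrow> f \<le> y \<Longrightarrow> f < b \<Longrightarrow> f \<notin> set c \<Longrightarrow> - f \<notin> set c \<Longrightarrow> False) \<Longrightarrow> cf c b x y = 0"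
  unfolding cf_def by (auto simp: card_eq_0_iff) 

lemma cf_empty [simp]: "cf c b x x = 0"
  by (rule cf_eq_0) simp

lemma cf_cut: "t \<le> y \<Longrightarrow> t \<le> y' \<Longrightarrow> cf c t x y = cf c t x y'"
  unfolding cf_def by (rule arg_cong[where f = "\<lambda>A. int (card A)"]) auto

lemma cf_split:
  assumes "t \<notin> set c" "- t \<notin> set c" "x < t" "t \<le> y" "t < b"
    and gap: "\<And>f. t < f \<Longrightarrow> f \<le> y \<Longrightarrow> f < b \<Longrightarrow> f \<notin> set c \<Longrightarrow> - f \<notin> set c \<Longrightarrow> False"
  shows "cf c b x y = cf c t x y + 1"
proof -
  have "{f. x < f \<and> f \<le> y \<and> f < b \<and> f \<notin> set c \<and> - f \<notin> set c}
      = insert t {f. x < f \<and> f \<le> y \<and> f < t \<and> f \<notin> set c \<and> - f \<notin> set c}"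
    using assms by (auto simp: not_less_iff_gr_or_eq) (metis linorder_neqE)
  then show ?thesis using cf_finite[of x y t "\<lambda>f. f \<notin> set c \<and> - f \<notin> set c"] by (simp add: cf_def)
qed

text \<open>Guarantees that the maxima in tseq are taken over nonempty sets.\<close>
definition matchable :: "int list \<Rightarrow> int \<Rightarrow> int list \<Rightarrow> bool" where
  "matchable c b zs \<longleftrightarrow> sorted_wrt (>) zs \<and> (\<forall>z\<in>set zs. 1 \<le> z \<and> z \<in> set c)
     \<and> (\<forall>y. cz zs 0 y \<le> cf c b 0 y)"

definition next_free :: "int list \<Rightarrow> int \<Rightarrow> int \<Rightarrow> int" where
  "next_free c b z = Max {t. 1 \<le> t \<and> t < min z b \<and> t \<notin> set c \<and> - t \<notin> set c}"

lemma tseq_Cons: "tseq c b (z # zs) = next_free c b z # tseq c (next_free c b z) zs"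
  by (simp add: next_free_def Let_def)

text \<open>\<open>matchable\<close> is Hall's condition for matching each z with a free letter, and
  the greedy choice preserves it. For y < t the free letters are unchanged and the z to be matched
  can only become fewer. For y \<ge> t all remaining z_k lie below z, and passing from z to the rest
  loses exactly one free letter, t, and one letter to match, z.\<close>

lemma matchable_step:
  assumes m: "matchable c b (z # zs)" and t_def: "t = next_free c b z"
  shows "1 \<le> t" "t < z" "t < b" "t \<notin> set c" "- t \<notin> set c"
    "\<And>f. t < f \<Longrightarrow> f \<le> z \<Longrightarrow> f < b \<Longrightarrow> f \<notin> set c \<Longrightarrow> - f \<notin> set c \<Longrightarrow> False"
    "matchable c t zs"
proof -
  let ?T = "{t. 1 \<le> t \<and> t < min z b \<and> t \<notin> set c \<and> - t \<notin> set c}"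
  have fin: "finite ?T" by (rule finite_subset[of _ "{1..z}"]) auto
  have z: "1 \<le> z" "z \<in> set c" "\<forall>w\<in>set zs. w < z" using m by (auto simp: matchable_def)
  have "1 \<le> cz (z # zs) 0 z" using z cz_nonneg[of zs 0 z] by (simp add: cz_Cons)
  also have "\<dots> \<le> cf c b 0 z" using m by (simp add: matchable_def)
  finally have "cf c b 0 z \<noteq> 0" by simp
  then obtain f where "0 < f" "f \<le> z" "f < b" "f \<notin> set c" "- f \<notin> set c"
    using cf_eq_0[of 0 z b c] by blast
  then have "f \<in> ?T" using z(2) by (auto simp: order_le_less)
  then have "?T \<noteq> {}" by blast
  from Max_in[OF fin this] show t: "1 \<le> t" "t < z" "t < b" "t \<notin> set c" "- t \<notin> set c"
    unfolding t_def next_free_def by auto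
  show gap: "False" if "t < f" "f \<le> z" "f < b" "f \<notin> set c" "- f \<notin> set c" for f
  proof -
    have "f \<noteq> z" using that z by auto
    then have "f \<in> ?T" using that t(1) by auto
    then have "f \<le> t" unfolding t_def next_free_def using Max_ge[OF fin] by blast
    then show False using that by simp
  qed
  have "cz zs 0 y \<le> cf c t 0 y" for y
  proof (cases "y < t")
    case True
    have "cz zs 0 y \<le> cz (z # zs) 0 y" by (simp add: cz_Cons)
    also have "\<dots> \<le> cf c b 0 y" using m by (simp add: matchable_def)
    also have "\<dots> = cf c t 0 y"
      unfolding cf_def using True t by (intro arg_cong[where f = "\<lambda>A. int (card A)"]) auto
    finally show ?thesis .
  next
    case False
    have "cz zs 0 y \<le> cz zs 0 z"
      using z(3) by (rule cz_le_all)
    moreover have "1 + cz zs 0 z \<le> cf c b 0 z"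
      using m z spec[of "\<lambda>y. cz (z # zs) 0 y \<le> cf c b 0 y" z] by (simp add: matchable_def cz_Cons)
    moreover have "cf c b 0 z = cf c t 0 z + 1"
      by (rule cf_split) (use t gap in auto)
    moreover have "cf c t 0 z = cf c t 0 y" using cf_cut[of t z y c 0] False t by simp
    ultimately show ?thesis by linarith
  qed
  then show "matchable c t zs" using m by (simp add: matchable_def)
qed

lemma tseq_props:
  assumes "matchable c b zs"
  shows "length (tseq c b zs) = length zs"
    "\<forall>t\<in>set (tseq c b zs). 1 \<le> t \<and> t < b \<and> t \<notin> set c \<and> - t \<notin> set c"
    "sorted_wrt (>) (tseq c b zs)"
  using assms
proof (induction zs arbitrary: b)
  case (Cons z zs)
  {
    case (1 b)
    define t where "t = next_free c b z"
    note s = matchable_step[OF 1 t_def]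
    show ?case using Cons.IH(1)[OF s(7)] by (simp add: tseq_Cons t_def[symmetric] del: tseq.simps)
  next
    case (2 b)
    define t where "t = next_free c b z"
    note s = matchable_step[OF 2 t_def]
    have "1 \<le> u \<and> u < b \<and> u \<notin> set c \<and> - u \<notin> set c" if "u \<in> set (tseq c t zs)" for u
      using Cons.IH(2)[OF s(7)] that s(3) by (meson less_trans)
    then show ?case using s(1,3-5) by (simp add: tseq_Cons t_def[symmetric] del: tseq.simps)
  next
    case (3 b)
    define t where "t = next_free c b z"
    note s = matchable_step[OF 3 t_def]
    show ?case using Cons.IH(2,3)[OF s(7)] s by (simp add: tseq_Cons t_def[symmetric] del: tseq.simps)
  }
qed simp_all

text \<open>A deficiency formula for the greedy matching: the number of z beyond x whose partner
  falls to x or below is the maximum over y \<ge> x of the number of z in the interval from x to y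
  minus the number of free letters there. The first claim is that every y gives a lower bound, the
  second that the bound is attained, with y equal to x or to some z.\<close>

lemma gain_tseq:
  assumes "matchable c b zs" "0 \<le> x"
  shows "\<And>y. x \<le> y \<Longrightarrow> cz zs x y - cf c b x y \<le> gain (tseq c b zs) zs x"
    "\<exists>y. x \<le> y \<and> (y = x \<or> y \<in> set zs) \<and> gain (tseq c b zs) zs x = cz zs x y - cf c b x y"
  using assms
proof (induction zs arbitrary: b)
  case Nil
  {
    case (1 y)
    then show ?case by (simp add: gain_def cz_def cf_nonneg)
  next
    case 2
    then show ?case by (simp add: gain_def cz_def)
  }
next
  case (Cons z zs)
  have g: "gain (tseq c b (z # zs)) (z # zs) x
      = of_bool (t \<le> x) - of_bool (z \<le> x) + gain (tseq c t zs) zs x" if t_def: "t = next_free c b z" for b t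
    by (simp add: tseq_Cons t_def[symmetric] gain_Cons del: tseq.simps)
  have A: "cz (z # zs) x y - cf c b x y \<le> gain (tseq c b (z # zs)) (z # zs) x"
    if m: "matchable c b (z # zs)" and y: "x \<le> y" for b y
  proof -
    define t where "t = next_free c b z"
    note g = g[OF t_def]
    note s = matchable_step[OF m t_def]
    note IH = Cons.IH(1)[OF _ s(7) assms(2)]
    have zs: "\<forall>w\<in>set zs. w < z" using m by (auto simp: matchable_def)
    consider "z \<le> x" | "t \<le> x" "x < z" | "x < t" by linarith
    then show ?thesis
    proof cases
      case 1
      have "cz zs x y = 0" using 1 zs by (force simp: cz_def filter_empty_conv)
      moreover have "0 \<le> gain (tseq c t zs) zs x" using IH[of x] cf_eq_0[of x x t c] by simp
      ultimately show ?thesis unfolding g using 1 s(2) cf_nonneg[of c b x y] by (simp add: cz_Cons)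
    next
      case 2
      have "cf c t x y = 0" by (rule cf_eq_0) (use 2 in simp)
      then show ?thesis unfolding g using 2 IH[OF y] cf_nonneg[of c b x y]
        by (simp add: cz_Cons of_bool_def)
    next
      case 3
      show ?thesis
      proof (cases "z \<le> y")
        case True
        have "cf c b x z = cf c t x z + 1" by (rule cf_split) (use s 3 in auto)
        moreover have "cf c b x z \<le> cf c b x y" using cf_mono[of b b z y] True by simp
        moreover have "cf c t x z = cf c t x y" using cf_cut[of t z y] s True by simp
        ultimately show ?thesis unfolding g using 3 s(2) IH[OF y] True by (simp add: cz_Cons)
      next
        case False
        then show ?thesis unfolding g using 3 s(2,3) IH[OF y] cf_mono[of t b y y c x] by (simp add: cz_Cons)
      qed
    qed
  qed
  {
    case (1 b y)
    then show ?case using A by blast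
  next
    case (2 b)
    define t where "t = next_free c b z"
    note g = g[OF t_def]
    note s = matchable_step[OF 2(1) t_def]
    note IH1 = Cons.IH(1)[OF _ s(7) assms(2)]
    obtain y' where y': "x \<le> y'" "y' = x \<or> y' \<in> set zs"
      "gain (tseq c t zs) zs x = cz zs x y' - cf c t x y'"
      using Cons.IH(2)[OF s(7) assms(2)] by blast
    have zs: "\<forall>w\<in>set zs. w < z" using 2(1) by (auto simp: matchable_def)
    consider "z \<le> x" | "t \<le> x" "x < z" | "x < t" by linarith
    then show ?case
    proof cases
      case 1
      then have "y' = x" using y' zs by force
      then show ?thesis unfolding g using 1 s(2) y' cf_eq_0[of x x b c] cf_eq_0[of x x t c]
        by (intro exI[of _ x]) simp
    next
      case 2
      have "cf c t x y' = 0" "cf c t x z = 0" using 2 by (auto intro!: cf_eq_0)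
      \<comment> \<open>As t \<le> x is the greatest free letter below z and b, none lies between x
        and z; every z_k in that interval is then matched across x, so y = z attains the
        maximum.\<close>
      moreover have "cf c b x z = 0" using s(6) 2 by (intro cf_eq_0) (meson less_le_trans not_le order_le_less_trans)
      moreover have "cz zs x y' \<le> cz zs x z" using y' zs 2 by (intro cz_mono) auto
      moreover have "cz zs x z - cf c t x z \<le> gain (tseq c t zs) zs x" using IH1[of z] 2 by simp
      ultimately show ?thesis unfolding g using y' 2 by (intro exI[of _ z]) (simp add: cz_Cons)
    next
      case 3
      show ?thesis
      proof (cases "y' < t")
        case True
        have "cf c b x y' = cf c t x y'"
          unfolding cf_def using True s by (intro arg_cong[where f = "\<lambda>A. int (card A)"]) auto
        then show ?thesis unfolding g using True 3 s(2) y' by (intro exI[of _ y']) (auto simp: cz_Cons)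
      next
        case False
        have "cf c b x z = cf c t x z + 1" by (rule cf_split) (use s 3 in auto)
        moreover have "cf c t x z = cf c t x y'" using cf_cut[of t z y'] s False by simp
        moreover have "cz zs x y' \<le> cz zs x z" using y' zs 3 s by (intro cz_mono) auto
        moreover have "cz (z # zs) x z - cf c b x z \<le> gain (tseq c b (z # zs)) (z # zs) x"
          using A[OF 2(1)] 3 s by simp
        ultimately show ?thesis unfolding g using 3 s(2) y'(3) by (intro exI[of _ z]) (simp add: cz_Cons)
      qed
    qed
  }
qed

lemma finite_Ipairs [simp]: "finite (Ipairs n c)"
  by (rule finite_subset[of _ "{1..int n}"]) (auto simp: Ipairs_def)

lemma set_Izs [simp]: "set (Izs n c) = Ipairs n c"
  by (simp add: Izs_def)

lemma Izs_sorted: "sorted_wrt (>) (Izs n c)"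
  by (simp add: Izs_def sorted_wrt_rev)

lemma distinct_Izs: "distinct (Izs n c)"
  by (simp add: Izs_def)

lemma cz_card: "distinct zs \<Longrightarrow> cz zs x y = int (card {z \<in> set zs. x < z \<and> z \<le> y})"
  by (simp add: cz_def distinct_length_filter Int_def conj_commute)

text \<open>Among k and bar k, the number of letters in the column exceeds 1 exactly for a pair and falls short
  of 1 exactly for a free k.\<close>
lemma cz_cf_diff:
  assumes "0 \<le> x" "x \<le> y" "y \<le> int n"
  shows "cz (Izs n c) x y - cf c (int n + 1) x y = (U c y + V c y - y) - (U c x + V c x - x)"
  using assms(2,3)
proof (induction y rule: int_ge_induct)
  case base
  show ?case by simp
next
  case (step y)
  have le: "w \<le> y + 1 \<longleftrightarrow> w \<le> y \<or> w = y + 1" for w :: int by linarith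
  have z: "cz (Izs n c) x (y + 1) = cz (Izs n c) x y + of_bool (y + 1 \<in> set c \<and> - (y + 1) \<in> set c)"
  proof -
    have "{z \<in> Ipairs n c. x < z \<and> z \<le> y + 1}
       = {z \<in> Ipairs n c. x < z \<and> z \<le> y} \<union> (if y + 1 \<in> set c \<and> - (y + 1) \<in> set c then {y + 1} else {})"
      using step assms(1) by (auto simp: Ipairs_def le)
    then show ?thesis by (auto simp: cz_card distinct_Izs)
  qed
  have f: "cf c (int n + 1) x (y + 1) = cf c (int n + 1) x y + of_bool (y + 1 \<notin> set c \<and> - (y + 1) \<notin> set c)"
  proof -
    let ?A = "\<lambda>y. {f. x < f \<and> f \<le> y \<and> f < int n + 1 \<and> f \<notin> set c \<and> - f \<notin> set c}"
    have "?A (y + 1) = ?A y \<union> (if y + 1 \<notin> set c \<and> - (y + 1) \<notin> set c then {y + 1} else {})"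
      using step by (auto simp: le)
    moreover have "y + 1 \<notin> ?A y" by simp
    ultimately show ?thesis
      using cf_finite[of x y "int n + 1" "\<lambda>f. f \<notin> set c \<and> - f \<notin> set c"]
      unfolding cf_def by (cases "y + 1 \<notin> set c \<and> - (y + 1) \<notin> set c") simp_all
  qed
  show ?case using step assms(1) N_step[of "y + 1" c] z f by (auto simp: of_bool_def split: if_splits)
qed

text \<open>Hall's condition is admissibility: at x = 0, \<open>cz_cf_diff\<close> reads cz - cf =
  N(y) - y. Beyond n both counts stay constant.\<close>

lemma matchable_Izs:
  assumes "bounded_counts n c"
  shows "matchable c (int n + 1) (Izs n c)"
proof -
  have "cz (Izs n c) 0 y \<le> cf c (int n + 1) 0 y" for y
  proof -
    consider "y \<le> 0" | "0 < y" "y \<le> int n" | "int n < y" by linarith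
    then show ?thesis
    proof cases
      case 1
      then have "cz (Izs n c) 0 y = 0" by (auto simp: cz_def filter_empty_conv)
      then show ?thesis using cf_nonneg by simp
    next
      case 2
      then have "U c y + V c y \<le> y" using assms by (simp add: bounded_counts_def)
      then show ?thesis using cz_cf_diff[of 0 y n c] 2 by simp
    next
      case 3
      have "cz (Izs n c) 0 y = cz (Izs n c) 0 (int n)"
        using 3 unfolding cz_card[OF distinct_Izs] by (intro arg_cong[where f = "\<lambda>A. int (card A)"]) (auto simp: Ipairs_def)
      moreover have "cf c (int n + 1) 0 y = cf c (int n + 1) 0 (int n)"
        using 3 unfolding cf_def by (intro arg_cong[where f = "\<lambda>A. int (card A)"]) auto
      moreover have "U c (int n) + V c (int n) \<le> int n"
        using assms by (cases "n = 0") (auto simp: bounded_counts_def)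
      ultimately show ?thesis using cz_cf_diff[of 0 "int n" n c] by simp
    qed
  qed
  then show ?thesis using Izs_sorted by (auto simp: matchable_def Ipairs_def)
qed

definition ts :: "nat \<Rightarrow> int list \<Rightarrow> int list" where
  "ts n c = tseq c (int n + 1) (Izs n c)"

lemma gain_le_iff:
  assumes "bounded_counts n c" "0 \<le> x" "x \<le> int n"
  shows "gain (ts n c) (Izs n c) x \<le> S
    \<longleftrightarrow> (\<forall>y. x \<le> y \<and> y \<le> int n \<longrightarrow> (U c y + V c y - y) - (U c x + V c x - x) \<le> S)"
proof
  assume "gain (ts n c) (Izs n c) x \<le> S"
  then show "\<forall>y. x \<le> y \<and> y \<le> int n \<longrightarrow> (U c y + V c y - y) - (U c x + V c x - x) \<le> S"
    using gain_tseq(1)[OF matchable_Izs[OF assms(1)] assms(2)] cz_cf_diff[OF assms(2)]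
    unfolding ts_def by (metis order_trans)
next
  assume R: "\<forall>y. x \<le> y \<and> y \<le> int n \<longrightarrow> (U c y + V c y - y) - (U c x + V c x - x) \<le> S"
  obtain y where "x \<le> y" "y = x \<or> y \<in> set (Izs n c)"
      "gain (ts n c) (Izs n c) x = cz (Izs n c) x y - cf c (int n + 1) x y"
    using gain_tseq(2)[OF matchable_Izs[OF assms(1)] assms(2)] unfolding ts_def by blast
  moreover from this have "y \<le> int n" using assms(3) by (auto simp: Ipairs_def)
  ultimately show "gain (ts n c) (Izs n c) x \<le> S" using R cz_cf_diff[OF assms(2)] by simp
qed

section \<open>Comparing split columns by counting letters\<close>

lemma count_le_nth:
  fixes v :: int
  assumes "sorted xs" "k < length xs"
  shows "xs ! k \<le> v \<longleftrightarrow> k < length (filter (\<lambda>x. x \<le> v) xs)"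
  using assms
proof (induction xs arbitrary: k)
  case (Cons x xs)
  show ?case
  proof (cases "x \<le> v")
    case True
    then show ?thesis using Cons by (cases k) auto
  next
    case False
    then have "filter (\<lambda>x. x \<le> v) (x # xs) = []" using Cons.prems by (auto simp: filter_empty_conv)
    moreover have "\<not> (x # xs) ! k \<le> v"
      using False Cons.prems by (cases k) (auto dest!: bspec[OF _ nth_mem])
    ultimately show ?thesis by simp
  qed
qed simp

text \<open>Entry k of a sorted list is at most v exactly when more than k entries are at most v, so
  entrywise comparison is comparison of counting functions. The lengths are compared by taking for v
  the maximum of ys.\<close>

lemma pointwise_le_iff_counts:
  assumes "sorted xs" "sorted ys"
  shows "length ys \<le> length xs \<and> (\<forall>k < length ys. xs ! k \<le> ys ! k)
    \<longleftrightarrow> (\<forall>v :: int. length (filter (\<lambda>x. x \<le> v) ys) \<le> length (filter (\<lambda>x. x \<le> v) xs))"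
proof
  assume L: "length ys \<le> length xs \<and> (\<forall>k < length ys. xs ! k \<le> ys ! k)"
  show "\<forall>v. length (filter (\<lambda>x. x \<le> v) ys) \<le> length (filter (\<lambda>x. x \<le> v) xs)"
  proof
    fix v
    define m where "m = length (filter (\<lambda>x. x \<le> v) ys)"
    have ml: "m \<le> length ys" by (simp add: m_def)
    show "length (filter (\<lambda>x. x \<le> v) ys) \<le> length (filter (\<lambda>x. x \<le> v) xs)"
    proof (cases m)
      case 0
      then show ?thesis by (simp add: m_def)
    next
      case (Suc k)
      then have "ys ! k \<le> v" using count_le_nth[OF assms(2), of k v] ml m_def by simp
      then have "xs ! k \<le> v" using L Suc ml by (meson Suc_le_lessD order_trans)
      then have "k < length (filter (\<lambda>x. x \<le> v) xs)" using count_le_nth[OF assms(1), of k v] L Suc ml by simp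
      then show ?thesis using Suc m_def by simp
    qed
  qed
next
  assume R: "\<forall>v. length (filter (\<lambda>x. x \<le> v) ys) \<le> length (filter (\<lambda>x. x \<le> v) xs)"
  have len: "length ys \<le> length xs"
  proof (cases "ys = []")
    case False
    have "filter (\<lambda>x. x \<le> Max (set ys)) ys = ys" by (simp add: filter_id_conv)
    then have "length ys \<le> length (filter (\<lambda>x. x \<le> Max (set ys)) xs)" using R by metis
    then show ?thesis using length_filter_le le_trans by blast
  qed simp
  moreover have "xs ! k \<le> ys ! k" if "k < length ys" for k
  proof -
    have "k < length (filter (\<lambda>x. x \<le> ys ! k) ys)" using count_le_nth[OF assms(2) that, of "ys ! k"] by simp
    then show ?thesis using R[rule_format, of "ys ! k"] count_le_nth[OF assms(1), of k "ys ! k"] that len by simp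
  qed
  ultimately show "length ys \<le> length xs \<and> (\<forall>k < length ys. xs ! k \<le> ys ! k)" by blast
qed

text \<open>It suffices to know this at v = x and v = 2n - x for 0 \<le> x \<le> n: the former
  counts the unbarred letters up to x, the latter all letters except bar x, ..., bar 1.\<close>

definition kcount :: "nat \<Rightarrow> int \<Rightarrow> int list \<Rightarrow> int" where
  "kcount n v w = int (length (filter (\<lambda>x. lkey n x \<le> v) w))"

lemma kcount_low:
  assumes "\<forall>x\<in>set w. is_letter n x" "x \<le> int n"
  shows "kcount n x w = int (length (filter (\<lambda>a. 0 < a \<and> a \<le> x) w))"
proof -
  have "lkey n a \<le> x \<longleftrightarrow> 0 < a \<and> a \<le> x" if "a \<in> set w" for a
    using assms that by (auto simp: lkey_def is_letter_def)
  then have "filter (\<lambda>a. lkey n a \<le> x) w = filter (\<lambda>a. 0 < a \<and> a \<le> x) w"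
    by (intro filter_cong) auto
  then show ?thesis by (simp add: kcount_def)
qed

lemma kcount_high:
  assumes "\<forall>x\<in>set w. is_letter n x" "x \<le> int n"
  shows "kcount n (2 * int n - x) w = int (length w) - int (length (filter (\<lambda>a. - x \<le> a \<and> a < 0) w))"
proof -
  have "lkey n a \<le> 2 * int n - x \<longleftrightarrow> \<not> (- x \<le> a \<and> a < 0)" if "a \<in> set w" for a
    using assms that by (auto simp: lkey_def is_letter_def)
  then have "filter (\<lambda>a. lkey n a \<le> 2 * int n - x) w = filter (\<lambda>a. \<not> (- x \<le> a \<and> a < 0)) w"
    by (intro filter_cong) auto
  moreover have "length (filter P w) + length (filter (\<lambda>a. \<not> P a) w) = length w" for P
    by (rule sum_length_filter_compl)
  ultimately show ?thesis unfolding kcount_def by (metis add_diff_cancel_left' of_nat_add)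
qed

lemma kcount_outside:
  assumes "\<forall>x\<in>set w. is_letter n x"
  shows "v < 0 \<Longrightarrow> kcount n v w = 0" "2 * int n < v \<Longrightarrow> kcount n v w = kcount n (2 * int n) w"
proof -
  show "kcount n v w = 0" if "v < 0"
    using assms lkey_bounds[of n] that by (force simp: kcount_def filter_empty_conv)
  show "kcount n v w = kcount n (2 * int n) w" if "2 * int n < v"
  proof -
    have "filter (\<lambda>a. lkey n a \<le> v) w = filter (\<lambda>a. lkey n a \<le> 2 * int n) w"
    proof (intro filter_cong refl)
      fix a assume "a \<in> set w"
      then have "lkey n a \<le> 2 * int n" using assms lkey_bounds by blast
      then show "lkey n a \<le> v \<longleftrightarrow> lkey n a \<le> 2 * int n" using that by simp
    qed
    then show ?thesis by (simp add: kcount_def)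
  qed
qed

lemma card_le_diff: "finite A \<Longrightarrow> B \<subseteq> A \<Longrightarrow> int (card (A - B)) = int (card A) - int (card B)"
  by (simp add: card_Diff_subset finite_subset card_mono of_nat_diff)

context
  fixes n :: nat and c :: "int list"
  assumes col: "is_column n c" and bc: "bounded_counts n c"
begin

lemma ts_range: "t \<in> set (ts n c) \<Longrightarrow> 1 \<le> t \<and> t \<le> int n"
  using tseq_props(2)[OF matchable_Izs[OF bc]] by (auto simp: ts_def)

lemma length_ts: "length (ts n c) = card (Ipairs n c)"
  using tseq_props(1)[OF matchable_Izs[OF bc]] distinct_card[OF distinct_Izs[of n c]] by (simp add: ts_def)

lemma length_filter_column: "length (filter P c) = card {x \<in> set c. P x}"
  using is_column_distinct[OF col] by (simp add: distinct_length_filter Int_def conj_commute)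

lemma gain_eq: "gain (ts n c) (Izs n c) x
    = int (length (filter (\<lambda>t. t \<le> x) (ts n c))) - int (card {z \<in> Ipairs n c. z \<le> x})"
  using distinct_Izs[of n c] by (simp add: gain_def distinct_length_filter Int_def conj_commute)

lemma uminus_Ipairs: "- a \<in> Ipairs n c \<Longrightarrow> a \<in> set c \<and> a < 0" "a \<in> Ipairs n c \<Longrightarrow> a \<in> set c \<and> 0 < a"
  by (auto simp: Ipairs_def)

lemma lcol_letters: "\<forall>x\<in>set (lcol n c). is_letter n x"
  using ts_range is_column_letter[OF col] by (force simp: lcol_def ts_def[symmetric] is_letter_def)

lemma rcol_letters: "\<forall>x\<in>set (rcol n c). is_letter n x"
  using ts_range is_column_letter[OF col] by (force simp: rcol_def ts_def[symmetric] is_letter_def)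

lemma length_lcol: "length (lcol n c) = length c"
proof -
  have "card {x \<in> set c. x \<notin> Ipairs n c} = card (set c) - card (Ipairs n c)"
    by (subst card_Diff_subset[symmetric]) (auto simp: set_diff_eq uminus_Ipairs)
  moreover have "card (Ipairs n c) \<le> card (set c)"
    by (rule card_mono) (auto simp: uminus_Ipairs)
  ultimately show ?thesis
    using distinct_card[OF is_column_distinct[OF col]]
    by (simp add: lcol_def ts_def[symmetric] length_ts length_filter_column)
qed

lemma length_rcol: "length (rcol n c) = length c"
proof -
  have "card {x \<in> set c. - x \<notin> Ipairs n c} = card (set c - uminus ` Ipairs n c)"
    by (rule arg_cong[where f = card]) (auto simp: uminus_image_iff)
  also have "\<dots> = card (set c) - card (uminus ` Ipairs n c)"
    by (rule card_Diff_subset) (auto simp: Ipairs_def)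
  also have "card (uminus ` Ipairs n c) = card (Ipairs n c)" by (simp add: card_image)
  finally have "card {x \<in> set c. - x \<notin> Ipairs n c} = card (set c) - card (Ipairs n c)" .
  moreover have "card (Ipairs n c) \<le> card (set c)"
    by (rule card_mono) (auto simp: uminus_Ipairs)
  ultimately show ?thesis
    using distinct_card[OF is_column_distinct[OF col]]
    by (simp add: rcol_def ts_def[symmetric] length_ts length_filter_column)
qed

text \<open>The left split column replaces each z of a pair by its t: the unbarred letters up to x
  gain the t \<le> x and lose the z \<le> x, and the barred part is untouched. In the right split
  column the same happens to the barred part.\<close>

lemma lcol_low:
  assumes "0 \<le> x" "x \<le> int n"
  shows "kcount n x (lcol n c) = U c x + gain (ts n c) (Izs n c) x"
proof -
  have "filter (\<lambda>a. 0 < a \<and> a \<le> x) (ts n c) = filter (\<lambda>a. a \<le> x) (ts n c)"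
    using ts_range by (intro filter_cong) force+
  moreover have "{a \<in> set c. a \<notin> Ipairs n c \<and> 0 < a \<and> a \<le> x}
      = {a \<in> set c. 0 < a \<and> a \<le> x} - {z \<in> Ipairs n c. z \<le> x}" by auto
  moreover have "int (card ({a \<in> set c. 0 < a \<and> a \<le> x} - {z \<in> Ipairs n c. z \<le> x}))
     = int (card {a \<in> set c. 0 < a \<and> a \<le> x}) - int (card {z \<in> Ipairs n c. z \<le> x})"
    by (rule card_le_diff) (auto simp: uminus_Ipairs)
  ultimately show ?thesis
    unfolding kcount_low[OF lcol_letters assms(2)] gain_eq U_def
    by (simp add: lcol_def ts_def[symmetric] filter_sort length_filter_column conj_commute)
qed

lemma lcol_high:
  assumes "0 \<le> x" "x \<le> int n"
  shows "kcount n (2 * int n - x) (lcol n c) = int (length c) - V c x"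
proof -
  have "filter (\<lambda>a. - x \<le> a \<and> a < 0) (ts n c) = []"
    using ts_range by (force simp: filter_empty_conv)
  moreover have "{a \<in> set c. a \<notin> Ipairs n c \<and> - x \<le> a \<and> a < 0} = {a \<in> set c. - x \<le> a \<and> a < 0}"
    using uminus_Ipairs(2) by force
  ultimately show ?thesis
    unfolding kcount_high[OF lcol_letters assms(2)] length_lcol V_def
    by (simp add: lcol_def ts_def[symmetric] filter_sort length_filter_column conj_commute)
qed

lemma rcol_low:
  assumes "0 \<le> x" "x \<le> int n"
  shows "kcount n x (rcol n c) = U c x"
proof -
  have "filter (\<lambda>a. 0 < a \<and> a \<le> x) (map uminus (ts n c)) = []"
    using ts_range by (force simp: filter_empty_conv)
  moreover have "{a \<in> set c. - a \<notin> Ipairs n c \<and> 0 < a \<and> a \<le> x} = {a \<in> set c. 0 < a \<and> a \<le> x}"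
    using uminus_Ipairs(1) by force
  ultimately show ?thesis
    unfolding kcount_low[OF rcol_letters assms(2)] U_def
    by (simp add: rcol_def ts_def[symmetric] filter_sort length_filter_column conj_commute)
qed

lemma rcol_high:
  assumes "0 \<le> x" "x \<le> int n"
  shows "kcount n (2 * int n - x) (rcol n c) = int (length c) - V c x - gain (ts n c) (Izs n c) x"
proof -
  have "length (filter (\<lambda>a. - x \<le> a \<and> a < 0) (map uminus (ts n c))) = length (filter (\<lambda>a. a \<le> x) (ts n c))"
    using ts_range by (auto simp: filter_map o_def intro!: arg_cong[where f = length] filter_cong dest!: ts_range)
  moreover have "{a \<in> set c. - a \<notin> Ipairs n c \<and> - x \<le> a \<and> a < 0}
      = {a \<in> set c. - x \<le> a \<and> a < 0} - uminus ` {z \<in> Ipairs n c. z \<le> x}"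
    by (auto simp: uminus_image_iff)
  moreover have "int (card ({a \<in> set c. - x \<le> a \<and> a < 0} - uminus ` {z \<in> Ipairs n c. z \<le> x}))
     = int (card {a \<in> set c. - x \<le> a \<and> a < 0}) - int (card (uminus ` {z \<in> Ipairs n c. z \<le> x}))"
    by (rule card_le_diff) (auto simp: Ipairs_def)
  moreover have "card (uminus ` {z \<in> Ipairs n c. z \<le> x}) = card {z \<in> Ipairs n c. z \<le> x}"
    by (rule card_image) simp
  ultimately show ?thesis
    unfolding kcount_high[OF rcol_letters assms(2)] length_rcol gain_eq V_def
    by (simp add: rcol_def ts_def[symmetric] filter_sort length_filter_column conj_commute)
qed

end

text \<open>Thresholds x \<le> n bound the gain of d, and the maximum formula for that gain yields
  the first inequality of \<open>fits_at\<close>. Thresholds 2n - x bound the gain of c and yield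
  the second.\<close>

lemma col_prec_iff_fits:
  assumes "is_column n c" "bounded_counts n c" "is_column n d" "bounded_counts n d"
  shows "col_prec n c d \<longleftrightarrow> fits n c d"
proof -
  note C = assms(1,2) and D = assms(3,4)
  have s: "sorted (map (lkey n) (rcol n c))" "sorted (map (lkey n) (lcol n d))"
    by (simp_all add: rcol_def lcol_def)
  have k: "int (length (filter (\<lambda>x. x \<le> v) (map (lkey n) w))) = kcount n v w" for v w
    by (simp add: kcount_def filter_map o_def)
  have "col_prec n c d \<longleftrightarrow> length (map (lkey n) (lcol n d)) \<le> length (map (lkey n) (rcol n c)) \<and>
      (\<forall>k < length (map (lkey n) (lcol n d)). map (lkey n) (rcol n c) ! k \<le> map (lkey n) (lcol n d) ! k)"
    by (auto simp: col_prec_def length_rcol[OF C] length_lcol[OF D] lle_def)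
  also have "\<dots> \<longleftrightarrow> (\<forall>v. kcount n v (lcol n d) \<le> kcount n v (rcol n c))"
    unfolding pointwise_le_iff_counts[OF s] k[symmetric] by simp
  also have "\<dots> \<longleftrightarrow> (\<forall>x. 0 \<le> x \<and> x \<le> int n \<longrightarrow> kcount n x (lcol n d) \<le> kcount n x (rcol n c)
      \<and> kcount n (2 * int n - x) (lcol n d) \<le> kcount n (2 * int n - x) (rcol n c))" (is "?L \<longleftrightarrow> ?R")
  proof
    assume R: ?R
    show ?L
    proof
      fix v
      consider "v < 0" | "0 \<le> v" "v \<le> int n" | "int n < v" "v \<le> 2 * int n" | "2 * int n < v" by linarith
      then show "kcount n v (lcol n d) \<le> kcount n v (rcol n c)"
      proof cases
        case 1
        then show ?thesis using kcount_outside(1) lcol_letters[OF D] rcol_letters[OF C] by simp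
      next
        case 2
        then show ?thesis using R by blast
      next
        case 3
        then show ?thesis using R[rule_format, of "2 * int n - v"] by simp
      next
        case 4
        then show ?thesis using R[rule_format, of 0] kcount_outside(2)[OF lcol_letters[OF D]]
          kcount_outside(2)[OF rcol_letters[OF C]] by simp
      qed
    qed
  qed blast
  also have "\<dots> \<longleftrightarrow> (\<forall>x. 0 \<le> x \<and> x \<le> int n \<longrightarrow> gain (ts n d) (Izs n d) x \<le> U c x - U d x
      \<and> gain (ts n c) (Izs n c) x \<le> int (length c) - V c x - int (length d) + V d x)"
    using lcol_low[OF D] lcol_high[OF D] rcol_low[OF C] rcol_high[OF C] by (smt (verit))
  also have "\<dots> \<longleftrightarrow> (\<forall>x. 0 \<le> x \<and> x \<le> int n \<longrightarrow> (\<forall>y. x \<le> y \<and> y \<le> int n \<longrightarrow> fits_at c d x y))"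
  proof (intro all_cong1 imp_cong refl)
    fix x :: int assume x: "0 \<le> x \<and> x \<le> int n"
    show "gain (ts n d) (Izs n d) x \<le> U c x - U d x
       \<and> gain (ts n c) (Izs n c) x \<le> int (length c) - V c x - int (length d) + V d x
      \<longleftrightarrow> (\<forall>y. x \<le> y \<and> y \<le> int n \<longrightarrow> fits_at c d x y)"
      unfolding gain_le_iff[OF D(2) x[THEN conjunct1] x[THEN conjunct2]]
        gain_le_iff[OF C(2) x[THEN conjunct1] x[THEN conjunct2]] fits_at_def
      by (auto simp: algebra_simps)
  qed
  also have "\<dots> \<longleftrightarrow> fits n c d"
    by (auto simp: fits_def)
  finally show ?thesis .
qed

lemma col_prec_fw:
  assumes "admissible_column n c" "admissible_column n d"
    "fw n i (d @ c) = Some (d' @ c')" "length d = length d'"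
  shows "col_prec n c d \<longleftrightarrow> col_prec n c' d'"
proof -
  have "admissible_column n c' \<and> admissible_column n d'"
    using fw_append_Some[OF assms(3,4)] fw_admissible assms(1,2) by blast
  then show ?thesis
    using fits_fw[OF _ _ assms(3,4)] assms(1,2) by (simp add: admissible_iff col_prec_iff_fits)
qed

section \<open>Existence and uniqueness of tableaux\<close>

lemma is_tableau_Nil [simp]: "is_tableau n []"
  by (simp add: is_tableau_def)

lemma is_tableau_Cons:
  "is_tableau n (d # ds) \<longleftrightarrow> admissible_column n d \<and> is_tableau n ds \<and> (ds \<noteq> [] \<longrightarrow> col_prec n (hd ds) d)"
proof -
  have split: "(\<forall>k. Q k) \<longleftrightarrow> Q 0 \<and> (\<forall>k. Q (Suc k))" for Q :: "nat \<Rightarrow> bool"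
    by (metis not0_implies_Suc)
  show ?thesis
    unfolding is_tableau_def
    by (subst split) (cases ds; auto)
qed

lemma is_tableau_snoc:
  "is_tableau n (ds @ [d]) \<longleftrightarrow> is_tableau n ds \<and> admissible_column n d \<and> (ds \<noteq> [] \<longrightarrow> col_prec n d (last ds))"
  by (induction ds) (auto simp: is_tableau_Cons hd_append)

lemma split_like:
  "length w = length (concat cs) \<Longrightarrow> \<exists>cs'. map length cs' = map length cs \<and> concat cs' = w"
proof (induction cs arbitrary: w)
  case (Cons c cs)
  have "length (drop (length c) w) = length (concat cs)" using Cons.prems by simp
  then obtain cs' where "map length cs' = map length cs" "concat cs' = drop (length c) w"
    using Cons.IH by blast
  then show ?case using Cons.prems by (intro exI[of _ "take (length c) w # cs'"]) auto
qed simp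

lemma concat_inj_lengths:
  "map length cs = map length cs' \<Longrightarrow> concat cs = concat cs' \<Longrightarrow> cs = cs'"
proof (induction cs arbitrary: cs')
  case (Cons c cs)
  then show ?case by (cases cs') auto
qed simp

text \<open>The order is a condition on adjacent columns, and on each adjacent pair the operator
  either acts, in which case \<open>col_prec_fw\<close> applies, or changes nothing. The tensor
  product rule for the whole word restricts to the pair: an operator that hits d or e within the
  word hits the same column of \<open>d @ e\<close>.\<close>

lemma tableau_fw_iff:
  assumes "fw n i (concat ds) = Some (concat ds')" "map length ds = map length ds'"
  shows "is_tableau n ds \<longleftrightarrow> is_tableau n ds'"
  using assms
proof (induction ds arbitrary: ds')
  case Nil
  then show ?case by (simp add: fw_Nil)
next
  case (Cons d ds)
  obtain d' ds2 where ds': "ds' = d' # ds2" "length d = length d'" "map length ds = map length ds2"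
    using Cons.prems(2) by (cases ds') auto
  have pair: "admissible_column n e \<and> admissible_column n d \<and> col_prec n e d
      \<longleftrightarrow> admissible_column n e' \<and> admissible_column n d' \<and> col_prec n e' d'"
    if f: "fw n i (d @ e) = Some (d' @ e')" for e e'
    using col_prec_fw[OF _ _ f ds'(2)] fw_admissible fw_append_Some[OF f ds'(2)] by blast
  have f: "fw n i (d @ concat ds) = Some (d' @ concat ds2)"
    using Cons.prems(1) ds' by simp
  from fw_append_Some[OF this ds'(2)] consider
    (1) "fw n i d = Some d'" "concat ds2 = concat ds" "eps n i (concat ds) < phi n i d"
  | (2) "d' = d" "fw n i (concat ds) = Some (concat ds2)" "phi n i d \<le> eps n i (concat ds)"
    by blast
  then show ?case
  proof cases
    case 1
    have eq: "ds2 = ds" using concat_inj_lengths ds'(3) 1(2) by metis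
    show ?thesis
    proof (cases ds)
      case Nil
      then show ?thesis using fw_admissible[OF 1(1)] ds'(1) eq by (simp add: is_tableau_Cons)
    next
      case (Cons e es)
      have "fw n i (d @ e) = Some (d' @ e)"
        using 1 Cons by (simp add: fw_append eps_append)
      from pair[OF this] show ?thesis
        using ds'(1) eq Cons by (auto simp: is_tableau_Cons)
    qed
  next
    case 2
    note IH = Cons.IH[OF 2(2) ds'(3)]
    show ?thesis
    proof (cases ds)
      case Nil
      then show ?thesis using 2(2) by (simp add: fw_Nil)
    next
      case (Cons e es)
      then obtain e' es' where es': "ds2 = e' # es'" "length e = length e'" "map length es = map length es'"
        using ds'(3) by (cases ds2) auto
      have f2: "fw n i (e @ concat es) = Some (e' @ concat es')" using 2(2) Cons es' by simp
      have "e' = e \<or> fw n i (d @ e) = Some (d' @ e')"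
        using fw_append_Some[OF f2 es'(2)] 2(1,3) Cons
        by (auto simp: fw_append eps_append)
      then show ?thesis
      proof
        assume "e' = e"
        then show ?thesis using IH Cons es' ds'(1) 2(1) by (auto simp: is_tableau_Cons)
      next
        assume "fw n i (d @ e) = Some (d' @ e')"
        from pair[OF this] show ?thesis
          using IH Cons es' ds'(1) by (auto simp: is_tableau_Cons)
      qed
    qed
  qed
qed

lemma fw_is_column_iff: "fw n i c = Some c' \<Longrightarrow> is_column n c \<longleftrightarrow> is_column n c'"
  using fw_is_column[of n c i c'] fw_is_column[OF _ fw_dual[of n i c c']] is_column_dual by (metis dual_dual)

text \<open>This version admits empty columns, which are not admissible but arise as the image of
  epsilon.\<close>

lemma columns_fw_iff:
  assumes "fw n i (concat ds) = Some (concat ds')" "map length ds = map length ds'"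
  shows "(\<forall>d\<in>set ds. is_column n d) \<longleftrightarrow> (\<forall>d\<in>set ds'. is_column n d)"
  using assms
proof (induction ds arbitrary: ds')
  case Nil
  then show ?case by (simp add: fw_Nil)
next
  case (Cons d ds)
  obtain d' ds2 where ds': "ds' = d' # ds2" "length d = length d'" "map length ds = map length ds2"
    using Cons.prems(2) by (cases ds') auto
  have f: "fw n i (d @ concat ds) = Some (d' @ concat ds2)"
    using Cons.prems(1) ds' by simp
  from fw_append_Some[OF this ds'(2)] show ?case
  proof (elim disjE conjE)
    assume "fw n i d = Some d'" "concat ds2 = concat ds"
    then show ?thesis using fw_is_column_iff[of n i d d'] concat_inj_lengths[OF ds'(3)] ds'(1) by simp
  next
    assume "d' = d" "fw n i (concat ds) = Some (concat ds2)"
    then show ?thesis using Cons.IH[OF _ ds'(3)] ds'(1) by simp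
  qed
qed

section \<open>The columns 1 2 ... a and words of highest weight\<close>

definition ivl :: "nat \<Rightarrow> int list" where
  "ivl a = map int [1..<Suc a]"

lemma ivl_0 [simp]: "ivl 0 = []"
  by (simp add: ivl_def)

lemma ivl_Suc: "ivl (Suc a) = ivl a @ [int a + 1]"
  by (simp add: ivl_def)

lemma ivl_1: "ivl (Suc 0) = [1]"
  by (simp add: ivl_Suc)

lemma set_ivl: "set (ivl a) = {1..int a}"
  by (induction a) (auto simp: ivl_Suc)

lemma length_ivl [simp]: "length (ivl a) = a"
  by (simp add: ivl_def)

lemma is_column_ivl: "a \<le> n \<Longrightarrow> is_column n (ivl a)"
  by (induction a) (auto simp: ivl_Suc is_column_append is_column_Cons set_ivl is_letter_def lless_def lkey_def)

lemma U_ivl: "0 \<le> x \<Longrightarrow> U (ivl a) x = min x (int a)"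
proof -
  assume "0 \<le> x"
  moreover have "{k \<in> set (ivl a). 0 < k \<and> k \<le> x} = {1..min x (int a)}" by (auto simp: set_ivl)
  ultimately show ?thesis by (simp add: U_def)
qed

lemma V_ivl [simp]: "V (ivl a) x = 0"
proof -
  have "{k \<in> set (ivl a). - x \<le> k \<and> k < 0} = {}" by (auto simp: set_ivl)
  then show ?thesis unfolding V_def by simp
qed

lemma admissible_ivl: "1 \<le> a \<Longrightarrow> a \<le> n \<Longrightarrow> admissible_column n (ivl a)"
  using length_ivl[of a]
  by (auto simp: admissible_iff is_column_ivl bounded_counts_def U_ivl simp del: length_ivl)

lemma phi_ivl:
  assumes "a \<le> n" "1 \<le> i" "i \<le> n"
  shows "phi n i (ivl a) = of_bool (i = a)"
proof (cases "i < n")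
  case True
  show ?thesis using assms unfolding phi_column[OF is_column_ivl[OF assms(1)] assms(2) True] set_ivl by auto
next
  case False
  then have "i = n" "1 \<le> n" using assms by auto
  then show ?thesis using assms phi_column_n[OF is_column_ivl[OF assms(1)]] by (auto simp: set_ivl)
qed

lemma eps_ivl:
  assumes "a \<le> n"
  shows "eps n i (ivl a) = 0"
proof (cases "1 \<le> i \<and> i \<le> n")
  case i: True
  show ?thesis
  proof (cases "i < n")
    case True
    show ?thesis using i unfolding eps_column[OF is_column_ivl[OF assms(1)] i[THEN conjunct1] True] set_ivl by auto
  next
    case False
    then have "i = n" "1 \<le> n" using i by auto
    then show ?thesis using assms eps_column_n[OF is_column_ivl[OF assms(1)]] by (auto simp: set_ivl)
  qed
qed (rule eps_outside)

abbreviation ivls :: "nat list \<Rightarrow> int list" where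
  "ivls as \<equiv> concat (map ivl as)"

lemma eps_ivls: "\<forall>a\<in>set as. a \<le> n \<Longrightarrow> eps n i (ivls as) = 0"
  by (induction as) (auto simp: eps_append eps_ivl)

lemma phi_ivls_pos:
  assumes "\<forall>a\<in>set as. a \<le> n" "1 \<le> i" "i \<le> n" "phi n i (ivls as) > 0"
  shows "i \<in> set as"
  using assms
proof (induction as)
  case (Cons a as)
  then show ?case using phi_ivl[of a n i] eps_ivls[of as n i]
    by (cases "phi n i (ivls as) > 0") (auto simp: phi_append of_bool_def split: if_splits)
qed simp

text \<open>While the next letter of the column is at most x, R1b lets x pass the letter before it.
  Once the letter x of the column is reached, the two copies of x are indistinguishable and the
  extra one stands behind 1 2 ... x. The larger letters are then passed by R1a.\<close>

lemma ivl_commute_letter: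
  assumes "1 \<le> x" "x \<le> b" "b \<le> n"
  shows "plactic n ([int x] @ ivl b) (ivl b @ [int x])"
proof -
  have L: "is_letter n (int k)" if "1 \<le> k" "k \<le> n" for k using that by (simp add: is_letter_def)
  have step1: "plactic n ([int x] @ ivl (Suc k)) (ivl k @ [int x, int k + 1])" if "Suc k \<le> x" for k
    using that
  proof (induction k)
    case 0
    then show ?case by (simp add: ivl_Suc)
  next
    case (Suc k)
    have "plactic n ([int x] @ ivl (Suc (Suc k))) ((ivl k @ [int x, int k + 1]) @ [2 + int k])"
      using plactic_append2[OF Suc.IH, of "[2 + int k]"] Suc.prems by (simp add: ivl_Suc[of "Suc k"])
    also have "plactic n \<dots> (ivl k @ [int k + 1, int x, 2 + int k])"
    proof -
      have "plac_rel n [int k + 1, int x, 2 + int k] [int x, int k + 1, 2 + int k]"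
        using Suc.prems assms L[of "k + 1"] L[of "k + 2"] L[of x]
        by (intro plac_rel.R1b) (auto simp: lle_def lless_def lkey_def add.commute)
      then have "plac_step n (ivl k @ [int k + 1, int x, 2 + int k]) (ivl k @ [int x, int k + 1, 2 + int k])"
        unfolding plac_step_def by (metis append_Nil2)
      then show ?thesis using plac_step_plactic plactic_sym by simp
    qed
    finally show ?case by (simp add: ivl_Suc)
  qed
  have base: "plactic n ([int x] @ ivl x) (ivl x @ [int x])"
    using step1[of "x - 1"] assms(1) by (cases x) (auto simp: ivl_Suc add.commute)
  show ?thesis using assms(2,3)
  proof (induction b rule: dec_induct)
    case base
    show ?case by fact
  next
    case (step m)
    have "plactic n ([int x] @ ivl (Suc m)) ((ivl m @ [int x]) @ [int m + 1])"
      using plactic_append2[OF step.IH, of "[int m + 1]"] step.prems by (simp add: ivl_Suc)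
    also have "plactic n \<dots> (ivl (Suc m) @ [int x])"
    proof -
      obtain m' where m: "m = Suc m'" using step.hyps assms(1) by (cases m) auto
      have "plac_rel n [int m, int m + 1, int x] [int m, int x, int m + 1]"
        using step assms L[of m] L[of "m + 1"] L[of x]
        by (intro plac_rel.R1a) (auto simp: lle_def lless_def lkey_def add.commute)
      then have "plac_step n (ivl m' @ [int m, int m + 1, int x]) (ivl m' @ [int m, int x, int m + 1])"
        unfolding plac_step_def by (metis append_Nil2)
      then show ?thesis using plac_step_plactic plactic_sym m by (simp add: ivl_Suc add.commute)
    qed
    finally show ?case .
  qed
qed

lemma ivl_commute:
  assumes "a \<le> n" "b \<le> n"
  shows "plactic n (ivl a @ ivl b) (ivl b @ ivl a)"
proof -
  have le: "plactic n (ivl a @ ivl b) (ivl b @ ivl a)" if "a \<le> b" "b \<le> n" for a b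
    using that
  proof (induction a)
    case (Suc a)
    have "plactic n (ivl (Suc a) @ ivl b) (ivl a @ ivl b @ [int a + 1])"
      using plactic_append1[OF ivl_commute_letter[of "Suc a" b n], of "ivl a"] Suc.prems
      by (simp add: ivl_Suc add.commute)
    also have "plactic n \<dots> (ivl b @ ivl (Suc a))"
      using plactic_append2[OF Suc.IH, of "[int a + 1]"] Suc.prems by (simp add: ivl_Suc)
    finally show ?case .
  qed simp
  show ?thesis
    using le[of a b] le[of b a] assms plactic_sym by (cases "a \<le> b") auto
qed

lemma ivl_ivls_commute:
  assumes "a \<le> n" "\<forall>b\<in>set bs. b \<le> n"
  shows "plactic n (ivl a @ ivls bs) (ivls bs @ ivl a)"
  using assms
proof (induction bs)
  case (Cons b bs)
  have "plactic n (ivl a @ ivls (b # bs)) (ivl b @ ivl a @ ivls bs)"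
    using plactic_append2[OF ivl_commute[of a n b], of "ivls bs"] Cons.prems by simp
  also have "plactic n \<dots> (ivls (b # bs) @ ivl a)"
    using plactic_append1[OF Cons.IH, of "ivl b"] Cons.prems by simp
  finally show ?case .
qed simp

lemma ivls_sort:
  assumes "\<forall>a\<in>set as. a \<le> n"
  shows "plactic n (ivls as) (ivls (sort as))"
proof -
  have ins: "plactic n (ivls (a # as)) (ivls (insort a as))" if "a \<le> n" "\<forall>a\<in>set as. a \<le> n" for a as
    using that
  proof (induction as)
    case (Cons b as)
    show ?case
    proof (cases "a \<le> b")
      case False
      have "plactic n (ivls (a # b # as)) (ivl b @ ivls (a # as))"
        using plactic_append2[OF ivl_commute[of a n b], of "ivls as"] Cons.prems by simp
      also have "plactic n \<dots> (ivl b @ ivls (insort a as))"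
        using plactic_append1[OF Cons.IH, of "ivl b"] Cons.prems by simp
      finally show ?thesis using False by simp
    qed simp
  qed simp
  show ?thesis using assms
  proof (induction as)
    case (Cons a as)
    have "plactic n (ivls (a # as)) (ivls (a # sort as))"
      using plactic_append1[OF Cons.IH, of "ivl a"] Cons.prems by simp
    also have "plactic n \<dots> (ivls (sort (a # as)))"
      using ins[of a "sort as"] Cons.prems by simp
    finally show ?case .
  qed simp
qed

lemma col_prec_ivl:
  assumes "a \<le> b" "b \<le> n"
  shows "col_prec n (ivl b) (ivl a)"
proof -
  have "bounded_counts n (ivl k)" for k by (simp add: bounded_counts_def U_ivl)
  then show ?thesis
    using assms is_column_ivl[of a n] is_column_ivl[of b n]
    by (auto simp: col_prec_iff_fits fits_def fits_at_def U_ivl min_def)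
qed

lemma is_tableau_ivls:
  "sorted as \<Longrightarrow> \<forall>a\<in>set as. 1 \<le> a \<and> a \<le> n \<Longrightarrow> is_tableau n (map ivl as)"
proof (induction as)
  case (Cons a as)
  then show ?case by (cases as) (auto simp: is_tableau_Cons admissible_ivl col_prec_ivl)
qed simp

lemma contractible_ivl:
  assumes "1 \<le> k" "k \<le> n"
  shows "contractible n (ivl k @ [- int k]) (int k)" "remove_pair (int k) (ivl k @ [- int k]) = ivl (k - 1)"
proof -
  have col: "is_column n (ivl k @ [- int k])"
    using assms is_column_ivl[of k n]
    by (auto simp: is_column_append is_column_Cons set_ivl is_letter_def lless_def lkey_def)
  have "U (ivl k @ [- int k]) y = U (ivl k) y" for y
    unfolding U_def using assms by (intro arg_cong[where f = "\<lambda>A. int (card A)"]) auto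
  moreover have "V (ivl k @ [- int k]) y = of_bool (int k \<le> y)" for y
  proof -
    have "{x \<in> set (ivl k @ [- int k]). - y \<le> x \<and> x < 0} = (if int k \<le> y then {- int k} else {})"
      using assms by (auto simp: set_ivl)
    then show ?thesis unfolding V_def by simp
  qed
  ultimately show "contractible n (ivl k @ [- int k]) (int k)"
    using assms col by (auto simp: contractible_def U_ivl)
  obtain k' where k: "k = Suc k'" using assms by (cases k) auto
  have "remove_pair (int k) (ivl k') = ivl k'"
    unfolding filter_id_conv using k by (auto simp: set_ivl)
  then show "remove_pair (int k) (ivl k @ [- int k]) = ivl (k - 1)"
    using k by (simp add: ivl_Suc)
qed

text \<open>The prefix w is again of highest weight, and the last letter x requires a + of w to
  cancel its -. If x = 1 there is no -, and a new column [1] starts. If x = k+1 or x = bar k, a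
  column of length k must occur; it commutes to the end and there absorbs x, becoming the column of
  length k+1, or that of length k-1 by a contraction.\<close>

lemma highest_weight_word_plactic:
  assumes "\<forall>x\<in>set w. is_letter n x" "\<forall>i. eps n i w = 0"
  shows "\<exists>as. (\<forall>a\<in>set as. 1 \<le> a \<and> a \<le> n) \<and> plactic n (ivls as) w"
  using assms
proof (induction w rule: rev_induct)
  case Nil
  show ?case by (intro exI[of _ "[]"]) simp
next
  case (snoc x w)
  have e: "eps n i w = 0" "eps n i [x] \<le> phi n i w" for i
    using snoc.prems(2)[rule_format, of i] by (auto simp only: eps_append)
  obtain as where as: "\<forall>a\<in>set as. 1 \<le> a \<and> a \<le> n" "plactic n (ivls as) w"
    using snoc.IH snoc.prems(1) e(1) by auto
  \<comment> \<open>Here r is the length of the column after absorbing x; r = 0 means that the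
    column disappears.\<close>
  have step: ?case if k: "1 \<le> k" "k \<le> n" and ek: "eps n k [x] > 0" and r: "plactic n (ivl k @ [x]) (ivl r)" "r \<le> n" for k r
  proof -
    have "phi n k (ivls as) > 0" using e(2)[of k] ek plactic_fw(2)[OF as(2), of k] by simp
    then have "k \<in> set as" using phi_ivls_pos[of as n k] as(1) k by auto
    then obtain us vs where uv: "as = us @ k # vs" by (meson split_list)
    have "plactic n (ivls us @ ivls vs @ ivl r) (ivls us @ ivls vs @ ivl k @ [x])"
      using plactic_append1[OF plactic_sym[OF r(1)], of "ivls us @ ivls vs"] by simp
    also have "plactic n \<dots> (ivls as @ [x])"
      using plactic_append[OF plactic_sym[OF ivl_ivls_commute[of k n vs]], of "ivls us" "[x]"] as(1) uv by simp
    also have "plactic n \<dots> (w @ [x])" using plactic_append2[OF as(2)] .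
    finally have *: "plactic n (ivls us @ ivls vs @ ivl r) (w @ [x])" .
    show ?thesis
    proof (cases "r = 0")
      case True
      then show ?thesis using * as(1) uv by (intro exI[of _ "us @ vs"]) auto
    next
      case False
      then show ?thesis using * as(1) uv r(2) by (intro exI[of _ "us @ vs @ [r]"]) auto
    qed
  qed
  have x: "is_letter n x" using snoc.prems(1) by simp
  consider "x = 1" | k where "1 \<le> k" "k < n" "x = int k + 1" | k where "1 \<le> k" "k \<le> n" "x = - int k"
  proof -
    have "x \<noteq> 0" "\<bar>x\<bar> \<le> int n" using x by (auto simp: is_letter_def)
    then show thesis using that(1) that(2)[of "nat (x - 1)"] that(3)[of "nat (- x)"]
      by (cases "x = 1"; cases "x > 0") auto
  qed
  then show ?case
  proof cases
    case 1
    then show ?thesis using as plactic_append2[OF as(2), of "[x]"] x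
      by (intro exI[of _ "as @ [1]"]) (auto simp: ivl_1 is_letter_def)
  next
    case (2 k)
    then show ?thesis by (intro step[of k "Suc k"]) (auto simp: ivl_Suc el_def)
  next
    case (3 k)
    have "plactic n (ivl k @ [x]) (ivl (k - 1))"
    proof -
      have "plac_step n (ivl k @ [x]) (ivl (k - 1))"
        using contractible_plac_rel[OF contractible_ivl(1)[OF 3(1,2)]] contractible_ivl(2)[OF 3(1,2)] 3(3)
        unfolding plac_step_def by (metis append_Nil append_Nil2)
      then show ?thesis by (rule plac_step_plactic)
    qed
    then show ?thesis using 3 by (intro step[of k "k - 1"]) (auto simp: el_def)
  qed
qed

lemma fw_letters:
  assumes "fw n i w = Some w'"
  shows "(\<forall>x\<in>set w. is_letter n x) \<longleftrightarrow> (\<forall>x\<in>set w'. is_letter n x)"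
proof -
  obtain a x y b where ab: "w = a @ x # b" "w' = a @ y # b" "fl n i x = Some y"
    using fw_SomeD[OF assms] by blast
  then have "is_letter n x \<and> is_letter n y" by (auto simp: fl_def is_letter_def split: if_splits)
  then show ?thesis using ab by auto
qed

lemma tableau_exists:
  "\<forall>x\<in>set w. is_letter n x \<Longrightarrow> \<exists>ds. is_tableau n ds \<and> plactic n (concat ds) w"
proof (induction w rule: crystal_induct[where n = n])
  case (1 w)
  show ?case
  proof (cases "\<exists>i. eps n i w > 0")
    case True
    then obtain i v where v: "fw n i v = Some w" using eps_pos_ex by metis
    then obtain ds where ds: "is_tableau n ds" "plactic n (concat ds) v"
      using 1 fw_letters[OF v] by blast
    obtain b where b: "fw n i (concat ds) = Some b" "plactic n w b"
      using plactic_fw_Some[OF plactic_sym[OF ds(2)] v] .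
    obtain ds' where ds': "map length ds' = map length ds" "concat ds' = b"
      using split_like[of b ds] fw_length[OF b(1)] by auto
    have "is_tableau n ds'" using tableau_fw_iff[of n i ds ds'] b(1) ds' ds(1) by simp
    then show ?thesis using ds'(2) plactic_sym[OF b(2)] by auto
  next
    case False
    then obtain as where as: "\<forall>a\<in>set as. 1 \<le> a \<and> a \<le> n" "plactic n (ivls as) w"
      using highest_weight_word_plactic[OF 1(2)] by auto
    have "plactic n (ivls (sort as)) w"
      using plactic_trans[OF plactic_sym[OF ivls_sort] as(2)] as(1) by auto
    moreover have "is_tableau n (map ivl (sort as))" using is_tableau_ivls[of "sort as" n] as(1) by simp
    ultimately show ?thesis by blast
  qed
qed

text \<open>With 1, ..., m the longest initial run in d, the least unbarred letter beyond it would
  give a - for an index greater than a. The barred letter bar j with j greatest is excluded as well: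
  for j \<le> m the letters 1, ..., j and bar j already violate N(j) \<le> j, and for j > m neither
  j nor bar(j+1) is there to cancel its -.\<close>

lemma column_hw_above:
  assumes adm: "admissible_column n d" and sub: "{1..int a} \<subseteq> set d"
    and e: "\<And>i. a < i \<Longrightarrow> eps n i d = 0"
  shows "d = ivl (length d) \<and> a \<le> length d"
proof -
  have col: "is_column n d" and bc: "bounded_counts n d" using adm by (auto simp: admissible_iff)
  have rng: "x \<in> set d \<Longrightarrow> x \<noteq> 0 \<and> - int n \<le> x \<and> x \<le> int n" for x
    using is_column_letter[OF col, of x] by (auto simp: is_letter_def)
  define m where "m = (LEAST m. int m + 1 \<notin> set d)"
  have m: "int m + 1 \<notin> set d"
    unfolding m_def by (rule LeastI[of _ n]) (use rng in force)
  have lt: "int k + 1 \<in> set d" if "k < m" for k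
    using not_less_Least that unfolding m_def by blast
  have le: "x \<in> set d" if "1 \<le> x" "x \<le> int m" for x
    using lt[of "nat (x - 1)"] that by simp
  have am: "a \<le> m"
  proof (rule ccontr)
    assume "\<not> a \<le> m"
    then have "int m + 1 \<in> {1..int a}" by simp
    then show False using sub m by blast
  qed
  have pos: "x \<le> int m" if "x \<in> set d" "0 < x" for x
  proof -
    have "\<not> (\<exists>j. int m < int j + 1 \<and> int j + 1 \<in> set d)"
    proof
      assume ex: "\<exists>j. int m < int j + 1 \<and> int j + 1 \<in> set d"
      define j where "j = (LEAST j. int m < int j + 1 \<and> int j + 1 \<in> set d)"
      have j: "int m < int j + 1" "int j + 1 \<in> set d" using LeastI_ex[OF ex] by (auto simp: j_def)
      have "j \<noteq> m" using j m by auto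
      then have jm: "m < j" using j by simp
      have "int j \<notin> set d"
        using not_less_Least[of "j - 1" "\<lambda>j. int m < int j + 1 \<and> int j + 1 \<in> set d"] jm
        unfolding j_def[symmetric] by (auto simp: of_nat_diff)
      moreover have "j < n" using rng[OF j(2)] by simp
      ultimately have "eps n j d > 0" using eps_column[OF col, of j] jm j(2) by simp
      then show False using e[of j] am jm by simp
    qed
    moreover have "int (nat (x - 1)) + 1 = x" using that by simp
    ultimately show ?thesis using that(1) by (metis not_le)
  qed
  have neg: "\<not> x < 0" if "x \<in> set d" for x
  proof
    assume "x < 0"
    \<comment> \<open>Writing the barred letters as bar(n - k) makes a LEAST over k select the
      greatest j.\<close>
    then have ex: "\<exists>j. - int (n - j) \<in> set d \<and> j < n"
      using rng[OF that] that by (intro exI[of _ "n - nat (- x)"]) (auto simp: of_nat_diff)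
    define k where "k = (LEAST j. - int (n - j) \<in> set d \<and> j < n)"
    define j where "j = n - k"
    have k: "- int (n - k) \<in> set d" "k < n" using LeastI_ex[OF ex] by (auto simp: k_def)
    have j: "- int j \<in> set d" "1 \<le> j" "j \<le> n" using k by (auto simp: j_def)
    show False
    proof (cases "j \<le> m")
      case True
      have "{1..int j} \<subseteq> {x \<in> set d. 0 < x \<and> x \<le> int j}" using le True by auto
      then have "card {1..int j} \<le> card {x \<in> set d. 0 < x \<and> x \<le> int j}" by (rule card_mono[rotated]) simp
      then have "int j \<le> U d (int j)" by (simp add: U_def)
      moreover have "V d (int j) \<ge> 1" using V_step[of "int j" d] j V_nonneg[of d "int j - 1"] by simp
      moreover have "U d (int j) + V d (int j) \<le> int j" using bc j by (simp add: bounded_counts_def)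
      ultimately show False by linarith
    next
      case False
      then have jd: "int j \<notin> set d" using pos[of "int j"] j by auto
      have "eps n j d > 0"
      proof (cases "j < n")
        case True
        have "- int j - 1 \<notin> set d"
        proof
          assume "- int j - 1 \<in> set d"
          moreover have "- int j - 1 = - int (n - (k - 1))" using True k by (simp add: j_def of_nat_diff)
          ultimately have "- int (n - (k - 1)) \<in> set d" by metis
          moreover have "k - 1 < k" "k - 1 < n" using True k by (auto simp: j_def)
          moreover have "\<not> (- int (n - (k - 1)) \<in> set d \<and> k - 1 < n)" if "k - 1 < k"
            by (rule not_less_Least[of "k - 1" "\<lambda>j. - int (n - j) \<in> set d \<and> j < n"])
              (use that in \<open>simp only: k_def[symmetric]\<close>)
          ultimately show False by blast
        qed
        then show ?thesis using eps_column[OF col j(2) True] jd j(1) by simp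
      next
        case False
        then have "j = n" using j by simp
        then show ?thesis using eps_column_n[OF col] jd j by simp
      qed
      then show False using e[of j] False am by simp
    qed
  qed
  have "set d = {1..int m}"
  proof
    show "set d \<subseteq> {1..int m}"
    proof
      fix x assume x: "x \<in> set d"
      then show "x \<in> {1..int m}" using pos[OF x] neg[OF x] rng[OF x] by auto
    qed
    show "{1..int m} \<subseteq> set d" using le by auto
  qed
  moreover have "m \<le> n"
  proof (cases m)
    case (Suc k)
    then show ?thesis using rng[OF lt[of k]] by simp
  qed simp
  ultimately have "d = ivl m" using is_column_eqI[OF col is_column_ivl] by (simp add: set_ivl)
  then show ?thesis using am by simp
qed

text \<open>Let a be the length of the last column before d, which is the longest so far. The order
  forces 1, ..., a into d. For indices above a no earlier column offers a +, so d itself has no -;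
  \<open>column_hw_above\<close> then leaves only a column 1 2 ... b with b \<ge> a.\<close>

lemma tableau_hw:
  assumes "is_tableau n ds" "\<forall>i. eps n i (concat ds) = 0"
  shows "\<exists>as. ds = map ivl as \<and> sorted as \<and> (\<forall>a\<in>set as. 1 \<le> a \<and> a \<le> n)"
  using assms
proof (induction ds rule: rev_induct)
  case (snoc d ds)
  have e: "eps n i (concat ds) = 0" "eps n i d \<le> phi n i (concat ds)" for i
    using snoc.prems(2)[rule_format, of i] by (auto simp: eps_append)
  obtain as where as: "ds = map ivl as" "sorted as" "\<forall>a\<in>set as. 1 \<le> a \<and> a \<le> n"
    using snoc.IH snoc.prems(1) e(1) by (auto simp: is_tableau_snoc)
  have adm: "admissible_column n d" using snoc.prems(1) by (simp add: is_tableau_snoc)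
  define a where "a = (if as = [] then 0 else last as)"
  have le_a: "b \<le> a" if "b \<in> set as" for b
    using that as(2) unfolding a_def
    by (cases as rule: rev_cases) (auto simp: sorted_append)
  have "{1..int a} \<subseteq> set d"
  proof (cases "as = []")
    case False
    then have an: "1 \<le> a" "a \<le> n" using as(3) by (auto simp: a_def)
    have "col_prec n d (ivl a)"
      using snoc.prems(1) False as(1) by (simp add: is_tableau_snoc a_def last_map)
    then have "fits n d (ivl a)"
      using col_prec_iff_fits[of n d "ivl a"] adm admissible_ivl[OF an] by (simp add: admissible_iff)
    then have "fits_at d (ivl a) (int a) (int a)" using an by (simp add: fits_def)
    then have "int a \<le> U d (int a)" by (simp add: fits_at_def U_ivl)
    then have "card {1..int a} \<le> card {x \<in> set d. 0 < x \<and> x \<le> int a}" by (simp add: U_def)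
    moreover have "{x \<in> set d. 0 < x \<and> x \<le> int a} \<subseteq> {1..int a}" by auto
    ultimately have "{x \<in> set d. 0 < x \<and> x \<le> int a} = {1..int a}" by (intro card_seteq) auto
    then show ?thesis by auto
  qed (simp add: a_def)
  moreover have "eps n i d = 0" if "a < i" for i
  proof (cases "i \<le> n")
    case True
    have "i \<notin> set as" using le_a that by force
    then have "phi n i (concat ds) = 0" using phi_ivls_pos[of as n i] as that True by auto
    then show ?thesis using e(2)[of i] by simp
  next
    case False
    then show ?thesis by (intro eps_outside) auto
  qed
  ultimately have d: "d = ivl (length d)" "a \<le> length d" using column_hw_above[OF adm] by blast+
  have "1 \<le> length d" using adm by (auto simp: admissible_iff Suc_le_eq)
  moreover have "length d \<le> n"
  proof -
    have "int (length d) \<in> set d" using d(1) \<open>1 \<le> length d\<close> set_ivl[of "length d"] by auto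
    then show ?thesis using adm is_column_letter by (force simp: admissible_iff is_letter_def)
  qed
  moreover have "sorted (as @ [length d])" using as(2) le_a d(2) by (auto simp: sorted_append intro: le_trans)
  ultimately show ?case using as d(1) by (intro exI[of _ "as @ [length d]"]) auto
qed simp

section \<open>Uniqueness and the number of columns\<close>

lemma weight_ivls: "1 \<le> k \<Longrightarrow> weight (ivls as) (int k) = int (length (filter (\<lambda>a. k \<le> a) as))"
proof (induction as)
  case (Cons a as)
  have "distinct (ivl a)" by (simp add: ivl_def distinct_map)
  then have "count_list (ivl a) x = of_bool (x \<in> {1..int a})" for x
    by (simp add: count_list_distinct set_ivl)
  then show ?case using Cons by (auto simp: weight_append weight_def)
qed (simp add: weight_def)

text \<open>The lists are partitions, and the counts are the parts of the conjugate partition; at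
  highest weight they are read off from the weight.\<close>

lemma sorted_eqI_counts:
  fixes as bs :: "nat list"
  assumes "sorted as" "sorted bs" "\<forall>a\<in>set as. 1 \<le> a" "\<forall>a\<in>set bs. 1 \<le> a"
    "\<And>k. 1 \<le> k \<Longrightarrow> length (filter (\<lambda>a. k \<le> a) as) = length (filter (\<lambda>a. k \<le> a) bs)"
  shows "as = bs"
proof -
  have len: "length as = length bs" using assms(3-5) by (metis (no_types, lifting) filter_True le_refl)
  have c: "length (filter (\<lambda>x. x \<le> v) (map int as)) = length (filter (\<lambda>x. x \<le> v) (map int bs))" for v
  proof (cases "0 \<le> v")
    case True
    have *: "length (filter (\<lambda>x. x \<le> v) (map int xs)) = length xs - length (filter (\<lambda>a. nat v + 1 \<le> a) xs)" for xs
    proof -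
      have "length (filter (\<lambda>x. x \<le> v) (map int xs)) = length (filter (\<lambda>a. \<not> nat v + 1 \<le> a) xs)"
        using True by (auto simp: filter_map o_def intro!: arg_cong[where f = length] filter_cong)
      then show ?thesis using sum_length_filter_compl[of "\<lambda>a. nat v + 1 \<le> a" xs] by linarith
    qed
    show ?thesis unfolding * using assms(5)[of "nat v + 1"] len by simp
  next
    case False
    then show ?thesis by (simp add: filter_map o_def)
  qed
  have s: "sorted (map int as)" "sorted (map int bs)" using assms(1,2) by (simp_all add: sorted_map)
  have "map int as ! k = map int bs ! k" if "k < length as" for k
    using pointwise_le_iff_counts[OF s] pointwise_le_iff_counts[OF s(2,1)] c that len
    by (metis length_map order_antisym order_refl)
  then show ?thesis using len by (auto intro: nth_equalityI)
qed

text \<open>Away from highest weight both tableaux are pulled back along the same operator, cut at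
  the same lengths and identified by the induction hypothesis. The lengths together with the
  readings then identify the originals.\<close>

lemma tableau_unique:
  "is_tableau n ds \<Longrightarrow> is_tableau n ds' \<Longrightarrow> concat ds = w \<Longrightarrow> plactic n w (concat ds') \<Longrightarrow> ds = ds'"
proof (induction w arbitrary: ds ds' rule: crystal_induct[where n = n])
  case (1 w)
  show ?case
  proof (cases "\<exists>i. eps n i w > 0")
    case True
    then obtain i v where v: "fw n i v = Some w" using eps_pos_ex by metis
    obtain b where b: "fw n i b = Some (concat ds')" "plactic n v b" using plactic_fw_back[OF 1(5) v] .
    obtain es where es: "map length es = map length ds" "concat es = v"
      using split_like[of v ds] fw_length[OF v] 1(4) by auto
    obtain es' where es': "map length es' = map length ds'" "concat es' = b"
      using split_like[of b ds'] fw_length[OF b(1)] by auto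
    have "is_tableau n es" "is_tableau n es'"
      using tableau_fw_iff[of n i es ds] tableau_fw_iff[of n i es' ds'] v b es es' 1(2-4) by auto
    then have "es = es'" using 1(1)[OF v _ _ es(2)] b(2) es'(2) by blast
    then show ?thesis
      using concat_inj_lengths[of ds ds'] es es' v b(1) 1(4) by simp
  next
    case False
    then have "eps n i w = 0" "eps n i (concat ds') = 0" for i using plactic_fw(1)[OF 1(5)] by simp_all
    then obtain as bs where as: "ds = map ivl as" "sorted as" "\<forall>a\<in>set as. 1 \<le> a \<and> a \<le> n"
      and bs: "ds' = map ivl bs" "sorted bs" "\<forall>a\<in>set bs. 1 \<le> a \<and> a \<le> n"
      using tableau_hw 1(2-4) by metis
    have "length (filter (\<lambda>a. k \<le> a) as) = length (filter (\<lambda>a. k \<le> a) bs)" if "1 \<le> k" for k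
      using plactic_weight[OF 1(5), of "int k"] weight_ivls[OF that] as(1) bs(1) 1(4)[symmetric] that by simp
    then have "as = bs" using sorted_eqI_counts[OF as(2) bs(2)] as(3) bs(3) by blast
    then show ?thesis using as bs by simp
  qed
qed

text \<open>At highest weight each column of the tableau contains exactly one letter 1 and no bar 1,
  so the weight at 1 is its number of columns, whereas an arbitrary column contributes at most one
  to this weight. Raising reduces to this case, since it changes neither number of columns.\<close>

lemma tableau_length_le:
  "is_tableau n ds \<Longrightarrow> \<forall>c\<in>set cs. is_column n c \<Longrightarrow> concat ds = w \<Longrightarrow> plactic n w (concat cs)
     \<Longrightarrow> length ds \<le> length cs"
proof (induction w arbitrary: ds cs rule: crystal_induct[where n = n])
  case (1 w)
  show ?case
  proof (cases "\<exists>i. eps n i w > 0")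
    case True
    then obtain i v where v: "fw n i v = Some w" using eps_pos_ex by metis
    obtain b where b: "fw n i b = Some (concat cs)" "plactic n v b" using plactic_fw_back[OF 1(5) v] .
    obtain es where es: "map length es = map length ds" "concat es = v"
      using split_like[of v ds] fw_length[OF v] 1(4) by auto
    obtain es' where es': "map length es' = map length cs" "concat es' = b"
      using split_like[of b cs] fw_length[OF b(1)] by auto
    have "is_tableau n es" "\<forall>c\<in>set es'. is_column n c"
      using tableau_fw_iff[of n i es ds] columns_fw_iff[of n i es' cs] v b es es' 1(2-4) by auto
    then have "length es \<le> length es'" using 1(1)[OF v _ _ es(2)] b(2) es'(2) by blast
    then show ?thesis using es(1) es'(1) by (metis length_map)
  next
    case False
    then obtain as where as: "ds = map ivl as" "sorted as" "\<forall>a\<in>set as. 1 \<le> a \<and> a \<le> n"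
      using tableau_hw 1(2-4) by (metis neq0_conv)
    have "weight w 1 = int (length ds)"
      using weight_ivls[of 1 as] as 1(4) by (simp add: filter_True[of as])
    moreover have "weight (concat cs) 1 \<le> int (length cs)" using 1(3)
    proof (induction cs)
      case (Cons c cs)
      have "count_list c 1 \<le> 1"
        using is_column_distinct[of n c] Cons.prems by (simp add: count_list_distinct)
      then show ?case using Cons by (simp add: weight_append) (simp add: weight_def)
    qed (simp add: weight_def)
    ultimately show ?thesis using plactic_weight[OF 1(5), of 1] by simp
  qed
qed

lemma tableau_of_eq:
  assumes "is_tableau n ds" "plactic n (concat ds) w"
  shows "tableau_of n w = ds"
  unfolding tableau_of_def
proof (rule the_equality)
  fix es assume "is_tableau n es \<and> plactic n (concat es) w"
  then show "es = ds" using tableau_unique[OF _ assms(1) refl] plactic_trans plactic_sym assms(2) by blast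
qed (use assms in blast)

lemma tableau_of_props:
  assumes "\<forall>x\<in>set w. is_letter n x"
  shows "is_tableau n (tableau_of n w)" "plactic n (concat (tableau_of n w)) w"
  using tableau_exists[OF assms] tableau_of_eq by metis+

text \<open>Lowering the tableau of w and cutting at the old lengths gives a tableau that is plactic
  equivalent to w', hence the tableau of w' by uniqueness. The equality of lengths later keeps the
  symbols epsilon in place.\<close>

lemma tableau_of_fw:
  assumes "\<forall>x\<in>set w. is_letter n x" "fw n i w = Some w'"
  shows "fw n i (concat (tableau_of n w)) = Some (concat (tableau_of n w'))"
    "map length (tableau_of n w) = map length (tableau_of n w')"
proof -
  note T = tableau_of_props[OF assms(1)]
  obtain b where b: "fw n i (concat (tableau_of n w)) = Some b" "plactic n w' b"
    using plactic_fw_Some[OF plactic_sym[OF T(2)] assms(2)] .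
  obtain ds where ds: "map length ds = map length (tableau_of n w)" "concat ds = b"
    using split_like[of b "tableau_of n w"] fw_length[OF b(1)] by auto
  have "is_tableau n ds" using tableau_fw_iff[of n i "tableau_of n w" ds] b(1) ds T(1) by simp
  then have "tableau_of n w' = ds" using tableau_of_eq ds(2) plactic_sym[OF b(2)] by blast
  then show "fw n i (concat (tableau_of n w)) = Some (concat (tableau_of n w'))"
    "map length (tableau_of n w) = map length (tableau_of n w')"
    using ds b(1) by auto
qed

section \<open>Rewriting in the crystal\<close>

text \<open>Keeping \<open>None\<close> apart from a length records where epsilon stands, which the
  reading cannot show; shape and reading together determine a word.\<close>

definition shape :: "int list option list \<Rightarrow> nat option list" where
  "shape ws = map (map_option length) ws"

lemma pw_Nil [simp]: "pw [] = []"
  and pw_Cons: "pw (c # ws) = pA c @ pw ws"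
  and pw_append: "pw (us @ ws) = pw us @ pw ws"
  by (simp_all add: pw_def)

lemma pA_simps [simp]: "pA None = []" "pA (Some c) = c"
  by (simp_all add: pA_def)

lemma length_pA_shape: "map_option length c = map_option length d \<Longrightarrow> length (pA c) = length (pA d)"
  by (cases c; cases d) auto

lemma pA_inj: "map_option length c = map_option length d \<Longrightarrow> pA c = pA d \<Longrightarrow> c = d"
  by (cases c; cases d) auto

lemma shape_resplit: "length w = length (pw ws) \<Longrightarrow> shape (resplit ws w) = shape ws \<and> pw (resplit ws w) = w"
proof (induction ws w rule: resplit.induct)
  case (3 c cs w)
  have "length (drop (length c) w) = length (pw cs)" using 3(2) by (simp add: pw_Cons)
  then show ?case using 3 by (simp add: shape_def pw_Cons)
qed (simp_all add: shape_def pw_Cons)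

lemma shape_pw_inj: "shape ws = shape vs \<Longrightarrow> pw ws = pw vs \<Longrightarrow> ws = vs"
proof (induction ws arbitrary: vs)
  case (Cons c ws)
  then obtain d vs' where vs: "vs = d # vs'" "map_option length c = map_option length d" "shape ws = shape vs'"
    by (cases vs) (auto simp: shape_def)
  then have "pA c = pA d \<and> pw ws = pw vs'"
    using Cons.prems(2) length_pA_shape[OF vs(2)] by (simp add: pw_Cons)
  then show ?case using vs Cons.IH pA_inj by blast
qed (simp add: shape_def)

lemma fA_iff: "fA n i ws = Some vs \<longleftrightarrow> shape ws = shape vs \<and> fw n i (pw ws) = Some (pw vs)"
proof
  assume "fA n i ws = Some vs"
  then obtain w where w: "fw n i (pw ws) = Some w" "vs = resplit ws w" by (auto simp: fA_def)
  then show "shape ws = shape vs \<and> fw n i (pw ws) = Some (pw vs)"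
    using shape_resplit[of w ws] fw_length[OF w(1)] by simp
next
  assume h: "shape ws = shape vs \<and> fw n i (pw ws) = Some (pw vs)"
  then have "shape (resplit ws (pw vs)) = shape vs \<and> pw (resplit ws (pw vs)) = pw vs"
    using shape_resplit[of "pw vs" ws] fw_length[of n i "pw ws" "pw vs"] by simp
  then have "resplit ws (pw vs) = vs" using shape_pw_inj by blast
  then show "fA n i ws = Some vs" using h by (simp add: fA_def)
qed

lemma shape_length: "shape ws = shape vs \<Longrightarrow> length ws = length vs"
  unfolding shape_def by (metis length_map)

lemma length_pw_shape: "shape ws = shape vs \<Longrightarrow> length (pw ws) = length (pw vs)"
proof (induction ws arbitrary: vs)
  case (Cons c ws)
  then obtain d vs' where vs: "vs = d # vs'" "map_option length c = map_option length d" "shape ws = shape vs'"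
    by (cases vs) (auto simp: shape_def)
  then show ?case using Cons.IH[OF vs(3)] length_pA_shape[OF vs(2)] by (simp add: pw_Cons)
qed (simp add: shape_def)

lemma fA_append:
  assumes "fA n i (us @ ws) = Some (us' @ ws')" "shape us = shape us'"
  shows "shape ws = shape ws'"
    and "fA n i us = Some us' \<and> ws' = ws \<and> eps n i (pw ws) < phi n i (pw us)
       \<or> us' = us \<and> fA n i ws = Some ws' \<and> phi n i (pw us) \<le> eps n i (pw ws)"
proof -
  have h: "shape (us @ ws) = shape (us' @ ws')" "fw n i (pw us @ pw ws) = Some (pw us' @ pw ws')"
    using assms(1) by (simp_all add: fA_iff pw_append)
  show s: "shape ws = shape ws'" using h(1) assms(2) by (simp add: shape_def)
  show "fA n i us = Some us' \<and> ws' = ws \<and> eps n i (pw ws) < phi n i (pw us)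
       \<or> us' = us \<and> fA n i ws = Some ws' \<and> phi n i (pw us) \<le> eps n i (pw ws)"
    using fw_append_Some[OF h(2) length_pw_shape[OF assms(2)]] shape_pw_inj assms(2) s
    unfolding fA_iff by metis
qed

lemma fA_appendI:
  assumes "shape us = shape us'" "shape ws = shape ws'"
    "fA n i us = Some us' \<and> ws' = ws \<and> eps n i (pw ws) < phi n i (pw us)
       \<or> us' = us \<and> fA n i ws = Some ws' \<and> phi n i (pw us) \<le> eps n i (pw ws)"
  shows "fA n i (us @ ws) = Some (us' @ ws')"
  using assms by (auto simp: fA_iff pw_append fw_append) (simp_all add: shape_def)

lemma acol_fA_iff:
  "fA n i ws = Some ws' \<Longrightarrow> (\<forall>c\<in>set ws. acol n c) \<longleftrightarrow> (\<forall>c\<in>set ws'. acol n c)"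
proof (induction ws arbitrary: ws')
  case Nil
  then show ?case by (simp add: fA_def fw_Nil)
next
  case (Cons c ws)
  obtain c' vs where ws': "ws' = c' # vs" "map_option length c = map_option length c'"
    using Cons.prems by (cases ws') (auto simp: fA_iff shape_def)
  have f: "fA n i ([c] @ ws) = Some ([c'] @ vs)" using Cons.prems ws' by simp
  have acol: "acol n c \<longleftrightarrow> acol n c'" if "fw n i (pA c) = Some (pA c')"
    using that ws'(2) fw_admissible by (cases c; cases c') (auto simp: acol_def fw_Nil)
  show ?case
    using fA_append(2)[OF f] ws' acol Cons.IH[of vs] by (auto simp: shape_def fA_iff pw_Cons)
qed

lemma acol_letters: "\<forall>c\<in>set ws. acol n c \<Longrightarrow> \<forall>x\<in>set (pw ws). is_letter n x"
proof (induction ws)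
  case (Cons c ws)
  have "\<forall>x\<in>set (pA c). is_letter n x" using Cons.prems
    by (cases c) (auto simp: acol_def admissible_iff intro: is_column_letter)
  then show ?case using Cons by (auto simp: pw_Cons)
qed simp

lemma acol_column: "acol n c \<Longrightarrow> is_column n (pA c)"
  by (cases c) (auto simp: acol_def admissible_iff)

lemma pw_pair: "pw [a, b] = pA a @ pA b"
  by (simp add: pw_Cons)

lemma acol_prec_fA:
  assumes "fA n i [a, b] = Some [a', b']" "acol n a" "acol n b"
  shows "acol_prec n b a \<longleftrightarrow> acol_prec n b' a'"
proof -
  have "map_option length a = map_option length a'" "map_option length b = map_option length b'"
    and "fw n i (pA a @ pA b) = Some (pA a' @ pA b')"
    using assms(1) by (auto simp: fA_iff shape_def pw_pair)
  then show ?thesis using assms(2,3) col_prec_fw[of n "pA b" "pA a" i "pA a'" "pA b'"]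
    by (cases a; cases a'; cases b; cases b') (auto simp: acol_prec_def acol_def)
qed

definition ins_word :: "nat \<Rightarrow> int list option \<Rightarrow> int list option \<Rightarrow> int list option list" where
  "ins_word n a b = [fst (acol_ins n a b), snd (acol_ins n a b)]"

lemma tableau_of_two_columns:
  assumes "acol n a" "acol n b"
  shows "length (tableau_of n (pw [a, b])) \<le> 2"
proof -
  have l: "\<forall>x\<in>set (pw [a, b]). is_letter n x" using acol_letters[of "[a, b]" n] assms by simp
  have "length (tableau_of n (pw [a, b])) \<le> length [pA a, pA b]"
    by (rule tableau_length_le[OF tableau_of_props(1)[OF l] _ refl])
      (use tableau_of_props(2)[OF l] acol_column assms in \<open>auto simp: pw_pair\<close>)
  then show ?thesis by simp
qed

text \<open>As the tableau has at most two columns, the default branch of \<open>acol_ins\<close> is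
  reached only by the empty tableau and no letters are lost. The shape is given in terms of the
  column lengths alone, which a lowering operator preserves.\<close>

lemma ins_word_props:
  assumes "acol n a" "acol n b"
  shows "pw (ins_word n a b) = concat (tableau_of n (pw [a, b]))"
    "\<forall>c\<in>set (ins_word n a b). acol n c"
    "shape (ins_word n a b) = (case map length (tableau_of n (pw [a, b])) of
        [k, l] \<Rightarrow> [Some k, Some l] | [k] \<Rightarrow> [None, Some k] | _ \<Rightarrow> [None, None])"
proof -
  have l: "\<forall>x\<in>set (pw [a, b]). is_letter n x" using acol_letters[of "[a, b]" n] assms by simp
  define ds where "ds = tableau_of n (pw [a, b])"
  have t: "is_tableau n ds" and len: "length ds \<le> 2"
    using tableau_of_props(1)[OF l] tableau_of_two_columns[OF assms] by (simp_all add: ds_def)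
  have "ds = [] \<or> (\<exists>d. ds = [d]) \<or> (\<exists>d e. ds = [d, e])"
    using len by (cases ds; cases "tl ds") (auto simp: le_Suc_eq numeral_2_eq_2)
  moreover have ins: "acol_ins n a b = (case ds of [d1, d2] \<Rightarrow> (Some d1, Some d2) | [d] \<Rightarrow> (None, Some d)
      | _ \<Rightarrow> (None, None))"
    unfolding acol_ins_def ds_def pw_pair by (rule refl)
  ultimately have "pw (ins_word n a b) = concat ds \<and> (\<forall>c\<in>set (ins_word n a b). acol n c)
    \<and> shape (ins_word n a b) = (case map length ds of
        [k, l] \<Rightarrow> [Some k, Some l] | [k] \<Rightarrow> [None, Some k] | _ \<Rightarrow> [None, None])"
    using t by (elim disjE exE) (simp_all add: ins_word_def ins pw_Cons shape_def acol_def is_tableau_Cons)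
  then show "pw (ins_word n a b) = concat (tableau_of n (pw [a, b]))"
    "\<forall>c\<in>set (ins_word n a b). acol n c"
    "shape (ins_word n a b) = (case map length (tableau_of n (pw [a, b])) of
        [k, l] \<Rightarrow> [Some k, Some l] | [k] \<Rightarrow> [None, Some k] | _ \<Rightarrow> [None, None])"
    by (simp_all add: ds_def)
qed

lemma ins_word_eps_phi:
  assumes "acol n a" "acol n b"
  shows "eps n i (pw (ins_word n a b)) = eps n i (pw [a, b])"
    "phi n i (pw (ins_word n a b)) = phi n i (pw [a, b])"
proof -
  have l: "\<forall>x\<in>set (pw [a, b]). is_letter n x" using acol_letters[of "[a, b]" n] assms by simp
  show "eps n i (pw (ins_word n a b)) = eps n i (pw [a, b])"
    "phi n i (pw (ins_word n a b)) = phi n i (pw [a, b])"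
    unfolding ins_word_props(1)[OF assms] using plactic_fw(1,2)[OF tableau_of_props(2)[OF l]] by blast+
qed

lemma ins_word_fA:
  assumes "fA n i [a, b] = Some [a', b']" "acol n a" "acol n b"
  shows "fA n i (ins_word n a b) = Some (ins_word n a' b')"
proof -
  have l: "\<forall>x\<in>set (pw [a, b]). is_letter n x" using acol_letters[of "[a, b]" n] assms by simp
  have a': "acol n a'" "acol n b'" using acol_fA_iff[OF assms(1)] assms(2,3) by auto
  have f: "fw n i (pw [a, b]) = Some (pw [a', b'])" using assms(1) by (simp add: fA_iff)
  show ?thesis
    using tableau_of_fw[OF l f] ins_word_props(1,3)[OF assms(2,3)] ins_word_props(1,3)[OF a']
    by (simp add: fA_iff)
qed

lemma shape_append: "shape (us @ ws) = shape us @ shape ws"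
  by (simp add: shape_def)

text \<open>Insertion keeps \<open>eps\<close> and \<open>phi\<close> of the pair, so before and
  after it the operator acts in the same one of left context, pair and right context. In the
  contexts the claim is immediate; in the pair it is \<open>acol_prec_fA\<close> and
  \<open>ins_word_fA\<close>.\<close>

lemma context_fA:
  assumes f: "fA n i (us @ [a, b] @ vs) = Some ws'" and ac: "\<forall>c\<in>set (us @ [a, b] @ vs). acol n c"
  obtains us' a' b' vs' where "ws' = us' @ [a', b'] @ vs'" "length us' = length us"
    "acol_prec n b a \<longleftrightarrow> acol_prec n b' a'"
    "fA n i (us @ ins_word n a b @ vs) = Some (us' @ ins_word n a' b' @ vs')"
proof -
  have acab: "acol n a" "acol n b" using ac by simp_all
  note ep = ins_word_eps_phi[OF acab]
  have sh: "shape ws' = shape us @ shape [a, b] @ shape vs"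
    using f[unfolded fA_iff] by (simp only: shape_append)
  have lw: "length ws' = length us + 2 + length vs"
    using arg_cong[OF sh, of length] by (simp add: shape_def)
  define us' where "us' = take (length us) ws'"
  define vs' where "vs' = drop (length us + 2) ws'"
  obtain a' b' where ab': "take 2 (drop (length us) ws') = [a', b']"
  proof -
    have "length (take 2 (drop (length us) ws')) = Suc (Suc 0)" using lw by simp
    then have "\<exists>x y. take 2 (drop (length us) ws') = [x, y]"
      by (simp only: length_Suc_conv length_0_conv) blast
    then show thesis using that by blast
  qed
  have ws': "ws' = us' @ [a', b'] @ vs'"
    unfolding us'_def vs'_def ab'[symmetric]
    by (metis append_take_drop_id drop_drop add.commute)
  have len: "length us' = length us"
    using lw by (simp add: us'_def)
  have s: "shape us = shape us'" "shape [a, b] = shape [a', b']" "shape vs = shape vs'"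
    using sh len unfolding ws' by (auto simp: shape_def)
  have f1: "fA n i (us @ ([a, b] @ vs)) = Some (us' @ ([a', b'] @ vs'))" using f ws' by simp
  have pwi: "pw ([a, b] @ vs) = pw [a, b] @ pw vs" "pw (ins_word n a b @ vs) = pw (ins_word n a b) @ pw vs"
    by (simp_all only: pw_append)
  have epv: "eps n i (pw (ins_word n a b @ vs)) = eps n i (pw ([a, b] @ vs))"
    "phi n i (pw (ins_word n a b @ vs)) = phi n i (pw ([a, b] @ vs))"
    unfolding pwi eps_append phi_append ep by simp_all
  have mid: "(acol_prec n b a \<longleftrightarrow> acol_prec n b' a') \<and> fA n i (ins_word n a b) = Some (ins_word n a' b')"
    if "fA n i [a, b] = Some [a', b']"
    using acol_prec_fA[OF that acab] ins_word_fA[OF that acab] by simp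
  have "(acol_prec n b a \<longleftrightarrow> acol_prec n b' a') \<and>
    fA n i (us @ ins_word n a b @ vs) = Some (us' @ ins_word n a' b' @ vs')"
    using fA_append(2)[OF f1 s(1)]
  proof (elim disjE conjE)
    assume h: "fA n i us = Some us'" "[a', b'] @ vs' = [a, b] @ vs"
      "eps n i (pw ([a, b] @ vs)) < phi n i (pw us)"
    then have eq: "a' = a" "b' = b" "vs' = vs" by auto
    show ?thesis unfolding eq using fA_appendI[OF s(1) refl] h epv by simp
  next
    assume h: "us' = us" "fA n i ([a, b] @ vs) = Some ([a', b'] @ vs')"
      "phi n i (pw us) \<le> eps n i (pw ([a, b] @ vs))"
    have "(acol_prec n b a \<longleftrightarrow> acol_prec n b' a') \<and>
      fA n i (ins_word n a b @ vs) = Some (ins_word n a' b' @ vs')"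
      using fA_append(2)[OF h(2) s(2)]
    proof (elim disjE conjE)
      assume k: "fA n i [a, b] = Some [a', b']" "vs' = vs" "eps n i (pw vs) < phi n i (pw [a, b])"
      have "shape (ins_word n a b) = shape (ins_word n a' b')" using mid[OF k(1)] by (simp add: fA_iff)
      then show ?thesis using mid[OF k(1)] fA_appendI[OF _ refl] k(2,3) ep by simp
    next
      assume k: "[a', b'] = [a, b]" "fA n i vs = Some vs'" "phi n i (pw [a, b]) \<le> eps n i (pw vs)"
      then show ?thesis using fA_appendI[OF refl s(3)] ep by simp
    qed
    moreover from this have "shape (ins_word n a b @ vs) = shape (ins_word n a' b' @ vs')"
      by (simp add: fA_iff)
    ultimately show ?thesis using fA_appendI[OF s(1)] h(1,3) epv by simp
  qed
  then show thesis using that[OF ws' len] by blast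
qed

lemma split_pair:
  assumes "Suc j < length w"
  shows "w = take j w @ [w ! j, w ! Suc j] @ drop (j + 2) w"
proof -
  have "drop j w = w ! j # w ! Suc j # drop (j + 2) w"
    using Cons_nth_drop_Suc[of j w] Cons_nth_drop_Suc[of "Suc j" w] assms by simp
  then show ?thesis using append_take_drop_id[of j w] by simp
qed

lemma rewrite_at_split:
  "rewrite_at n (us @ [a, b] @ vs) (length us) = us @ ins_word n a b @ vs"
  by (simp add: rewrite_at_def ins_word_def Let_def list_update_append nth_append)

lemma reducible_at_split:
  "reducible_at n (us @ [a, b] @ vs) (length us) \<longleftrightarrow> \<not> acol_prec n b a"
  by (simp add: reducible_at_def nth_append)

lemma rewrite_fA:
  assumes f: "fA n i w = Some w'" and ac: "\<forall>c\<in>set w. acol n c"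
  shows "reducible_at n w = reducible_at n w'"
    and "Suc j < length w \<Longrightarrow> fA n i (rewrite_at n w j) = Some (rewrite_at n w' j)
      \<and> (\<forall>c\<in>set (rewrite_at n w j). acol n c)"
proof -
  have main: "(reducible_at n w j \<longleftrightarrow> reducible_at n w' j) \<and> fA n i (rewrite_at n w j) = Some (rewrite_at n w' j)
      \<and> (\<forall>c\<in>set (rewrite_at n w j). acol n c)" if j: "Suc j < length w" for j
  proof -
    define us a b vs where "us = take j w" "a = w ! j" "b = w ! Suc j" "vs = drop (j + 2) w"
    then have w: "w = us @ [a, b] @ vs" and lu: "length us = j"
      using split_pair[OF j] j by simp_all
    have acab: "acol n a" "acol n b" using ac w by auto
    obtain us' a' b' vs' where w': "w' = us' @ [a', b'] @ vs'" "length us' = length us"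
      "acol_prec n b a \<longleftrightarrow> acol_prec n b' a'"
      "fA n i (us @ ins_word n a b @ vs) = Some (us' @ ins_word n a' b' @ vs')"
      using context_fA[of n i us a b vs w'] f ac w by metis
    have "\<forall>c\<in>set (us @ ins_word n a b @ vs). acol n c"
      using ins_word_props(2)[OF acab] ac w by auto
    then show ?thesis
      using w'(3,4) reducible_at_split[of n us a b vs] reducible_at_split[of n us' a' b' vs']
        rewrite_at_split[of n us a b vs] rewrite_at_split[of n us' a' b' vs'] w w'(1,2) lu by simp
  qed
  have len: "length w = length w'" using shape_length f[unfolded fA_iff] by blast
  show "reducible_at n w = reducible_at n w'"
  proof
    fix j
    show "reducible_at n w j = reducible_at n w' j"
    proof (cases "Suc j < length w")
      case False
      then show ?thesis using len by (simp add: reducible_at_def)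
    qed (use main in blast)
  qed
  show "Suc j < length w \<Longrightarrow> fA n i (rewrite_at n w j) = Some (rewrite_at n w' j)
      \<and> (\<forall>c\<in>set (rewrite_at n w j). acol n c)" using main by blast
qed

section \<open>Simulation of the two strategies along crystal edges\<close>

definition linked :: "nat \<Rightarrow> int list option list \<Rightarrow> int list option list \<Rightarrow> bool" where
  "linked n w w' \<longleftrightarrow> (\<forall>c\<in>set w. acol n c) \<and> (\<exists>i. fA n i w = Some w')"

lemma reducible_at_bound: "reducible_at n w j \<Longrightarrow> Suc j < length w"
  by (simp add: reducible_at_def)

text \<open>Linked words are reducible at the same positions, so the leftmost positions agree, and
  so do the rightmost ones; the rewritten words are linked by the same operator.\<close>

lemma linked_step:
  assumes "linked n w w'"
  shows "rel_option (linked n) (lstep n w) (lstep n w')" "rel_option (linked n) (rstep n w) (rstep n w')"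
proof -
  obtain i where f: "fA n i w = Some w'" and ac: "\<forall>c\<in>set w. acol n c"
    using assms by (auto simp: linked_def)
  note r = rewrite_fA[OF f ac]
  have l: "linked n (rewrite_at n w j) (rewrite_at n w' j)" if "reducible_at n w j" for j
    using r(2)[of j] reducible_at_bound[OF that] by (auto simp: linked_def)
  show "rel_option (linked n) (lstep n w) (lstep n w')"
    unfolding lstep_def r(1)[symmetric] using l LeastI_ex[of "reducible_at n w"] by auto
  show "rel_option (linked n) (rstep n w) (rstep n w')"
    unfolding rstep_def r(1)[symmetric]
    using l GreatestI_ex_nat[of "reducible_at n w" "length w"] reducible_at_bound[of n w] by fastforce
qed

text \<open>R is a bisimulation for s: by \<open>rel_option\<close> both sides stop together or both
  proceed to related states. Each direction is an induction on the run on one side.\<close>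

lemma strat_len_rel:
  assumes step: "\<And>w w'. R w w' \<Longrightarrow> rel_option R (s w) (s w')" and "R w w'"
  shows "strat_len s w k \<longleftrightarrow> strat_len s w' k"
proof -
  have 1: "strat_len s w k \<Longrightarrow> R w w' \<Longrightarrow> strat_len s w' k" for w k w'
  proof (induction arbitrary: w' rule: strat_len.induct)
    case (stop w)
    then show ?case using step[of w w'] strat_len.stop[of s w'] by simp
  next
    case (step w v k)
    then obtain v' where "s w' = Some v'" "R v v'"
      using assms(1)[of w w'] by (auto simp: option_rel_Some1)
    then show ?case using step.IH strat_len.step by metis
  qed
  have 2: "strat_len s w' k \<Longrightarrow> R w w' \<Longrightarrow> strat_len s w k" for w k w'
  proof (induction arbitrary: w rule: strat_len.induct)
    case (stop w')
    then show ?case using step[of w w'] strat_len.stop[of s w] by simp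
  next
    case (step w' v' k)
    then obtain v where "s w = Some v" "R v v'"
      using assms(1)[of w w'] by (auto simp: option_rel_Some2)
    then show ?case using step.IH strat_len.step by metis
  qed
  show ?thesis using 1 2 assms(2) by blast
qed

text \<open>The length predicates of the two words coincide for every k, so the descriptions in
  \<open>conf\<close> denote the same numbers.\<close>

lemma linked_conf:
  assumes "linked n w w'"
  shows "conf n w = conf n w'"
  using strat_len_rel[of "linked n" "lstep n", OF linked_step(1) assms]
    strat_len_rel[of "linked n" "rstep n", OF linked_step(2) assms]
  by (simp add: conf_def)

lemma same_component_conf:
  assumes "same_component n w w'" "\<forall>c\<in>set w. acol n c"
  shows "conf n w' = conf n w \<and> (\<forall>c\<in>set w'. acol n c)"
  using assms unfolding same_component_def
proof (induction rule: rtranclp_induct)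
  case (step v v')
  then have IH: "conf n v = conf n w" "\<forall>c\<in>set v. acol n c" by auto
  from step(2) show ?case
  proof
    assume "crystal_edge n v v'"
    then obtain i where f: "fA n i v = Some v'" by (auto simp: crystal_edge_def)
    then have "linked n v v'" using IH by (auto simp: linked_def)
    then show ?thesis using IH acol_fA_iff[OF f] linked_conf[of n v v'] by simp
  next
    assume "crystal_edge n v' v"
    then obtain i where f: "fA n i v' = Some v" by (auto simp: crystal_edge_def)
    then have "linked n v' v" using IH acol_fA_iff[OF f] by (auto simp: linked_def)
    then show ?thesis using IH acol_fA_iff[OF f] linked_conf[of n v' v] by simp
  qed
qed simp

theorem theorem3p11:
  fixes n :: nat and t u v :: "int list option" and w0 :: "int list option list"
  assumes "acol n t" and "acol n u" and "acol n v"
    and "same_component n [t, u, v] w0"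
    and "highest_weight n w0"
  shows "conf n [t, u, v] = conf n w0"
  using same_component_conf[OF assms(4)] assms(1-3) by simp

end
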